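(* Let $\mathcal P(\boldsymbol\alpha,\boldsymbol\ell)$ be a curvilinear polygon with quasi-eigenvalues $\sigma_1\le\sigma_2\le\dots$, and let $\nu_1\le\nu_2\le\dots$ be the eigenvalues of the quantum graph Laplacian $\Delta_{\mathcal G}$, both listed non-decreasingly with multiplicities. Then $\sigma_m^2=\nu_m$ for all $m\ge1$.
   Context: A curvilinear polygon $\mathcal P(\boldsymbol\alpha,\boldsymbol\ell)$: bounded simply connected planar domain bounded by $n$ smooth arcs $I_j$ of lengths $\ell_j>0$, vertices $V_1,\dots,V_n$ clockwise (cyclic indices), $I_j$ joins $V_{j-1}$ to $V_j$, interior angle $\alpha_j\in(0,\pi)$ at $V_j$. Quantum graph: $\mathcal G(\boldsymbol\ell)$ is the cyclic metric graph with vertices $V_1,\dots,V_n$ and edges $I_j$ (joining $V_{j-1},V_j$) of lengths $\ell_j$, with arc-length coordinate $s$ increasing from $V_{j-1}$ to $V_j$ along each $I_j$. For a function $g$ on $\mathcal G$, $g|_{V_j-0}$ and $g|_{V_j+0}$ denote the limits at $V_j$ along $I_j$ and along $I_{j+1}$ respectively. $\Delta_{\mathcal G}$ is the operator $f\mapsto -f''$ on $\bigoplus_j H^2(I_j)$ with matching conditions at each $V_j$: $\sin(\frac{\pi^2}{4\alpha_j})f|_{V_j+0}=\cos(\frac{\pi^2}{4\alpha_j})f|_{V_j-0}$ and $\cos(\frac{\pi^2}{4\alpha_j})f'|_{V_j+0}=\sin(\frac{\pi^2}{4\alpha_j})f'|_{V_j-0}$; it is self-adjoint, non-negative, with discrete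 spectrum. Equivalently its eigenvalues are the min-max values of $\sum_j\int_{I_j}|f'|^2$ over $\sum_j\int_{I_j}|f|^2$ on the form domain $\{f\in\bigoplus_jH^1(I_j):\sin(\frac{\pi^2}{4\alpha_j})f|_{V_j+0}=\cos(\frac{\pi^2}{4\alpha_j})f|_{V_j-0}\ \forall j\}$. Quasi-eigenvalues: $\mathcal E=\{\pi/(2k)\}$, $\mathcal O(\pi/(2k))=(-1)^k$. For $\alpha\notin\mathcal E$, $\mathtt A(\alpha)=\begin{pmatrix}\csc\frac{\pi^2}{2\alpha}&-i\cot\frac{\pi^2}{2\alpha}\\ i\cot\frac{\pi^2}{2\alpha}&\csc\frac{\pi^2}{2\alpha}\end{pmatrix}$, $\mathtt B(\ell,\sigma)=\operatorname{diag}(e^{i\ell\sigma},e^{-i\ell\sigma})$. If no $\alpha_j\in\mathcal E$: $\sigma\ge0$ is a quasi-eigenvalue iff $1$ is an eigenvalue of $\mathtt T(\sigma)=\mathtt A(\alpha_n)\mathtt B(\ell_n,\sigma)\cdots\mathtt A(\alpha_1)\mathtt B(\ell_1,\sigma)$, multiplicity (for $\sigma>0$) the geometric multiplicity, and multiplicity $1$ for $\sigma=0$. Otherwise, with exceptional vertices $V_{E_1},\dots,V_{E_K}$, $1\le E_1<\dots<E_K=n$, $E_0:=E_K$, $\mathtt U_\kappa(\sigma)=\mathtt B(\ell_{E_\kappa},\sigma)\mathtt A(\alpha_{E_\kappa-1})\mathtt B(\ell_{E_\kappa-1},\sigma)\cdots\mathtt A(\alpha_{E_{\kappa-1}+1})\mathtt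 B(\ell_{E_{\kappa-1}+1},\sigma)$ (indices mod $n$), $\mathbf X_{\rm even}=\frac1{\sqrt2}(e^{-i\pi/4},e^{i\pi/4})^T$, $\mathbf X_{\rm odd}=\frac1{\sqrt2}(e^{i\pi/4},e^{-i\pi/4})^T$, $\mathbf X(\alpha)=\mathbf X_{\rm even}$ if $\mathcal O(\alpha)=1$ else $\mathbf X_{\rm odd}$, $u\cdot v=u_1\bar v_1+u_2\bar v_2$: $\sigma\ge0$ is a quasi-eigenvalue iff $\mathtt U_\kappa(\sigma)\mathbf X(\alpha_{E_{\kappa-1}})\cdot\mathbf X(\alpha_{E_\kappa})=0$ for some $\kappa$, multiplicity of $\sigma>0$ the number of such $\kappa$, multiplicity of $0$ half the number of $\kappa$ with $\mathcal O(\alpha_{E_{\kappa-1}})\ne\mathcal O(\alpha_{E_\kappa})$. *)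

theory Defs
  imports "HOL-Analysis.Analysis" "Jordan_Normal_Form.Jordan_Normal_Form_Uniqueness"
begin

definition nxt :: "nat \<Rightarrow> nat \<Rightarrow> nat" where
  "nxt n j = (if j = n then 1 else j + 1)"

definition prv :: "nat \<Rightarrow> nat \<Rightarrow> nat" where
  "prv n j = (if j = 1 then n else j - 1)"

definition weak_deriv_on :: "real \<Rightarrow> (real \<Rightarrow> complex) \<Rightarrow> (real \<Rightarrow> complex) \<Rightarrow> bool" where
  "weak_deriv_on L f g \<longleftrightarrow>
     g \<in> borel_measurable lborel \<and>
     set_integrable lborel {0..L} (\<lambda>s. (cmod (g s))^2) \<and>
     (\<forall>s\<in>{0..L}. f s = f 0 + (LINT t:{0..s}|lborel. g t))"

definition H1_on :: "real \<Rightarrow> (real \<Rightarrow> complex) \<Rightarrow> bool" where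
  "H1_on L f \<longleftrightarrow> (\<exists>g. weak_deriv_on L f g)"

text \<open>Dirichlet integral of f over [0,L] (independent of the chosen weak derivative).\<close>
definition dirichlet_on :: "real \<Rightarrow> (real \<Rightarrow> complex) \<Rightarrow> real" where
  "dirichlet_on L f = (LINT s:{0..L}|lborel. (cmod ((SOME g. weak_deriv_on L f g) s))^2)"

text \<open>A function on the graph: f j s is the value on edge I_j at arc length s \<in> [0, ell j].\<close>
definition graph_L2 :: "nat \<Rightarrow> (nat \<Rightarrow> real) \<Rightarrow> (nat \<Rightarrow> real \<Rightarrow> complex) \<Rightarrow> real" where
  "graph_L2 n ell f = (\<Sum>j\<in>{1..n}. LINT s:{0..ell j}|lborel. (cmod (f j s))^2)"

definition graph_dirichlet :: "nat \<Rightarrow> (nat \<Rightarrow> real) \<Rightarrow> (nat \<Rightarrow> real \<Rightarrow> complex) \<Rightarrow> real" where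
  "graph_dirichlet n ell f = (\<Sum>j\<in>{1..n}. dirichlet_on (ell j) (f j))"

text \<open>Form domain: H^1 on every edge, with the matching condition
  sin(pi^2/(4 alpha_j)) f|_{V_j+0} = cos(pi^2/(4 alpha_j)) f|_{V_j-0};
  V_j+0 is the start (s = 0) of edge I_{j+1}, V_j-0 is the end (s = ell_j) of edge I_j.\<close>
definition form_domain :: "nat \<Rightarrow> (nat \<Rightarrow> real) \<Rightarrow> (nat \<Rightarrow> real) \<Rightarrow> (nat \<Rightarrow> real \<Rightarrow> complex) \<Rightarrow> bool" where
  "form_domain n alpha ell f \<longleftrightarrow>
     (\<forall>j\<in>{1..n}. H1_on (ell j) (f j)) \<and>
     (\<forall>j\<in>{1..n}. complex_of_real (sin (pi^2 / (4 * alpha j))) * f (nxt n j) 0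
                 = complex_of_real (cos (pi^2 / (4 * alpha j))) * f j (ell j))"

definition lin_comb :: "nat \<Rightarrow> (nat \<Rightarrow> nat \<Rightarrow> real \<Rightarrow> complex) \<Rightarrow> (nat \<Rightarrow> complex) \<Rightarrow> nat \<Rightarrow> real \<Rightarrow> complex" where
  "lin_comb m phi c = (\<lambda>j s. \<Sum>i<m. c i * phi i j s)"

text \<open>m-th min-max value (m \<ge> 1): infimum over m-dimensional subspaces (spanned by
  phi_0..phi_{m-1}, linearly independent in L^2 of the graph) of the maximum of the
  Rayleigh quotient on the subspace.\<close>
definition graph_eig :: "nat \<Rightarrow> (nat \<Rightarrow> real) \<Rightarrow> (nat \<Rightarrow> real) \<Rightarrow> nat \<Rightarrow> real" where
  "graph_eig n alpha ell m =
     Inf { Sup { graph_dirichlet n ell (lin_comb m phi c) / graph_L2 n ell (lin_comb m phi c)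
               | c. \<exists>i<m. c i \<noteq> 0 }
         | phi. (\<forall>i<m. form_domain n alpha ell (phi i)) \<and>
                (\<forall>c. graph_L2 n ell (lin_comb m phi c) = 0 \<longrightarrow> (\<forall>i<m. c i = 0)) }"

definition exc_angle :: "real \<Rightarrow> bool" where
  "exc_angle a \<longleftrightarrow> (\<exists>k::nat. k \<ge> 1 \<and> a = pi / (2 * real k))"

definition Opar :: "real \<Rightarrow> int" where
  "Opar a = (-1) ^ (THE k::nat. k \<ge> 1 \<and> a = pi / (2 * real k))"

definition Amat :: "real \<Rightarrow> complex mat" where
  "Amat a = (let cs = complex_of_real (1 / sin (pi^2 / (2 * a)));
                 ct = complex_of_real (cot (pi^2 / (2 * a)))
             in mat_of_rows_list 2 [[cs, - \<i> * ct], [\<i> * ct, cs]])"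

definition Bmat :: "real \<Rightarrow> real \<Rightarrow> complex mat" where
  "Bmat l \<sigma> = mat_of_rows_list 2
     [[exp (\<i> * complex_of_real (l * \<sigma>)), 0], [0, exp (- \<i> * complex_of_real (l * \<sigma>))]]"

definition X_even :: "complex vec" where
  "X_even = vec_of_list [exp (- \<i> * pi / 4) / sqrt 2, exp (\<i> * pi / 4) / sqrt 2]"

definition X_odd :: "complex vec" where
  "X_odd = vec_of_list [exp (\<i> * pi / 4) / sqrt 2, exp (- \<i> * pi / 4) / sqrt 2]"

definition Xvec :: "real \<Rightarrow> complex vec" where
  "Xvec a = (if Opar a = 1 then X_even else X_odd)"

definition cdot :: "complex vec \<Rightarrow> complex vec \<Rightarrow> complex" where
  "cdot u v = u $ 0 * cnj (v $ 0) + u $ 1 * cnj (v $ 1)"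

fun Tprod :: "(nat \<Rightarrow> real) \<Rightarrow> (nat \<Rightarrow> real) \<Rightarrow> real \<Rightarrow> nat \<Rightarrow> complex mat" where
  "Tprod alpha ell \<sigma> 0 = 1\<^sub>m 2"
| "Tprod alpha ell \<sigma> (Suc j) = Amat (alpha (Suc j)) * Bmat (ell (Suc j)) \<sigma> * Tprod alpha ell \<sigma> j"

definition Tmat :: "nat \<Rightarrow> (nat \<Rightarrow> real) \<Rightarrow> (nat \<Rightarrow> real) \<Rightarrow> real \<Rightarrow> complex mat" where
  "Tmat n alpha ell \<sigma> = Tprod alpha ell \<sigma> n"

definition exc_set :: "nat \<Rightarrow> (nat \<Rightarrow> real) \<Rightarrow> nat set" where
  "exc_set n alpha = {e \<in> {1..n}. exc_angle (alpha e)}"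

text \<open>For an exceptional vertex e, the number of steps back to the previous exceptional
  vertex (cyclically; equals n if e is the only exceptional vertex).\<close>
definition gap :: "nat \<Rightarrow> (nat \<Rightarrow> real) \<Rightarrow> nat \<Rightarrow> nat" where
  "gap n alpha e = (LEAST d. 0 < d \<and> exc_angle (alpha ((prv n ^^ d) e)))"

definition prev_exc :: "nat \<Rightarrow> (nat \<Rightarrow> real) \<Rightarrow> nat \<Rightarrow> nat" where
  "prev_exc n alpha e = (prv n ^^ gap n alpha e) e"

fun Wprod :: "nat \<Rightarrow> (nat \<Rightarrow> real) \<Rightarrow> (nat \<Rightarrow> real) \<Rightarrow> nat \<Rightarrow> real \<Rightarrow> nat \<Rightarrow> complex mat" where
  "Wprod n alpha ell e \<sigma> 0 = 1\<^sub>m 2"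
| "Wprod n alpha ell e \<sigma> (Suc d) = Wprod n alpha ell e \<sigma> d *
     (if d = 0 then Bmat (ell e) \<sigma>
      else Amat (alpha ((prv n ^^ d) e)) * Bmat (ell ((prv n ^^ d) e)) \<sigma>)"

text \<open>U for the block ending at exceptional vertex e (the paper's U_kappa with E_kappa = e).\<close>
definition Umat :: "nat \<Rightarrow> (nat \<Rightarrow> real) \<Rightarrow> (nat \<Rightarrow> real) \<Rightarrow> nat \<Rightarrow> real \<Rightarrow> complex mat" where
  "Umat n alpha ell e \<sigma> = Wprod n alpha ell e \<sigma> (gap n alpha e)"

definition U_cond :: "nat \<Rightarrow> (nat \<Rightarrow> real) \<Rightarrow> (nat \<Rightarrow> real) \<Rightarrow> nat \<Rightarrow> real \<Rightarrow> bool" where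
  "U_cond n alpha ell e \<sigma> \<longleftrightarrow>
     cdot (Umat n alpha ell e \<sigma> *\<^sub>v Xvec (alpha (prev_exc n alpha e))) (Xvec (alpha e)) = 0"

definition qmult :: "nat \<Rightarrow> (nat \<Rightarrow> real) \<Rightarrow> (nat \<Rightarrow> real) \<Rightarrow> real \<Rightarrow> nat" where
  "qmult n alpha ell \<sigma> =
    (if \<sigma> < 0 then 0
     else if exc_set n alpha = {} then
       (if \<sigma> = 0 then (if eigenvalue (Tmat n alpha ell 0) 1 then 1 else 0)
        else kernel_dim (char_matrix (Tmat n alpha ell \<sigma>) 1))
     else if \<sigma> = 0 then
       (if (\<exists>e\<in>exc_set n alpha. U_cond n alpha ell e 0)
        then card {e \<in> exc_set n alpha. Opar (alpha (prev_exc n alpha e)) \<noteq> Opar (alpha e)} div 2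
        else 0)
     else card {e \<in> exc_set n alpha. U_cond n alpha ell e \<sigma>})"

definition qcount :: "nat \<Rightarrow> (nat \<Rightarrow> real) \<Rightarrow> (nat \<Rightarrow> real) \<Rightarrow> real \<Rightarrow> nat" where
  "qcount n alpha ell \<sigma> = (\<Sum>\<tau>\<in>{\<tau>. 0 \<le> \<tau> \<and> \<tau> \<le> \<sigma> \<and> qmult n alpha ell \<tau> \<noteq> 0}. qmult n alpha ell \<tau>)"

definition quasi_eig :: "nat \<Rightarrow> (nat \<Rightarrow> real) \<Rightarrow> (nat \<Rightarrow> real) \<Rightarrow> nat \<Rightarrow> real" where
  "quasi_eig n alpha ell m = Inf {\<sigma>. 0 \<le> \<sigma> \<and> m \<le> qcount n alpha ell \<sigma>}"

end

theory Submission
  imports Defs "HOL-Library.Function_Algebras"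
begin

text \<open>
  Let \<open>q l = D - l M\<close>, with \<open>D\<close> the Dirichlet form and \<open>M\<close> the \<open>L\<^sup>2\<close> form. The \<open>m\<close>-th min-max value is the
  infimum of the \<open>l\<close> for which \<open>q l\<close> is negative definite on some \<open>m\<close>-dimensional subspace. Compactness
  arguments are avoided: cutting every edge into short pieces splits the form domain \<open>q l\<close>-orthogonally
  into the functions vanishing at all nodes, where \<open>q l\<close> is coercive by Poincare's inequality, and a
  finite-dimensional space of piecewise trigonometric functions. Diagonalising \<open>q l\<close> on the latter shows
  that, just above \<open>l\<close>, the index exceeds the index at \<open>l\<close> by at most the dimension of the kernel of
  \<open>q l\<close>. Since the index is left continuous and eigenfunctions with eigenvalue below \<open>l\<close> span a negative
  subspace, the index at \<open>l\<close> is the number of eigenvalues below \<open>l\<close>.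

  An eigenfunction is determined by its values and derivatives at the starts of the edges. The vector
  \<open>(a, i b)\<close> attached to \<open>a exp (i \<sigma> s) + b exp (- i \<sigma> s)\<close> is transported along an edge by
  \<open>B\<close> and across a non-exceptional vertex by \<open>A\<close>; at an exceptional vertex the matching conditions
  decouple into a Dirichlet and a Neumann condition, so that the graph splits into independent strings.
\<close>

section \<open>Hermitian forms on complex vector spaces\<close>

text \<open>The vectors are arbitrary functions of an edge number and a real, so those that vanish
  on all edges are invisible to both forms. Hence \<open>M\<close> is only semi-definite, and
  kernels are measured modulo \<open>M\<close>-null vectors (\<open>kernel_family\<close>); no
  Hilbert space or operator appears. The locale \<open>spectral_count\<close> lists what a concrete
  problem has to supply.

  The mesh condition \<delta>^2 (l + 1) \<le> 1 does two jobs: with Poincare's inequality it makes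
  \<open>q l\<close> at least \<open>M\<close> on functions vanishing at the nodes, and it keeps l
  below the Dirichlet eigenvalues of a cell, so that node values can be interpolated by solutions.

  Zero is the delicate value. For \<sigma> = 0 waves no longer produce all Cauchy data, and the
  transfer matrices have fixed vectors that belong to no eigenfunction. There the kernel is found
  directly: its elements have no Dirichlet energy, hence are constant on each edge. A string then
  contributes iff both its ends are Neumann, that is, iff it runs from an even to an odd vertex. The
  opposite parity change gives a Dirichlet string without kernel; this is the origin of the factor
  one half.\<close>

lemma homogeneous_system:
  fixes A :: "'r \<Rightarrow> 'i \<Rightarrow> 'a::field"
  assumes "finite R" "finite I" "card R < card I"
  shows "\<exists>c. (\<exists>i\<in>I. c i \<noteq> 0) \<and> (\<forall>r\<in>R. (\<Sum>i\<in>I. c i * A r i) = 0)"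
  using assms
proof (induction R arbitrary: I A rule: finite_induct)
  case empty
  then have "I \<noteq> {}" by auto
  then show ?case by (intro exI[of _ "\<lambda>_. 1"]) auto
next
  case (insert r R)
  show ?case
  proof (cases "\<forall>i\<in>I. A r i = 0")
    case True
    have "card R < card I" using insert by simp
    then obtain c where "\<exists>i\<in>I. c i \<noteq> 0" "\<forall>r\<in>R. (\<Sum>i\<in>I. c i * A r i) = 0"
      using insert.IH[of I A] insert.prems by auto
    with True show ?thesis by (intro exI[of _ c]) auto
  next
    case False
    then obtain p where p: "p \<in> I" "A r p \<noteq> 0" by auto
    \<comment> \<open>Gaussian elimination: row \<open>r\<close> is solved for the unknown
      \<open>p\<close>, whose coefficient there is non-zero; \<open>c'\<close> below is the back
      substitution.\<close>
    define A' where "A' = (\<lambda>r' i. A r' i - A r' p * A r i / A r p)"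
    have "card R < card (I - {p})" using insert p by simp
    then obtain c where c: "\<exists>i\<in>I - {p}. c i \<noteq> 0"
      "\<forall>r\<in>R. (\<Sum>i\<in>I - {p}. c i * A' r i) = 0"
      using insert.IH[of "I - {p}" A'] insert.prems by auto
    define s where "s = (\<Sum>i\<in>I - {p}. c i * A r i)"
    define c' where "c' = c(p := - s / A r p)"
    have sum: "(\<Sum>i\<in>I. c' i * A r' i) = - s / A r p * A r' p + (\<Sum>i\<in>I - {p}. c i * A r' i)" for r'
      by (subst sum.remove[OF insert.prems(1) p(1)]) (auto simp: c'_def intro!: sum.cong)
    have *: "(\<Sum>i\<in>I - {p}. c i * A' r' i) = (\<Sum>i\<in>I - {p}. c i * A r' i) - s / A r p * A r' p" for r'
      unfolding A'_def s_def
      by (simp add: algebra_simps sum_subtractf sum_distrib_left sum_divide_distrib)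
    have "(\<Sum>i\<in>I. c' i * A r' i) = 0" if "r' \<in> insert r R" for r'
      using that c(2) *[of r'] sum[of r'] p(2) by (auto simp: s_def)
    moreover have "\<exists>i\<in>I. c' i \<noteq> 0" using c(1) by (auto simp: c'_def)
    ultimately show ?thesis by blast
  qed
qed

text \<open>The laws are demanded on \<open>V\<close> only, because additivity of the graph forms is
  available only where the integrals exist.\<close>

locale hermitian_form = vector_space scale
  for scale :: "complex \<Rightarrow> 'v::ab_group_add \<Rightarrow> 'v" (infixr "\<star>" 75) +
  fixes V :: "'v set" and B :: "'v \<Rightarrow> 'v \<Rightarrow> complex"
  assumes subspace_V: "subspace V"
    and add_left: "\<lbrakk>x \<in> V; y \<in> V; z \<in> V\<rbrakk> \<Longrightarrow> B (x + y) z = B x z + B y z"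
    and scale_left: "\<lbrakk>x \<in> V; z \<in> V\<rbrakk> \<Longrightarrow> B (c \<star> x) z = c * B x z"
    and hermitian: "\<lbrakk>x \<in> V; y \<in> V\<rbrakk> \<Longrightarrow> B y x = cnj (B x y)"
begin

lemmas V_closed = subspace_add[OF subspace_V] subspace_scale[OF subspace_V]
  subspace_diff[OF subspace_V] subspace_0[OF subspace_V] subspace_sum[OF subspace_V]

lemma add_right: "\<lbrakk>x \<in> V; y \<in> V; z \<in> V\<rbrakk> \<Longrightarrow> B z (x + y) = B z x + B z y"
  using hermitian[of "x + y" z] hermitian[of x z] hermitian[of y z] add_left[of x y z] V_closed(1)
  by simp

lemma scale_right: "\<lbrakk>x \<in> V; z \<in> V\<rbrakk> \<Longrightarrow> B z (c \<star> x) = cnj c * B z x"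
  using hermitian[of "c \<star> x" z] hermitian[of x z] scale_left[of x z c] V_closed(2) by simp

lemma diff_left: "\<lbrakk>x \<in> V; y \<in> V; z \<in> V\<rbrakk> \<Longrightarrow> B (x - y) z = B x z - B y z"
  using add_left[of "x - y" y z] V_closed(3) by simp

lemma diff_right: "\<lbrakk>x \<in> V; y \<in> V; z \<in> V\<rbrakk> \<Longrightarrow> B z (x - y) = B z x - B z y"
  using add_right[of "x - y" y z] V_closed(3) by simp

lemma zero_left [simp]: "z \<in> V \<Longrightarrow> B 0 z = 0"
  using diff_left[of z z z] by simp

lemma zero_right [simp]: "z \<in> V \<Longrightarrow> B z 0 = 0"
  using diff_right[of z z z] by simp

lemma sum_left: "\<lbrakk>\<And>i. i \<in> I \<Longrightarrow> f i \<in> V; z \<in> V\<rbrakk> \<Longrightarrow> B (\<Sum>i\<in>I. c i \<star> f i) z = (\<Sum>i\<in>I. c i * B (f i) z)"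
proof (induction I rule: infinite_finite_induct)
  case (insert x F)
  then show ?case by (simp add: add_left scale_left V_closed)
qed auto

lemma sum_right: "\<lbrakk>\<And>i. i \<in> I \<Longrightarrow> f i \<in> V; z \<in> V\<rbrakk> \<Longrightarrow> B z (\<Sum>i\<in>I. c i \<star> f i) = (\<Sum>i\<in>I. cnj (c i) * B z (f i))"
proof (induction I rule: infinite_finite_induct)
  case (insert x F)
  then show ?case by (simp add: add_right scale_right V_closed)
qed auto

lemma Im_eq_0: "x \<in> V \<Longrightarrow> Im (B x x) = 0"
  using hermitian[of x x] by (metis cnj.simps(2) equal_neg_zero)

lemma of_real_Re: "x \<in> V \<Longrightarrow> of_real (Re (B x x)) = B x x"
  using Im_eq_0[of x] by (simp add: complex_eq_iff)

lemma scale_scale: "x \<in> V \<Longrightarrow> B (c \<star> x) (c \<star> x) = of_real ((cmod c)\<^sup>2) * B x x"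
  using V_closed(2)[of x c] by (simp add: scale_left scale_right complex_norm_square mult_ac del: of_real_power)

text \<open>By the parallelogram identity the two sides differ by the form value at
  \<open>x - y\<close>.\<close>

lemma parallelogram_bound:
  assumes "x \<in> V" "y \<in> V" "0 \<le> Re (B (x - y) (x - y))"
  shows "Re (B (x + y) (x + y)) \<le> 2 * Re (B x x) + 2 * Re (B y y)"
  using assms V_closed by (simp add: add_left add_right diff_left diff_right)

lemma sum_orthogonal:
  assumes "finite I" "\<And>i. i \<in> I \<Longrightarrow> f i \<in> V"
    "\<And>i j. \<lbrakk>i \<in> I; j \<in> I; i \<noteq> j\<rbrakk> \<Longrightarrow> B (f i) (f j) = 0"
  shows "B (\<Sum>i\<in>I. a i \<star> f i) (\<Sum>i\<in>I. a i \<star> f i) = (\<Sum>i\<in>I. of_real ((cmod (a i))\<^sup>2) * B (f i) (f i))"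
proof -
  have S: "(\<Sum>i\<in>I. a i \<star> f i) \<in> V" using assms(2) by (intro V_closed) auto
  have "B (f i) (\<Sum>i\<in>I. a i \<star> f i) = cnj (a i) * B (f i) (f i)" if "i \<in> I" for i
  proof -
    have "B (f i) (\<Sum>i\<in>I. a i \<star> f i) = (\<Sum>j\<in>I. cnj (a j) * B (f i) (f j))"
      using assms(2) that by (intro sum_right) auto
    also have "\<dots> = (\<Sum>j\<in>I. if j = i then cnj (a i) * B (f i) (f i) else 0)"
      using assms(3) that by (intro sum.cong) auto
    finally show ?thesis using assms(1) that by simp
  qed
  then show ?thesis
    using assms(2) S
    by (subst sum_left) (auto simp: complex_norm_square mult_ac simp del: of_real_power intro!: sum.cong)
qed

text \<open>Replaces the equivalence of norms in finite dimension: the constant is built up one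
  vector at a time, each step costing a factor 2 from \<open>parallelogram_bound\<close>.\<close>

lemma sum_bound:
  assumes "finite T" "T \<subseteq> V" "\<And>x. x \<in> V \<Longrightarrow> 0 \<le> Re (B x x)"
  shows "\<exists>C\<ge>0. \<forall>a. Re (B (\<Sum>v\<in>T. a v \<star> v) (\<Sum>v\<in>T. a v \<star> v)) \<le> C * (\<Sum>v\<in>T. (cmod (a v))\<^sup>2)"
  using assms(1,2)
proof (induction T rule: finite_induct)
  case empty
  then show ?case using V_closed(4) by auto
next
  case (insert w T)
  then obtain C where C: "C \<ge> 0"
    "\<And>a. Re (B (\<Sum>v\<in>T. a v \<star> v) (\<Sum>v\<in>T. a v \<star> v)) \<le> C * (\<Sum>v\<in>T. (cmod (a v))\<^sup>2)"
    by auto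
  have w: "w \<in> V" using insert by auto
  define K where "K = 2 * Re (B w w) + 2 * C"
  have "Re (B (\<Sum>v\<in>insert w T. a v \<star> v) (\<Sum>v\<in>insert w T. a v \<star> v)) \<le> K * (\<Sum>v\<in>insert w T. (cmod (a v))\<^sup>2)" for a
  proof -
    define y where "y = (\<Sum>v\<in>T. a v \<star> v)"
    have y: "y \<in> V" "a w \<star> w \<in> V" using insert w by (auto simp: y_def intro!: V_closed)
    have "Re (B (a w \<star> w + y) (a w \<star> w + y)) \<le> 2 * Re (B (a w \<star> w) (a w \<star> w)) + 2 * Re (B y y)"
      using parallelogram_bound[OF y(2,1)] assms(3)[of "a w \<star> w - y"] y V_closed by auto
    also have "\<dots> = 2 * (cmod (a w))\<^sup>2 * Re (B w w) + 2 * Re (B y y)"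
      using scale_scale[OF w, of "a w"] by (simp del: of_real_power)
    also have "\<dots> \<le> 2 * (cmod (a w))\<^sup>2 * Re (B w w) + 2 * (C * (\<Sum>v\<in>T. (cmod (a v))\<^sup>2))"
      using C(2)[of a] by (simp add: y_def)
    also have "\<dots> \<le> K * ((cmod (a w))\<^sup>2 + (\<Sum>v\<in>T. (cmod (a v))\<^sup>2))"
      using C(1) assms(3)[OF w]
      by (simp add: K_def algebra_simps mult_nonneg_nonneg sum_nonneg)
    finally show ?thesis using insert by (simp add: y_def)
  qed
  moreover have "K \<ge> 0" using C(1) assms(3)[OF w] by (simp add: K_def)
  ultimately show ?case by blast
qed

lemma span_subset_V: "S \<subseteq> V \<Longrightarrow> span S \<subseteq> V"
  using span_minimal subspace_V by auto

lemma orthogonal_span: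
  assumes "v \<in> V" "S \<subseteq> V" "\<And>x. x \<in> S \<Longrightarrow> B x v = 0" "y \<in> span S"
  shows "B y v = 0"
proof -
  have "y \<in> V \<and> B y v = 0"
    using assms(4)
  proof (induction rule: span_induct_alt)
    case (step c x y)
    then show ?case using assms(1-3) by (auto simp: add_left scale_left V_closed subset_iff)
  qed (use assms(1) V_closed in auto)
  then show ?thesis by simp
qed

text \<open>Sylvester's law of inertia: a non-isotropic vector is split off until the form vanishes.\<close>

lemma diagonalise:
  assumes "finite S" "S \<subseteq> V"
  shows "\<exists>T. finite T \<and> span T = span S \<and>
    (\<forall>v\<in>T. \<forall>w\<in>T. v \<noteq> w \<longrightarrow> B v w = 0) \<and> (\<forall>v\<in>T. B v v \<in> {-1, 0, 1})"
  using assms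
proof (induction "card S" arbitrary: S rule: less_induct)
  case less
  show ?case
  proof (cases "\<forall>x\<in>S. \<forall>y\<in>S. B x y = 0")
    case True
    then show ?thesis using less.prems by (intro exI[of _ S]) auto
  next
    case False
    then obtain x y where xy: "x \<in> S" "y \<in> S" "B x y \<noteq> 0" by auto
    have V: "span S \<subseteq> V" using span_subset_V less.prems by auto
    have xyV: "x \<in> V" "y \<in> V" using xy less.prems by auto
    \<comment> \<open>If x and y are both isotropic, x + B(x,y) y has form value 2
      |B(x,y)|^2.\<close>
    have "\<exists>v\<in>span S. B v v \<noteq> 0"
    proof (cases "B x x = 0 \<and> B y y = 0")
      case True
      have c: "B x y \<star> y \<in> V" using xyV V_closed by auto
      have "B (x + B x y \<star> y) (x + B x y \<star> y) = 2 * (B x y * cnj (B x y))"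
        using True xyV c hermitian[of x y] V_closed
        by (simp add: add_left add_right scale_left scale_right)
      also have "\<dots> \<noteq> 0" using xy by simp
      finally show ?thesis using xy by (intro bexI) (auto intro: span_base span_add span_scale)
    qed (use xy span_base in auto)
    then obtain v0 where v0: "v0 \<in> span S" "B v0 v0 \<noteq> 0" by auto
    define r where "r = Re (B v0 v0)"
    have r: "r \<noteq> 0" "B v0 v0 = of_real r" using v0 V of_real_Re[of v0] by (auto simp: r_def)
    define v where "v = of_real (1 / sqrt \<bar>r\<bar>) \<star> v0"
    have v: "v \<in> span S" "v \<in> V" using v0 V by (auto simp: v_def intro: span_scale)
    have "B v v = of_real (r / \<bar>r\<bar>)"
      unfolding v_def using v0 V r scale_scale[of v0 "of_real (1 / sqrt \<bar>r\<bar>)"]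
      by (auto simp: power_divide norm_divide)
    then have Bv: "B v v \<in> {-1, 1}" using r by (auto simp: abs_if)
    obtain a where a: "v = (\<Sum>x\<in>S. a x \<star> x)"
      using v(1) span_finite[OF less.prems(1)] by auto
    have "\<exists>x0\<in>S. a x0 \<noteq> 0"
    proof (rule ccontr)
      assume "\<not> ?thesis"
      then have "v = 0" using a by simp
      then show False using Bv v by auto
    qed
    \<comment> \<open>A generator occurring in \<open>v\<close> is exchanged for \<open>v\<close>;
      the projections of the other generators along \<open>v\<close> form a smaller set for the
      induction.\<close>
    then obtain x0 where x0: "x0 \<in> S" "a x0 \<noteq> 0" by auto
    define P where "P = (\<lambda>x. x - (B x v / B v v) \<star> v)"
    define S' where "S' = P ` (S - {x0})"
    have PV: "P x \<in> V" if "x \<in> V" for x using that v V_closed by (auto simp: P_def)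
    have Pspan: "P x \<in> span S" if "x \<in> S" for x
      using that v by (auto simp: P_def intro: span_diff span_scale span_base)
    have Porth: "B (P x) v = 0" if "x \<in> V" for x
      using that v Bv V_closed(2) by (auto simp: P_def diff_left scale_left)
    have S': "finite S'" "S' \<subseteq> V" "card S' < card S" "S' \<subseteq> span S"
    proof -
      have "card S' \<le> card (S - {x0})" unfolding S'_def using less.prems by (intro card_image_le) auto
      also have "\<dots> < card S" using x0 less.prems(1) by (intro psubset_card_mono) auto
      finally show "card S' < card S" .
    qed (use less.prems PV Pspan in \<open>auto simp: S'_def\<close>)
    from less.hyps[OF S'(3) S'(1,2)] obtain T where T: "finite T" "span T = span S'"
      "\<forall>v\<in>T. \<forall>w\<in>T. v \<noteq> w \<longrightarrow> B v w = 0" "\<forall>v\<in>T. B v v \<in> {-1, 0, 1}" by auto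
    have TS': "T \<subseteq> span S'" using T(2) span_superset by auto
    have TV: "T \<subseteq> V" using TS' span_subset_V[OF S'(2)] by auto
    have orth: "B w v = 0" if "w \<in> T" for w
      by (rule orthogonal_span[OF v(2) S'(2)]) (use that TS' Porth less.prems in \<open>auto simp: S'_def\<close>)
    have orth': "B v w = 0" if "w \<in> T" for w
      using orth[OF that] hermitian[of w v] that TV v by auto
    have "span (insert v T) = span S"
    proof (rule subset_antisym; rule span_minimal[OF _ subspace_span])
      show "insert v T \<subseteq> span S"
        using v TS' S'(4) span_minimal[of S' "span S"] by auto
      have sub: "S' \<subseteq> span (insert v T)"
        using span_superset[of S'] T(2) span_mono[of T "insert v T"] by auto
      have vin: "v \<in> span (insert v T)" by (simp add: span_base)
      have 1: "x \<in> span (insert v T)" if "x \<in> S - {x0}" for x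
      proof -
        have "x = P x + (B x v / B v v) \<star> v" by (simp add: P_def)
        moreover have "P x \<in> span (insert v T)" using sub that by (auto simp: S'_def)
        ultimately show ?thesis using vin by (metis span_add span_scale)
      qed
      have "v = a x0 \<star> x0 + (\<Sum>x\<in>S - {x0}. a x \<star> x)"
        unfolding a by (rule sum.remove) (use less.prems x0 in auto)
      then have "(1 / a x0) \<star> (v - (\<Sum>x\<in>S - {x0}. a x \<star> x)) = x0"
        using x0 by (simp add: algebra_simps)
      moreover have "(1 / a x0) \<star> (v - (\<Sum>x\<in>S - {x0}. a x \<star> x)) \<in> span (insert v T)"
        using 1 vin by (intro span_scale span_diff span_sum) auto
      ultimately have "x0 \<in> span (insert v T)" by simp
      with 1 show "S \<subseteq> span (insert v T)" by auto
    qed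
    then show ?thesis
      using T orth orth' Bv by (intro exI[of _ "insert v T"]) auto
  qed
qed

end

section \<open>Two forms: index and eigenvalue counting\<close>

locale form_pair = vector_space scale +
  M: hermitian_form scale V M + D: hermitian_form scale V D
  for scale :: "complex \<Rightarrow> 'v::ab_group_add \<Rightarrow> 'v" (infixr "\<star>" 75)
    and V :: "'v set" and M D :: "'v \<Rightarrow> 'v \<Rightarrow> complex" +
  assumes M_nonneg: "x \<in> V \<Longrightarrow> 0 \<le> Re (M x x)"
    and D_nonneg: "x \<in> V \<Longrightarrow> 0 \<le> Re (D x x)"
begin

definition q :: "real \<Rightarrow> 'v \<Rightarrow> 'v \<Rightarrow> complex"
  where "q l x y = D x y - of_real l * M x y"

sublocale q: hermitian_form scale V "q l" for l
proof
  show "subspace V" by (rule M.subspace_V)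
qed (auto simp: q_def M.add_left D.add_left M.scale_left D.scale_left algebra_simps
       M.hermitian[symmetric] D.hermitian[symmetric])

lemmas V_closed = M.V_closed

definition comb :: "nat \<Rightarrow> (nat \<Rightarrow> 'v) \<Rightarrow> (nat \<Rightarrow> complex) \<Rightarrow> 'v"
  where "comb m \<phi> c = (\<Sum>i<m. c i \<star> \<phi> i)"

text \<open>Strict negativity for every non-zero coefficient vector forces the \<phi>'s to be
  linearly independent, so this speaks of genuinely m-dimensional subspaces.\<close>

definition negative :: "real \<Rightarrow> nat \<Rightarrow> bool"
  where "negative l m \<longleftrightarrow> (\<exists>\<phi>. (\<forall>i<m. \<phi> i \<in> V) \<and>
    (\<forall>c. (\<exists>i<m. c i \<noteq> 0) \<longrightarrow> Re (q l (comb m \<phi> c) (comb m \<phi> c)) < 0))"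

definition rayleigh_values :: "nat \<Rightarrow> real set"
  where "rayleigh_values m =
    {Sup {Re (D (comb m \<phi> c) (comb m \<phi> c)) / Re (M (comb m \<phi> c) (comb m \<phi> c)) | c. \<exists>i<m. c i \<noteq> 0} | \<phi>.
       (\<forall>i<m. \<phi> i \<in> V) \<and> (\<forall>c. Re (M (comb m \<phi> c) (comb m \<phi> c)) = 0 \<longrightarrow> (\<forall>i<m. c i = 0))}"

lemma Re_q: "Re (q l x y) = Re (D x y) - l * Re (M x y)"
  by (simp add: q_def)

lemma comb_in_V: "(\<And>i. i < m \<Longrightarrow> \<phi> i \<in> V) \<Longrightarrow> comb m \<phi> c \<in> V"
  unfolding comb_def by (intro V_closed) auto

lemma comb_span: "x \<in> span (\<phi> ` {..<m}) \<Longrightarrow> \<exists>c. x = comb m \<phi> c"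
proof (induction rule: span_induct_alt)
  case base
  show ?case by (intro exI[of _ "\<lambda>_. 0"]) (simp add: comb_def)
next
  case (step a x y)
  then obtain c i where "y = comb m \<phi> c" "i < m" "x = \<phi> i" by auto
  moreover have "a \<star> \<phi> i = (\<Sum>j<m. (if j = i then a else 0) \<star> \<phi> j)"
    using \<open>i < m\<close> by (simp add: if_distrib[of "\<lambda>c. c \<star> _"] sum.delta' cong: if_cong)
  ultimately show ?case
    by (intro exI[of _ "\<lambda>j. (if j = i then a else 0) + c j"])
       (simp add: comb_def scale_left_distrib sum.distrib)
qed

lemma negative_antimono: "negative l m \<Longrightarrow> k \<le> m \<Longrightarrow> negative l k"
proof -
  assume neg: "negative l m" and km: "k \<le> m"
  obtain \<phi> where \<phi>: "\<forall>i<m. \<phi> i \<in> V"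
    "\<And>c. (\<exists>i<m. c i \<noteq> 0) \<Longrightarrow> Re (q l (comb m \<phi> c) (comb m \<phi> c)) < 0"
    using neg unfolding negative_def by auto
  have "Re (q l (comb k \<phi> c) (comb k \<phi> c)) < 0" if "\<exists>i<k. c i \<noteq> 0" for c
  proof -
    have "comb k \<phi> c = comb m \<phi> (\<lambda>i. if i < k then c i else 0)"
      unfolding comb_def by (rule sum.mono_neutral_cong_left) (use km in auto)
    moreover have "\<exists>i<m. (if i < k then c i else 0) \<noteq> 0" using that km by force
    ultimately show ?thesis using \<phi>(2) by simp
  qed
  then show "negative l k" using \<phi>(1) km unfolding negative_def by (intro exI[of _ \<phi>]) auto
qed

lemma q_mono: "l \<le> l' \<Longrightarrow> x \<in> V \<Longrightarrow> Re (q l' x x) \<le> Re (q l x x)"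
  using M_nonneg[of x] by (simp add: Re_q mult_right_mono)

lemma negative_mono: "negative l m \<Longrightarrow> l \<le> l' \<Longrightarrow> negative l' m"
proof -
  assume neg: "negative l m" and l: "l \<le> l'"
  obtain \<phi> where \<phi>: "\<forall>i<m. \<phi> i \<in> V"
    "\<And>c. (\<exists>i<m. c i \<noteq> 0) \<Longrightarrow> Re (q l (comb m \<phi> c) (comb m \<phi> c)) < 0"
    using neg unfolding negative_def by auto
  have "Re (q l' (comb m \<phi> c) (comb m \<phi> c)) < 0" if "\<exists>i<m. c i \<noteq> 0" for c
    by (rule le_less_trans[OF q_mono[OF l comb_in_V] \<phi>(2)[OF that]]) (use \<phi>(1) in auto)
  then show "negative l' m" using \<phi>(1) unfolding negative_def by blast
qed

lemma negative_pos: "negative l m \<Longrightarrow> 1 \<le> m \<Longrightarrow> 0 < l"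
proof (rule ccontr)
  assume neg: "negative l m" and m: "1 \<le> m" and l: "\<not> 0 < l"
  obtain \<phi> where \<phi>: "\<forall>i<m. \<phi> i \<in> V"
    "\<And>c. (\<exists>i<m. c i \<noteq> 0) \<Longrightarrow> Re (q l (comb m \<phi> c) (comb m \<phi> c)) < 0"
    using neg unfolding negative_def by auto
  have "Re (q l (comb m \<phi> (\<lambda>_. 1)) (comb m \<phi> (\<lambda>_. 1))) < 0" using m by (intro \<phi>(2) exI[of _ 0]) auto
  moreover have "Re (q 0 (comb m \<phi> (\<lambda>_. 1)) (comb m \<phi> (\<lambda>_. 1))) \<ge> 0"
    using D_nonneg[OF comb_in_V] \<phi>(1) by (simp add: Re_q)
  moreover have "comb m \<phi> (\<lambda>_. 1) \<in> V" using \<phi>(1) by (intro comb_in_V) auto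
  ultimately show False using q_mono[of l 0 "comb m \<phi> (\<lambda>_. 1)"] l by simp
qed

text \<open>Stands in for compactness of the unit sphere: diagonalising the positive definite form
  \<open>Q\<close> turns it into the coefficient norm, which controls \<open>A\<close> by
  \<open>sum_bound\<close>. Used for left continuity of the index and for boundedness of Rayleigh
  quotients.\<close>

lemma dominated:
  assumes A: "hermitian_form scale V A" and A_nonneg: "\<And>x. x \<in> V \<Longrightarrow> 0 \<le> Re (A x x)"
    and Q: "hermitian_form scale V Q"
    and \<phi>: "\<And>i. i < m \<Longrightarrow> \<phi> i \<in> V"
    and pos: "\<And>c. (\<exists>i<m. c i \<noteq> 0) \<Longrightarrow> 0 < Re (Q (comb m \<phi> c) (comb m \<phi> c))"
  shows "\<exists>C\<ge>0. \<forall>c. Re (A (comb m \<phi> c) (comb m \<phi> c)) \<le> C * Re (Q (comb m \<phi> c) (comb m \<phi> c))"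
proof -
  interpret A: hermitian_form scale V A by (rule A)
  interpret Q: hermitian_form scale V Q by (rule Q)
  have "\<phi> ` {..<m} \<subseteq> V" using \<phi> by auto
  from Q.diagonalise[OF _ this] obtain T where T: "finite T" "span T = span (\<phi> ` {..<m})"
    "\<forall>v\<in>T. \<forall>w\<in>T. v \<noteq> w \<longrightarrow> Q v w = 0" "\<forall>v\<in>T. Q v v \<in> {-1, 0, 1}" by auto
  \<comment> \<open>The diagonal family may contain the zero vector. Every other member has a
    positive \<open>Q\<close>-value, hence the value 1.\<close>
  define T1 where "T1 = T - {0}"
  have TV: "T \<subseteq> V" using T(2) span_superset[of T] Q.span_subset_V[OF \<open>\<phi> ` {..<m} \<subseteq> V\<close>] by auto
  have one: "Q v v = 1" if v: "v \<in> T1" for v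
  proof -
    have "v \<in> span (\<phi> ` {..<m})" using v T(2) span_superset[of T] by (auto simp: T1_def)
    then obtain c where c: "v = comb m \<phi> c" using comb_span[of v \<phi> m] by auto
    have "\<exists>i<m. c i \<noteq> 0"
    proof (rule ccontr)
      assume "\<not> ?thesis"
      then have "v = 0" using c by (simp add: comb_def)
      then show False using v by (simp add: T1_def)
    qed
    then have "0 < Re (Q v v)" using pos c by auto
    then show ?thesis using T(4) v by (auto simp: T1_def)
  qed
  obtain C where C: "C \<ge> 0"
    "\<And>a. Re (A (\<Sum>v\<in>T1. a v \<star> v) (\<Sum>v\<in>T1. a v \<star> v)) \<le> C * (\<Sum>v\<in>T1. (cmod (a v))\<^sup>2)"
    using A.sum_bound[of T1] T(1) TV A_nonneg by (auto simp: T1_def)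
  have "Re (A (comb m \<phi> c) (comb m \<phi> c)) \<le> C * Re (Q (comb m \<phi> c) (comb m \<phi> c))" for c
  proof -
    have "comb m \<phi> c \<in> span T"
      unfolding T(2) comb_def by (intro span_sum span_scale span_base) auto
    then obtain a where a: "comb m \<phi> c = (\<Sum>v\<in>T. a v \<star> v)" using span_finite[OF T(1)] by auto
    also have "\<dots> = (\<Sum>v\<in>T1. a v \<star> v)"
      by (rule sum.mono_neutral_right) (use T(1) in \<open>auto simp: T1_def\<close>)
    finally have a: "comb m \<phi> c = (\<Sum>v\<in>T1. a v \<star> v)" .
    have "Q (comb m \<phi> c) (comb m \<phi> c) = (\<Sum>v\<in>T1. of_real ((cmod (a v))\<^sup>2) * Q v v)"
      unfolding a using T TV by (intro Q.sum_orthogonal) (auto simp: T1_def)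
    also have "\<dots> = of_real (\<Sum>v\<in>T1. (cmod (a v))\<^sup>2)" using one by simp
    finally show ?thesis using C(2)[of a] a by simp
  qed
  then show ?thesis using C(1) by blast
qed

lemma hermitian_form_uminus: "hermitian_form scale V B \<Longrightarrow> hermitian_form scale V (\<lambda>x y. - B x y)"
proof -
  assume "hermitian_form scale V B"
  then interpret B: hermitian_form scale V B .
  show ?thesis
    by unfold_locales
      (auto simp: M.subspace_V B.add_left B.scale_left B.hermitian[symmetric])
qed

text \<open>Left continuity of the index. Since \<open>M\<close> is at most C times
  \<open>- q l\<close> on the subspace, lowering l by 1/(C + 1) raises the form by only the fraction
  C/(C + 1) of its absolute value.\<close>

lemma negative_left:
  assumes "negative l m"
  shows "\<exists>l'<l. negative l' m"
proof -
  obtain \<phi> where \<phi>: "\<forall>i<m. \<phi> i \<in> V"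
    "\<And>c. (\<exists>i<m. c i \<noteq> 0) \<Longrightarrow> Re (q l (comb m \<phi> c) (comb m \<phi> c)) < 0"
    using assms unfolding negative_def by auto
  obtain C where C: "C \<ge> 0"
    "\<And>c. Re (M (comb m \<phi> c) (comb m \<phi> c)) \<le> C * Re (- q l (comb m \<phi> c) (comb m \<phi> c))"
    using dominated[OF M.hermitian_form_axioms M_nonneg hermitian_form_uminus[OF q.hermitian_form_axioms], of m \<phi> l] \<phi>
    by auto
  define l' where "l' = l - 1 / (C + 1)"
  have "Re (q l' (comb m \<phi> c) (comb m \<phi> c)) < 0" if c: "\<exists>i<m. c i \<noteq> 0" for c
  proof -
    let ?x = "comb m \<phi> c"
    have "Re (q l' ?x ?x) = Re (q l ?x ?x) + Re (M ?x ?x) / (C + 1)"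
      by (simp add: Re_q l'_def algebra_simps)
    also have "Re (M ?x ?x) / (C + 1) \<le> (C * - Re (q l ?x ?x)) / (C + 1)"
      using C by (intro divide_right_mono) auto
    also have "\<dots> < - Re (q l ?x ?x)" using \<phi>(2)[OF c] C(1) by (simp add: field_simps)
    finally show ?thesis by simp
  qed
  moreover have "l' < l" using C(1) by (simp add: l'_def)
  ultimately show ?thesis using \<phi>(1) unfolding negative_def by blast
qed

section \<open>Finitely many linear conditions and the jump of the index\<close>

definition linear_functional :: "('v \<Rightarrow> complex) \<Rightarrow> bool"
  where "linear_functional g \<longleftrightarrow>
    (\<forall>x\<in>V. \<forall>y\<in>V. g (x + y) = g x + g y) \<and> (\<forall>c. \<forall>x\<in>V. g (c \<star> x) = c * g x)"

lemma linear_functional_sum: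
  assumes "linear_functional g" "\<And>i. i \<in> I \<Longrightarrow> f i \<in> V"
  shows "g (\<Sum>i\<in>I. c i \<star> f i) = (\<Sum>i\<in>I. c i * g (f i))"
proof -
  have "g 0 = 0"
    using assms(1) V_closed(4) unfolding linear_functional_def by (metis mult_zero_left scale_zero_left)
  with assms(2) show ?thesis
  proof (induction I rule: infinite_finite_induct)
    case (insert x F)
    have "c x \<star> f x \<in> V" "(\<Sum>i\<in>F. c i \<star> f i) \<in> V" "f x \<in> V" using insert.prems by (auto intro!: V_closed)
    then show ?case using insert assms(1) by (simp add: linear_functional_def)
  qed auto
qed

lemma linear_functional_diff:
  assumes "linear_functional g" "x \<in> V" "y \<in> V"
  shows "g (x - y) = g x - g y"
proof -
  have "g ((x - y) + y) = g (x - y) + g y"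
    using assms V_closed(3) unfolding linear_functional_def by blast
  then show ?thesis by simp
qed

text \<open>Fewer homogeneous equations than coefficients leave a non-zero solution, and the form is
  negative there.\<close>

lemma negative_constrained:
  assumes "negative l m" "finite R" "card R < m" "\<And>r. r \<in> R \<Longrightarrow> linear_functional (g r)"
  shows "\<exists>x\<in>V. Re (q l x x) < 0 \<and> (\<forall>r\<in>R. g r x = 0)"
proof -
  obtain \<phi> where \<phi>: "\<forall>i<m. \<phi> i \<in> V"
    "\<And>c. (\<exists>i<m. c i \<noteq> 0) \<Longrightarrow> Re (q l (comb m \<phi> c) (comb m \<phi> c)) < 0"
    using assms(1) unfolding negative_def by auto
  obtain c where c: "\<exists>i<m. c i \<noteq> 0" "\<forall>r\<in>R. (\<Sum>i<m. c i * g r (\<phi> i)) = 0"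
    using homogeneous_system[of R "{..<m}" "\<lambda>r i. g r (\<phi> i)"] assms by auto
  then have "\<forall>r\<in>R. g r (comb m \<phi> c) = 0"
    using assms(4) \<phi>(1) linear_functional_sum[of _ "{..<m}" \<phi> c] by (auto simp: comb_def)
  then show ?thesis using \<phi> c comb_in_V by blast
qed

text \<open>Each further functional costs at most one generator: either it already vanishes on the
  joint kernel of the others, or a vector of that kernel on which it is non-zero corrects its
  value.\<close>

lemma finite_codimension:
  assumes "finite \<Phi>" "\<And>g. g \<in> \<Phi> \<Longrightarrow> linear_functional g"
  shows "\<exists>S. finite S \<and> S \<subseteq> V \<and> (\<forall>x\<in>V. \<exists>s\<in>span S. \<forall>g\<in>\<Phi>. g (x - s) = 0)"
  using assms
proof (induction \<Phi> rule: finite_induct)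
  case empty
  show ?case by (intro exI[of _ "{}"]) auto
next
  case (insert g \<Phi>)
  then obtain S where S: "finite S" "S \<subseteq> V" "\<forall>x\<in>V. \<exists>s\<in>span S. \<forall>g\<in>\<Phi>. g (x - s) = 0" by auto
  have SV: "span S \<subseteq> V" using M.span_subset_V[OF S(2)] .
  have g: "linear_functional g" using insert by auto
  show ?case
  proof (cases "\<forall>h\<in>V. (\<forall>g\<in>\<Phi>. g h = 0) \<longrightarrow> g h = 0")
    case True
    have "\<exists>s\<in>span S. \<forall>g\<in>insert g \<Phi>. g (x - s) = 0" if x: "x \<in> V" for x
    proof -
      obtain s where "s \<in> span S" "\<forall>g\<in>\<Phi>. g (x - s) = 0" using S(3) x by blast
      with True x SV show ?thesis by (intro bexI[of _ s]) (auto simp: V_closed subset_iff)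
    qed
    then show ?thesis using S by (intro exI[of _ S]) auto
  next
    case False
    then obtain h where h: "h \<in> V" "\<forall>g\<in>\<Phi>. g h = 0" "g h \<noteq> 0" by auto
    have "\<exists>s\<in>span (insert h S). \<forall>g\<in>insert g \<Phi>. g (x - s) = 0" if x: "x \<in> V" for x
    proof -
      obtain s where s: "s \<in> span S" "\<forall>g\<in>\<Phi>. g (x - s) = 0" using S(3) x by blast
      define a where "a = g (x - s) / g h"
      have V: "x - s \<in> V" "a \<star> h \<in> V" using x s SV h V_closed by auto
      have "f (x - (s + a \<star> h)) = f (x - s) - a * f h" if "linear_functional f" for f
        using linear_functional_diff[OF that V] that h(1)
        by (simp add: linear_functional_def diff_diff_eq)
      moreover have "f (x - s) - a * f h = 0" if "f \<in> insert g \<Phi>" for f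
        using s h that by (auto simp: a_def)
      ultimately have "\<forall>f\<in>insert g \<Phi>. f (x - (s + a \<star> h)) = 0"
        using insert.prems by metis
      moreover have "s + a \<star> h \<in> span (insert h S)"
      proof (rule span_add)
        show "s \<in> span (insert h S)" using s(1) span_mono[of S "insert h S"] by auto
        show "a \<star> h \<in> span (insert h S)" by (intro span_scale span_base) auto
      qed
      ultimately show ?thesis by blast
    qed
    then show ?thesis using S h by (intro exI[of _ "insert h S"]) auto
  qed
qed

text \<open>Abstract Schur complement: \<open>q l\<close> is coercive on the joint kernel of \<Phi>,
  and every vector can be replaced, without changing its \<Phi>-values, by one that is
  \<open>q l\<close>-orthogonal to that kernel. In the graph \<Phi> consists of evaluations at mesh
  nodes.\<close>

definition reducible :: "real \<Rightarrow> bool"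
  where "reducible l \<longleftrightarrow> (\<exists>\<Phi> c. finite \<Phi> \<and> (\<forall>g\<in>\<Phi>. linear_functional g) \<and> 0 < c \<and>
    (\<forall>h\<in>V. (\<forall>g\<in>\<Phi>. g h = 0) \<longrightarrow> c * Re (M h h) \<le> Re (q l h h)) \<and>
    (\<forall>v\<in>V. \<exists>u\<in>V. (\<forall>g\<in>\<Phi>. g (v - u) = 0) \<and> (\<forall>h\<in>V. (\<forall>g\<in>\<Phi>. g h = 0) \<longrightarrow> q l u h = 0)))"

text \<open>A basis of the kernel of \<open>q l\<close> modulo \<open>M\<close>-null vectors.
  Spanning is expressed by duality: whatever is \<open>M\<close>-orthogonal to the family is
  \<open>M\<close>-orthogonal to the whole kernel.\<close>

definition kernel_family :: "real \<Rightarrow> nat \<Rightarrow> (nat \<Rightarrow> 'v) \<Rightarrow> bool"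
  where "kernel_family l d \<kappa> \<longleftrightarrow> (\<forall>i<d. \<kappa> i \<in> V \<and> (\<forall>g\<in>V. q l (\<kappa> i) g = 0)) \<and>
    (\<forall>c. Re (M (comb d \<kappa> c) (comb d \<kappa> c)) = 0 \<longrightarrow> (\<forall>i<d. c i = 0)) \<and>
    (\<forall>u\<in>V. (\<forall>g\<in>V. q l u g = 0) \<longrightarrow> (\<forall>f\<in>V. (\<forall>i<d. M f (\<kappa> i) = 0) \<longrightarrow> M f u = 0))"

text \<open>A negative subspace of dimension k + d + 1 just above l would contain a vector x that is
  \<open>q l\<close>-orthogonal to the k negative directions and \<open>M\<close>-orthogonal to the
  kernel. On such x the form \<open>q l\<close> bounds a fixed multiple of \<open>M\<close> from
  above, so raising l slightly cannot make it negative.\<close>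

lemma index_jump:
  assumes red: "reducible l" and ker: "kernel_family l d \<kappa>"
  shows "\<exists>k \<epsilon>. 0 < \<epsilon> \<and> negative l k \<and> (\<forall>l'\<le>l + \<epsilon>. \<not> negative l' (k + d + 1))"
proof -
  obtain \<Phi> c where \<Phi>: "finite \<Phi>" "\<forall>g\<in>\<Phi>. linear_functional g" and c: "0 < c"
    and coercive: "\<forall>h\<in>V. (\<forall>g\<in>\<Phi>. g h = 0) \<longrightarrow> c * Re (M h h) \<le> Re (q l h h)"
    and interp: "\<forall>v\<in>V. \<exists>u\<in>V. (\<forall>g\<in>\<Phi>. g (v - u) = 0) \<and> (\<forall>h\<in>V. (\<forall>g\<in>\<Phi>. g h = 0) \<longrightarrow> q l u h = 0)"
    using red unfolding reducible_def by (elim exE conjE) (rule that; assumption)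
  have "\<forall>v\<in>V. \<exists>u. u\<in>V \<and> (\<forall>g\<in>\<Phi>. g (v - u) = 0) \<and> (\<forall>h\<in>V. (\<forall>g\<in>\<Phi>. g h = 0) \<longrightarrow> q l u h = 0)"
    using interp by (auto simp: Bex_def)
  then have "\<exists>I. \<forall>v\<in>V. I v \<in> V \<and> (\<forall>g\<in>\<Phi>. g (v - I v) = 0) \<and>
      (\<forall>h\<in>V. (\<forall>g\<in>\<Phi>. g h = 0) \<longrightarrow> q l (I v) h = 0)"
    by (rule bchoice)
  then obtain I where I': "\<forall>v\<in>V. I v \<in> V \<and> (\<forall>g\<in>\<Phi>. g (v - I v) = 0) \<and>
      (\<forall>h\<in>V. (\<forall>g\<in>\<Phi>. g h = 0) \<longrightarrow> q l (I v) h = 0)"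
    by (rule exE)
  have I: "I v \<in> V" "g \<in> \<Phi> \<Longrightarrow> g (v - I v) = 0"
    "\<lbrakk>h \<in> V; \<forall>g\<in>\<Phi>. g h = 0\<rbrakk> \<Longrightarrow> q l (I v) h = 0" if "v \<in> V" for v g h
    using bspec[OF I' that] by simp_all
  obtain S where S: "finite S" "S \<subseteq> V" "\<forall>x\<in>V. \<exists>s\<in>span S. \<forall>g\<in>\<Phi>. g (x - s) = 0"
    using finite_codimension[OF \<Phi>(1)] \<Phi>(2) by auto
  \<comment> \<open>Interpolants of finitely many vectors spanning \<open>V\<close> modulo the joint
    kernel: \<open>V\<close> is the \<open>q l\<close>-orthogonal sum of their span and that
    kernel.\<close>
  define U where "U = I ` S"
  have UV: "U \<subseteq> V" using I(1) S(2) by (auto simp: U_def)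
  have U_orth: "q l y h = 0" if "y \<in> span U" "h \<in> V" "\<forall>g\<in>\<Phi>. g h = 0" for y h
    by (rule q.orthogonal_span[OF that(2) UV _ that(1)]) (use that I(3) S(2) in \<open>auto simp: U_def\<close>)
  have decomp: "\<exists>y\<in>span U. x - y \<in> V \<and> (\<forall>g\<in>\<Phi>. g (x - y) = 0)" if x: "x \<in> V" for x
  proof -
    obtain s where s: "s \<in> span S" "\<forall>g\<in>\<Phi>. g (x - s) = 0" using S(3) x by blast
    obtain a where a: "s = (\<Sum>v\<in>S. a v \<star> v)" using s(1) span_finite[OF S(1)] by auto
    define y where "y = (\<Sum>v\<in>S. a v \<star> I v)"
    have V: "s \<in> V" "y \<in> V" using S(2) I(1) by (auto simp: a y_def intro!: V_closed)
    have "g (x - y) = 0" if g: "g \<in> \<Phi>" for g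
    proof -
      have "g (s - y) = (\<Sum>v\<in>S. a v * g (v - I v))"
      proof -
        have "s - y = (\<Sum>v\<in>S. a v \<star> (v - I v))"
          by (simp add: a y_def sum_subtractf scale_right_diff_distrib)
        then show ?thesis
          using linear_functional_sum[of g S "\<lambda>v. v - I v" a] \<Phi>(2) g I(1) S(2) by (auto intro: V_closed)
      qed
      also have "\<dots> = 0"
      proof (intro sum.neutral ballI)
        fix v assume "v \<in> S"
        then have "v \<in> V" using S(2) by auto
        then show "a v * g (v - I v) = 0" using I(2)[OF _ g] by simp
      qed
      finally have "g (s - y) = 0" .
      moreover have "g (x - s) = 0" using s g by auto
      ultimately show ?thesis
        using linear_functional_diff[of g] \<Phi>(2) g V x by auto
    qed
    moreover have "y \<in> span U"
      unfolding y_def U_def by (intro span_sum span_scale span_base) auto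
    moreover have "x - y \<in> V" using V(2) x V_closed(3) by auto
    ultimately show ?thesis by blast
  qed
  obtain T where T: "finite T" "span T = span U"
    "\<forall>v\<in>T. \<forall>w\<in>T. v \<noteq> w \<longrightarrow> q l v w = 0" "\<forall>v\<in>T. q l v v \<in> {-1, 0, 1}"
    using q.diagonalise[of U l] S(1) UV by (auto simp: U_def)
  have TU: "T \<subseteq> span U" using T(2) span_superset[of T] by auto
  have TV: "T \<subseteq> V" using TU M.span_subset_V[OF UV] by auto
  define N where "N = {v\<in>T. q l v v = -1}"
  define Z where "Z = {v\<in>T. q l v v = 0}"
  define P where "P = {v\<in>T. q l v v = 1}"
  have fin: "finite N" "finite Z" "finite P" using T(1) by (auto simp: N_def Z_def P_def)
  have neg: "negative l (card N)"
  proof -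
    obtain \<phi> where \<phi>: "bij_betw \<phi> {..<card N} N"
      using ex_bij_betw_nat_finite[OF fin(1)] by (auto simp: atLeast0LessThan)
    have \<phi>N: "\<phi> i \<in> N" if "i < card N" for i using \<phi> that by (auto simp: bij_betw_def)
    have "Re (q l (comb (card N) \<phi> a) (comb (card N) \<phi> a)) < 0" if a: "\<exists>i<card N. a i \<noteq> 0" for a
    proof -
      have "q l (\<phi> i) (\<phi> j) = 0" if "i < card N" "j < card N" "i \<noteq> j" for i j
      proof -
        have "\<phi> i \<noteq> \<phi> j" using \<phi> that by (auto simp: bij_betw_def inj_on_def)
        then show ?thesis using T(3) \<phi>N that by (auto simp: N_def)
      qed
      then have "q l (comb (card N) \<phi> a) (comb (card N) \<phi> a)
          = (\<Sum>i<card N. of_real ((cmod (a i))\<^sup>2) * q l (\<phi> i) (\<phi> i))"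
        unfolding comb_def using \<phi>N TV by (intro q.sum_orthogonal) (auto simp: N_def)
      also have "\<dots> = of_real (- (\<Sum>i<card N. (cmod (a i))\<^sup>2))"
        using \<phi>N by (simp add: N_def sum_negf)
      finally have "Re (q l (comb (card N) \<phi> a) (comb (card N) \<phi> a)) = - (\<Sum>i<card N. (cmod (a i))\<^sup>2)"
        by simp
      moreover have "0 < (\<Sum>i<card N. (cmod (a i))\<^sup>2)"
        using a by (auto intro!: sum_pos2)
      ultimately show ?thesis by simp
    qed
    then show ?thesis
      using \<phi>N TV unfolding negative_def by (intro exI[of _ \<phi>]) (auto simp: N_def)
  qed
  obtain C where C: "C \<ge> 0"
    "\<And>a. Re (M (\<Sum>v\<in>P. a v \<star> v) (\<Sum>v\<in>P. a v \<star> v)) \<le> C * (\<Sum>v\<in>P. (cmod (a v))\<^sup>2)"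
    using M.sum_bound[of P] fin TV M_nonneg by (auto simp: P_def)
  \<comment> \<open>C bounds \<open>M\<close> by \<open>q l\<close> on the positive directions and
    1/c does so on the joint kernel; the factors 2 come from
    \<open>parallelogram_bound\<close>.\<close>
  define \<epsilon> where "\<epsilon> = 1 / (2 * C + 2 / c + 1)"
  have \<epsilon>: "0 < \<epsilon>" "\<epsilon> * (2 * C + 2 / c) \<le> 1"
  proof -
    have "0 \<le> 2 * C + 2 / c" using C(1) c by simp
    then have "0 < 2 * C + 2 / c + 1" by linarith
    then show "0 < \<epsilon>" "\<epsilon> * (2 * C + 2 / c) \<le> 1" by (simp_all add: \<epsilon>_def)
  qed
  have "\<not> negative l' (card N + d + 1)" if l': "l' \<le> l + \<epsilon>" for l'
  proof
    assume "negative l' (card N + d + 1)"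
    then have n': "negative (l + \<epsilon>) (card N + d + 1)" using negative_mono l' by auto
    define g where "g = (\<lambda>r x. case r of Inl v \<Rightarrow> q l x v | Inr i \<Rightarrow> M x (\<kappa> i))"
    \<comment> \<open>These are card N + d conditions, one fewer than the dimension of the assumed
      negative subspace.\<close>
    define R where "R = N <+> {..<d}"
    have "card R < card N + d + 1" "finite R" using fin by (auto simp: R_def card_Plus)
    moreover have "linear_functional (g r)" if "r \<in> R" for r
      using that TV ker
      by (auto simp: R_def g_def linear_functional_def N_def q.add_left q.scale_left M.add_left
          M.scale_left kernel_family_def subset_iff)
    ultimately obtain x where x: "x \<in> V" "Re (q (l + \<epsilon>) x x) < 0" "\<forall>r\<in>R. g r x = 0"
      using negative_constrained[OF n'] by blast
    have xN: "q l x v = 0" if "v \<in> N" for v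
      using x(3) that by (auto simp: R_def g_def dest: bspec[of _ _ "Inl v"])
    have xK: "M x (\<kappa> i) = 0" if "i < d" for i
      using x(3) that by (auto simp: R_def g_def dest: bspec[of _ _ "Inr i"])
    obtain y where y: "y \<in> span U" "x - y \<in> V" "\<forall>g\<in>\<Phi>. g (x - y) = 0" using decomp[OF x(1)] by auto
    have yV: "y \<in> V" using y(1) M.span_subset_V[OF UV] by auto
    define h where "h = x - y"
    obtain a where a: "y = (\<Sum>v\<in>T. a v \<star> v)" using y(1) T(2) span_finite[OF T(1)] by auto
    have aN: "a v = 0" if v: "v \<in> N" for v
    proof -
      have vT: "v \<in> T" "v \<in> V" "v \<in> span U" using v TV TU by (auto simp: N_def)
      have "q l h v = 0"
        using U_orth[OF vT(3) y(2,3)] q.hermitian[of v h l] vT y by (simp add: h_def)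
      then have "q l y v = 0" using xN[OF v] q.diff_left[of x y v l] x(1) yV vT by (simp add: h_def)
      moreover have "q l y v = (\<Sum>w\<in>T. a w * q l w v)"
        unfolding a using TV vT by (intro q.sum_left) auto
      moreover have "\<dots> = (\<Sum>w\<in>T. if w = v then - a v else 0)"
        using T(3) vT v by (intro sum.cong) (auto simp: N_def)
      ultimately show ?thesis using T(1) vT by simp
    qed
    define y0 where "y0 = (\<Sum>v\<in>Z. a v \<star> v)"
    define y1 where "y1 = (\<Sum>v\<in>P. a v \<star> v)"
    have "T = N \<union> (Z \<union> P)" using T(4) by (auto simp: N_def Z_def P_def)
    moreover have "N \<inter> (Z \<union> P) = {}" "Z \<inter> P = {}" by (auto simp: N_def Z_def P_def)
    ultimately have y01: "y = y0 + y1"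
      using fin aN by (simp add: a sum.union_disjoint y0_def y1_def)
    have V01: "y0 \<in> V" "y1 \<in> V" "h \<in> V"
      using TV y(2) by (auto simp: y0_def y1_def h_def Z_def P_def intro!: V_closed)
    have S01: "y0 \<in> span U" "y1 \<in> span U"
      using TU by (auto simp: y0_def y1_def Z_def P_def intro!: span_sum span_scale)
    \<comment> \<open>The isotropic part is orthogonal to the diagonal family, hence to
      \<open>U\<close>, and as an element of \<open>span U\<close> also to the joint kernel; so it
      lies in the kernel of \<open>q l\<close> on all of \<open>V\<close>.\<close>
    have y0_ker: "q l y0 z = 0" if z: "z \<in> V" for z
    proof -
      obtain z' where z': "z' \<in> span U" "z - z' \<in> V" "\<forall>g\<in>\<Phi>. g (z - z') = 0" using decomp[OF z] by auto
      have z'V: "z' \<in> V" using z'(1) M.span_subset_V[OF UV] by auto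
      have "q l z' y0 = 0"
      proof (rule q.orthogonal_span[OF V01(1) TV])
        fix v assume v: "v \<in> T"
        have "q l v y0 = (\<Sum>w\<in>Z. cnj (a w) * q l v w)"
          unfolding y0_def using TV v by (intro q.sum_right) (auto simp: Z_def)
        also have "\<dots> = 0" using T(3) v by (intro sum.neutral) (auto simp: Z_def)
        finally show "q l v y0 = 0" .
      qed (use z' T(2) in auto)
      then have "q l y0 z' = 0" using q.hermitian[of z' y0 l] z'V V01 by simp
      moreover have "q l y0 (z - z') = 0" using U_orth S01(1) z' by auto
      ultimately show ?thesis using q.diff_right[of z z' y0 l] z z'V V01 by simp
    qed
    have Mxy0: "M x y0 = 0"
      using ker V01(1) y0_ker x(1) xK unfolding kernel_family_def by blast
    define w where "w = y1 + h"
    have w: "w \<in> V" "x = y0 + w"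
      using V_closed(1)[OF V01(2,3)] y01 by (simp_all add: w_def h_def)
    \<comment> \<open>By Pythagoras, removing the \<open>M\<close>-orthogonal kernel part
      \<open>y0\<close> from x can only increase the \<open>M\<close>-norm.\<close>
    have "Re (M x x) \<le> Re (M w w)"
    proof -
      have "M y0 x = 0" using Mxy0 M.hermitian[of x y0] x(1) V01 by simp
      moreover have "w = x - y0" using w by simp
      ultimately have "Re (M w w) = Re (M x x) + Re (M y0 y0)"
        using Mxy0 x(1) V01 V_closed by (simp add: M.diff_left M.diff_right)
      then show ?thesis using M_nonneg[OF V01(1)] by simp
    qed
    moreover have "Re (M w w) \<le> 2 * Re (M y1 y1) + 2 * Re (M h h)"
      using M.parallelogram_bound[OF V01(2,3)] M_nonneg V_closed V01 by (simp add: w_def)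
    moreover have qx: "q l x x = q l y1 y1 + q l h h"
    proof -
      have "q l w y0 = 0" using y0_ker[OF w(1)] q.hermitian[of y0 w l] V01 w(1) by simp
      then have "q l x x = q l w w"
        using w V01 y0_ker by (simp add: q.add_left q.add_right V_closed)
      moreover have "q l y1 h = 0" using U_orth[OF S01(2)] y by (simp add: h_def)
      moreover have "q l h y1 = 0"
        using calculation q.hermitian[of y1 h l] V01 by simp
      ultimately show ?thesis
        using V01 by (simp add: w_def q.add_left q.add_right V_closed)
    qed
    have qy1: "Re (q l y1 y1) = (\<Sum>v\<in>P. (cmod (a v))\<^sup>2)"
    proof -
      have "q l y1 y1 = (\<Sum>v\<in>P. of_real ((cmod (a v))\<^sup>2) * q l v v)"
        unfolding y1_def using fin T(3) TV by (intro q.sum_orthogonal) (auto simp: P_def)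
      also have "\<dots> = of_real (\<Sum>v\<in>P. (cmod (a v))\<^sup>2)" by (simp add: P_def)
      finally show ?thesis by simp
    qed
    have M1: "Re (M y1 y1) \<le> C * Re (q l y1 y1)" unfolding qy1 using C(2)[of a] by (simp add: y1_def)
    have Mh: "Re (M h h) \<le> Re (q l h h) / c"
      using bspec[OF coercive, of h] y c by (simp add: h_def field_simps)
    have pos: "0 \<le> Re (q l y1 y1)" "0 \<le> Re (q l h h)"
      using bspec[OF coercive, of h] M_nonneg[OF V01(3)] y c by (auto simp: h_def qy1 sum_nonneg intro: order_trans[rotated])
    ultimately have "Re (M x x) \<le> 2 * (C * Re (q l y1 y1)) + 2 * (Re (q l h h) / c)"
      using M1 Mh by linarith
    also have "\<dots> \<le> (2 * C + 2 / c) * Re (q l x x)"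
      using pos C(1) c by (simp add: qx algebra_simps)
    finally have "\<epsilon> * Re (M x x) \<le> (\<epsilon> * (2 * C + 2 / c)) * Re (q l x x)"
      using \<epsilon>(1) by (simp add: mult.assoc)
    also have "\<dots> \<le> 1 * Re (q l x x)" using \<epsilon>(2) pos by (intro mult_right_mono) (auto simp: qx)
    finally have "0 \<le> Re (q (l + \<epsilon>) x x)" by (simp add: Re_q algebra_simps)
    then show False using x(2) by simp
  qed
  then show ?thesis using neg \<epsilon>(1) by blast
qed

end

section \<open>Eigenvalue counting and min-max values\<close>

text \<open>\<open>mult\<close> is indexed by \<sigma>, the square root of the spectral parameter,
  as quasi-eigenvalues are. The assumption \<open>unbounded\<close> makes the sets whose infima are
  compared non-empty.\<close>

locale spectral_count = form_pair +
  fixes mult :: "real \<Rightarrow> nat"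
  assumes reducible: "0 \<le> l \<Longrightarrow> reducible l"
    and kernel: "0 \<le> \<sigma> \<Longrightarrow> \<exists>\<kappa>. kernel_family (\<sigma>\<^sup>2) (mult \<sigma>) \<kappa>"
    and unbounded: "\<exists>l. negative l m"
begin

text \<open>Kernel vectors for different \<sigma> are orthogonal for both forms, so on their sum
  \<open>q l\<close> is diagonal with the factors \<sigma>^2 - l < 0 in front of
  \<open>M\<close>.\<close>

lemma negative_eigenvectors:
  assumes F: "finite F" "\<And>\<sigma>. \<sigma> \<in> F \<Longrightarrow> 0 \<le> \<sigma> \<and> \<sigma>\<^sup>2 < l"
  shows "negative l (\<Sum>\<sigma>\<in>F. mult \<sigma>)"
proof -
  have "\<forall>\<sigma>\<in>F. \<exists>\<kappa>. kernel_family (\<sigma>\<^sup>2) (mult \<sigma>) \<kappa>" using kernel F by auto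
  from bchoice[OF this] obtain \<kappa> where \<kappa>: "\<forall>\<sigma>\<in>F. kernel_family (\<sigma>\<^sup>2) (mult \<sigma>) (\<kappa> \<sigma>)" ..
  define I where "I = Sigma F (\<lambda>\<sigma>. {..<mult \<sigma>})"
  have fin: "finite I" "card I = (\<Sum>\<sigma>\<in>F. mult \<sigma>)" using F by (auto simp: I_def)
  obtain e where e: "bij_betw e {..<card I} I"
    using ex_bij_betw_nat_finite[OF fin(1)] by (auto simp: atLeast0LessThan)
  define \<phi> where "\<phi> = (\<lambda>i. \<kappa> (fst (e i)) (snd (e i)))"
  have \<kappa>V: "\<kappa> \<sigma> i \<in> V" if "\<sigma> \<in> F" "i < mult \<sigma>" for \<sigma> i
    using \<kappa> that by (auto simp: kernel_family_def)
  have "\<phi> i \<in> V" if "i < card I" for i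
  proof -
    have "e i \<in> I" using e that by (auto simp: bij_betw_def)
    then show ?thesis using \<kappa>V by (auto simp: \<phi>_def I_def)
  qed
  moreover have "Re (q l (comb (card I) \<phi> c) (comb (card I) \<phi> c)) < 0" if c: "\<exists>i<card I. c i \<noteq> 0" for c
  proof -
    define c' where "c' = (\<lambda>p. c (the_inv_into {..<card I} e p))"
    have c': "c' (e i) = c i" if "i < card I" for i
      using e that by (auto simp: c'_def bij_betw_def the_inv_into_f_f)
    define x where "x = (\<lambda>\<sigma>. comb (mult \<sigma>) (\<kappa> \<sigma>) (\<lambda>i. c' (\<sigma>, i)))"
    have xV: "x \<sigma> \<in> V" if "\<sigma> \<in> F" for \<sigma> using \<kappa>V that by (auto simp: x_def intro: comb_in_V)
    have ker: "q (\<sigma>\<^sup>2) (x \<sigma>) g = 0" if "\<sigma> \<in> F" "g \<in> V" for \<sigma> g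
    proof -
      have "q (\<sigma>\<^sup>2) (x \<sigma>) g = (\<Sum>i<mult \<sigma>. c' (\<sigma>, i) * q (\<sigma>\<^sup>2) (\<kappa> \<sigma> i) g)"
        unfolding x_def comb_def using \<kappa>V that by (intro q.sum_left) auto
      then show ?thesis using \<kappa> that by (simp add: kernel_family_def)
    qed
    have Dx: "D (x \<sigma>) g = of_real (\<sigma>\<^sup>2) * M (x \<sigma>) g" if "\<sigma> \<in> F" "g \<in> V" for \<sigma> g
      using ker[OF that] by (simp add: q_def)
    have orth: "M (x \<sigma>) (x \<tau>) = 0" if "\<sigma> \<in> F" "\<tau> \<in> F" "\<sigma> \<noteq> \<tau>" for \<sigma> \<tau>
    proof -
      have "D (x \<sigma>) (x \<tau>) = cnj (D (x \<tau>) (x \<sigma>))" using D.hermitian[OF xV[OF that(2)] xV[OF that(1)]] .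
      also have "\<dots> = of_real (\<tau>\<^sup>2) * cnj (M (x \<tau>) (x \<sigma>))" using Dx that xV by simp
      also have "cnj (M (x \<tau>) (x \<sigma>)) = M (x \<sigma>) (x \<tau>)" using M.hermitian[OF xV[OF that(2)] xV[OF that(1)]] by simp
      finally have "of_real (\<sigma>\<^sup>2 - \<tau>\<^sup>2) * M (x \<sigma>) (x \<tau>) = 0" using Dx that xV by (simp add: algebra_simps)
      moreover have "\<sigma>\<^sup>2 \<noteq> \<tau>\<^sup>2" using F that by (simp add: power2_eq_iff_nonneg)
      ultimately show ?thesis by (metis eq_iff_diff_eq_0 mult_eq_0_iff of_real_eq_0_iff)
    qed
    have "comb (card I) \<phi> c = (\<Sum>i<card I. c' (e i) \<star> \<kappa> (fst (e i)) (snd (e i)))"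
      unfolding comb_def \<phi>_def using c' by (intro sum.cong) auto
    also have "\<dots> = (\<Sum>p\<in>I. c' p \<star> \<kappa> (fst p) (snd p))"
      by (rule sum.reindex_bij_betw[OF e])
    also have "\<dots> = (\<Sum>\<sigma>\<in>F. 1 \<star> x \<sigma>)"
      unfolding I_def x_def comb_def using F(1) by (simp add: sum.Sigma case_prod_unfold)
    finally have comb: "comb (card I) \<phi> c = (\<Sum>\<sigma>\<in>F. 1 \<star> x \<sigma>)" .
    have "q l (x \<sigma>) (x \<tau>) = 0" if "\<sigma> \<in> F" "\<tau> \<in> F" "\<sigma> \<noteq> \<tau>" for \<sigma> \<tau>
      using orth[OF that] Dx[OF that(1) xV[OF that(2)]] by (simp add: q_def)
    then have "q l (comb (card I) \<phi> c) (comb (card I) \<phi> c) = (\<Sum>\<sigma>\<in>F. of_real ((cmod 1)\<^sup>2) * q l (x \<sigma>) (x \<sigma>))"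
      unfolding comb using F xV by (intro q.sum_orthogonal) auto
    then have "Re (q l (comb (card I) \<phi> c) (comb (card I) \<phi> c)) = (\<Sum>\<sigma>\<in>F. (\<sigma>\<^sup>2 - l) * Re (M (x \<sigma>) (x \<sigma>)))"
      using Dx xV by (simp add: q_def algebra_simps)
    also have "\<dots> < 0"
    proof -
      obtain i where i: "i < card I" "c i \<noteq> 0" using c by auto
      obtain \<sigma> j where ei: "e i = (\<sigma>, j)" by (cases "e i")
      have "e i \<in> I" using e i by (auto simp: bij_betw_def)
      then have \<sigma>: "\<sigma> \<in> F" "j < mult \<sigma>" using ei by (auto simp: I_def)
      have "Re (M (x \<sigma>) (x \<sigma>)) \<noteq> 0"
      proof
        assume "Re (M (x \<sigma>) (x \<sigma>)) = 0"
        then have "c' (\<sigma>, j) = 0" using \<kappa> \<sigma> unfolding kernel_family_def x_def by blast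
        then show False using c'[OF i(1)] i(2) ei by simp
      qed
      then have "0 < Re (M (x \<sigma>) (x \<sigma>))" using M_nonneg[OF xV[OF \<sigma>(1)]] by simp
      then have "(l - \<sigma>\<^sup>2) * Re (M (x \<sigma>) (x \<sigma>)) > 0" using F \<sigma> by simp
      moreover have "0 \<le> (l - \<tau>\<^sup>2) * Re (M (x \<tau>) (x \<tau>))" if "\<tau> \<in> F" for \<tau>
        using F(2)[OF that] M_nonneg[OF xV[OF that]] by simp
      ultimately have "0 < (\<Sum>\<tau>\<in>F. (l - \<tau>\<^sup>2) * Re (M (x \<tau>) (x \<tau>)))"
        using F(1) \<sigma>(1) by (intro sum_pos2) auto
      moreover have "(\<Sum>\<tau>\<in>F. (\<tau>\<^sup>2 - l) * Re (M (x \<tau>) (x \<tau>))) = - (\<Sum>\<tau>\<in>F. (l - \<tau>\<^sup>2) * Re (M (x \<tau>) (x \<tau>)))"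
        by (simp add: sum_negf[symmetric] algebra_simps)
      ultimately show ?thesis by simp
    qed
    finally show ?thesis .
  qed
  ultimately show ?thesis unfolding negative_def fin(2)[symmetric] by blast
qed

lemma index_jump_mult:
  assumes "0 \<le> l"
  shows "\<exists>k \<epsilon>. 0 < \<epsilon> \<and> negative l k \<and> (\<forall>l'\<le>l + \<epsilon>. \<not> negative l' (k + mult (sqrt l) + 1))"
proof -
  obtain \<kappa> where "kernel_family l (mult (sqrt l)) \<kappa>"
    using kernel[of "sqrt l"] assms by auto
  from index_jump[OF reducible[OF assms] this] show ?thesis .
qed

text \<open>Infinitely many eigenvalues below l would give negative subspaces of every dimension,
  whereas \<open>index_jump_mult\<close> bounds the dimension.\<close>

lemma finite_spectrum: "finite {\<sigma>. 0 \<le> \<sigma> \<and> \<sigma>\<^sup>2 < l \<and> mult \<sigma> \<noteq> 0}" (is "finite ?S")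
proof (cases "0 \<le> l")
  case True
  obtain k \<epsilon> where k: "0 < \<epsilon>" "\<forall>l'\<le>l + \<epsilon>. \<not> negative l' (k + mult (sqrt l) + 1)"
    using index_jump_mult[OF True] by blast
  define N where "N = k + mult (sqrt l) + 1"
  have N: "\<not> negative l N" using k by (simp add: N_def)
  show ?thesis
  proof (rule ccontr)
    assume "infinite ?S"
    then obtain F where F: "finite F" "card F = N" "F \<subseteq> ?S" using infinite_arbitrarily_large by blast
    have "card F = (\<Sum>\<sigma>\<in>F. 1)" by simp
    also have "\<dots> \<le> (\<Sum>\<sigma>\<in>F. mult \<sigma>)" using F by (intro sum_mono) auto
    finally have "N \<le> (\<Sum>\<sigma>\<in>F. mult \<sigma>)" using F by simp
    moreover have "negative l (\<Sum>\<sigma>\<in>F. mult \<sigma>)" using F by (intro negative_eigenvectors) auto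
    ultimately show False using N negative_antimono by blast
  qed
next
  case False
  have "?S = {}" using False by (auto simp: not_le) (smt (verit) zero_le_power2)
  then show ?thesis by (simp only: finite.emptyI)
qed

text \<open>The inequality is strict because an eigenvector at l itself makes \<open>q l\<close>
  vanish, not negative. Restricting to non-zero multiplicity keeps the index set finite; over an
  infinite set the sum would be 0.\<close>

definition below :: "real \<Rightarrow> nat"
  where "below l = (\<Sum>\<sigma>\<in>{\<sigma>. 0 \<le> \<sigma> \<and> \<sigma>\<^sup>2 < l \<and> mult \<sigma> \<noteq> 0}. mult \<sigma>)"

lemma below_mono: "l \<le> l' \<Longrightarrow> below l \<le> below l'"
  unfolding below_def by (intro sum_mono2 finite_spectrum) auto

lemma below_jump:
  assumes "0 \<le> l" "l < l'"
  shows "below l + mult (sqrt l) \<le> below l'"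
proof -
  let ?S = "\<lambda>l. {\<sigma>. 0 \<le> \<sigma> \<and> \<sigma>\<^sup>2 < l \<and> mult \<sigma> \<noteq> 0}"
  have "below l + mult (sqrt l) = (\<Sum>\<sigma>\<in>insert (sqrt l) (?S l). mult \<sigma>)"
    unfolding below_def using finite_spectrum[of l] assms by (subst sum.insert) auto
  also have "\<dots> = (\<Sum>\<sigma>\<in>{\<sigma>\<in>insert (sqrt l) (?S l). mult \<sigma> \<noteq> 0}. mult \<sigma>)"
    using finite_spectrum[of l] by (intro sum.mono_neutral_right) auto
  also have "\<dots> \<le> below l'"
    unfolding below_def using assms by (intro sum_mono2 finite_spectrum) auto
  finally show ?thesis .
qed

text \<open>Let L be the infimum of the levels violating the bound. If L violates it, left
  continuity yields a violation below L. Otherwise the index just above L has grown by at most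
  \<open>mult (sqrt L)\<close>, and \<open>below\<close> grows by at least that much as soon as L is
  passed.\<close>

lemma negative_le_below: "negative l m \<Longrightarrow> m \<le> below l"
proof (rule ccontr)
  assume "negative l m" "\<not> m \<le> below l"
  define Bad where "Bad = {l. \<exists>m. negative l m \<and> below l < m}"
  have pos: "0 < l" if "l \<in> Bad" for l using that negative_pos by (force simp: Bad_def)
  have ne: "Bad \<noteq> {}" using \<open>negative l m\<close> \<open>\<not> m \<le> below l\<close> by (auto simp: Bad_def not_le)
  define L where "L = Inf Bad"
  have bdd: "bdd_below Bad" using pos by (intro bdd_belowI[of _ 0]) force
  have L: "0 \<le> L" unfolding L_def by (rule cInf_greatest[OF ne]) (use pos in force)
  show False
  proof (cases "L \<in> Bad")
    case True
    then obtain m where m: "negative L m" "below L < m" by (auto simp: Bad_def)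
    obtain l' where l': "l' < L" "negative l' m" using negative_left[OF m(1)] by auto
    have "l' \<notin> Bad" using l'(1) cInf_lower[OF _ bdd, of l'] by (auto simp: L_def)
    then have "m \<le> below l'" using l'(2) by (auto simp: Bad_def not_less)
    then show False using m(2) below_mono[of l' L] l'(1) by simp
  next
    case False
    obtain k \<epsilon> where k: "0 < \<epsilon>" "negative L k" "\<forall>l'\<le>L + \<epsilon>. \<not> negative l' (k + mult (sqrt L) + 1)"
      using index_jump_mult[OF L] by auto
    have kL: "k \<le> below L" using False k(2) by (auto simp: Bad_def not_less)
    obtain l' where l': "l' \<in> Bad" "l' < L + \<epsilon>"
      using cInf_lessD[OF ne, of "L + \<epsilon>"] k(1) by (auto simp: L_def)
    have "L < l'" using cInf_lower[OF l'(1) bdd] False l'(1) by (cases "L = l'") (auto simp: L_def)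
    obtain m where m: "negative l' m" "below l' < m" using l'(1) by (auto simp: Bad_def)
    have "m < k + mult (sqrt L) + 1"
      using k(3) l'(2) m(1) negative_antimono[of l' m "k + mult (sqrt L) + 1"] by force
    then show False using below_jump[OF L \<open>L < l'\<close>] kL m(2) by simp
  qed
qed

lemma negative_iff: "negative l m \<longleftrightarrow> m \<le> below l"
proof
  assume "m \<le> below l"
  moreover have "negative l (below l)"
    unfolding below_def by (rule negative_eigenvectors[OF finite_spectrum]) auto
  ultimately show "negative l m" using negative_antimono by blast
qed (rule negative_le_below)

lemma negative_imp_rayleigh:
  assumes "negative l m" "1 \<le> m"
  shows "\<exists>\<rho>\<in>rayleigh_values m. \<rho> \<le> l"
proof -
  obtain \<phi> where \<phi>: "\<forall>i<m. \<phi> i \<in> V"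
    "\<And>c. (\<exists>i<m. c i \<noteq> 0) \<Longrightarrow> Re (q l (comb m \<phi> c) (comb m \<phi> c)) < 0"
    using assms(1) unfolding negative_def by auto
  have V: "comb m \<phi> c \<in> V" for c using \<phi>(1) by (intro comb_in_V) auto
  have l: "0 < l" using negative_pos assms by blast
  have pos: "0 < Re (M (comb m \<phi> c) (comb m \<phi> c))" if "\<exists>i<m. c i \<noteq> 0" for c
    using \<phi>(2)[OF that] M_nonneg[OF V[of c]] D_nonneg[OF V[of c]] l
    by (cases "Re (M (comb m \<phi> c) (comb m \<phi> c)) = 0") (auto simp: Re_q)
  let ?R = "\<lambda>c. Re (D (comb m \<phi> c) (comb m \<phi> c)) / Re (M (comb m \<phi> c) (comb m \<phi> c))"
  let ?\<rho> = "Sup {?R c | c. \<exists>i<m. c i \<noteq> 0}"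
  have "?\<rho> \<in> rayleigh_values m"
    unfolding rayleigh_values_def using \<phi>(1) pos by (fastforce intro!: exI[of _ \<phi>])
  moreover have "?\<rho> \<le> l"
  proof (rule cSup_least)
    have *: "\<exists>i<m. (\<lambda>_. 1::complex) i \<noteq> 0" using assms(2) by (intro exI[of _ 0]) auto
    have "?R (\<lambda>_. 1) \<in> {?R c | c. \<exists>i<m. c i \<noteq> 0}" by (rule CollectI exI conjI refl *)+
    then show "{?R c | c. \<exists>i<m. c i \<noteq> 0} \<noteq> {}" by (metis empty_iff)
    show "r \<le> l" if r: "r \<in> {?R c | c. \<exists>i<m. c i \<noteq> 0}" for r
    proof -
      from r[unfolded mem_Collect_eq] obtain c where c: "r = ?R c \<and> (\<exists>i<m. c i \<noteq> 0)" ..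
      then have c: "\<exists>i<m. c i \<noteq> 0" "r = ?R c" by auto
      show ?thesis using \<phi>(2)[OF c(1)] pos[OF c(1)] by (simp add: c(2) Re_q divide_le_eq)
    qed
  qed
  ultimately show ?thesis by blast
qed

text \<open>The \<open>Sup\<close> says something about the quotients only if they are bounded
  above; \<open>dominated\<close>, with \<open>M\<close> positive definite on the subspace, provides
  the bound.\<close>

lemma rayleigh_imp_negative:
  assumes "\<rho> \<in> rayleigh_values m" "1 \<le> m"
  shows "0 \<le> \<rho>" "\<rho> < l \<Longrightarrow> negative l m"
proof -
  obtain \<phi> where \<phi>: "\<forall>i<m. \<phi> i \<in> V"
    "\<forall>c. Re (M (comb m \<phi> c) (comb m \<phi> c)) = 0 \<longrightarrow> (\<forall>i<m. c i = 0)"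
    and \<rho>: "\<rho> = Sup {Re (D (comb m \<phi> c) (comb m \<phi> c)) / Re (M (comb m \<phi> c) (comb m \<phi> c)) | c. \<exists>i<m. c i \<noteq> 0}"
      (is "_ = Sup ?R")
    using assms(1) unfolding rayleigh_values_def by blast
  have V: "comb m \<phi> c \<in> V" for c using \<phi>(1) by (intro comb_in_V) auto
  have pos: "0 < Re (M (comb m \<phi> c) (comb m \<phi> c))" if "\<exists>i<m. c i \<noteq> 0" for c
  proof -
    have "Re (M (comb m \<phi> c) (comb m \<phi> c)) \<noteq> 0" using \<phi>(2) that by blast
    then show ?thesis using M_nonneg[OF V[of c]] by simp
  qed
  obtain C where C: "\<And>c. Re (D (comb m \<phi> c) (comb m \<phi> c)) \<le> C * Re (M (comb m \<phi> c) (comb m \<phi> c))"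
    using dominated[OF D.hermitian_form_axioms D_nonneg M.hermitian_form_axioms, of m \<phi>] \<phi>(1) pos by blast
  have bdd: "bdd_above ?R"
  proof (rule bdd_aboveI[of _ C])
    fix r assume "r \<in> ?R"
    then obtain c where c: "r = Re (D (comb m \<phi> c) (comb m \<phi> c)) / Re (M (comb m \<phi> c) (comb m \<phi> c))
        \<and> (\<exists>i<m. c i \<noteq> 0)" unfolding mem_Collect_eq ..
    then have c: "\<exists>i<m. c i \<noteq> 0"
      "r = Re (D (comb m \<phi> c) (comb m \<phi> c)) / Re (M (comb m \<phi> c) (comb m \<phi> c))" by auto
    show "r \<le> C" unfolding c(2) using C[of c] pos[OF c(1)] by (simp add: divide_le_eq)
  qed
  have le: "Re (D (comb m \<phi> c) (comb m \<phi> c)) \<le> \<rho> * Re (M (comb m \<phi> c) (comb m \<phi> c))"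
    if c: "\<exists>i<m. c i \<noteq> 0" for c
  proof -
    have "Re (D (comb m \<phi> c) (comb m \<phi> c)) / Re (M (comb m \<phi> c) (comb m \<phi> c)) \<le> \<rho>"
      unfolding \<rho> using c by (intro cSup_upper[OF _ bdd]) blast
    then show ?thesis using pos[OF c] by (simp add: divide_le_eq)
  qed
  show "0 \<le> \<rho>"
  proof -
    have c: "\<exists>i<m. (\<lambda>_. 1::complex) i \<noteq> 0" using assms(2) by (intro exI[of _ 0]) auto
    show ?thesis using le[OF c] D_nonneg[OF V[of "\<lambda>_. 1"]] pos[OF c] by (smt (verit) mult_neg_pos)
  qed
  show "negative l m" if "\<rho> < l"
  proof -
    have "Re (q l (comb m \<phi> c) (comb m \<phi> c)) < 0" if c: "\<exists>i<m. c i \<noteq> 0" for c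
    proof -
      have "\<rho> * Re (M (comb m \<phi> c) (comb m \<phi> c)) < l * Re (M (comb m \<phi> c) (comb m \<phi> c))"
        using \<open>\<rho> < l\<close> pos[OF c] by simp
      then show ?thesis using le[OF c] by (simp add: Re_q)
    qed
    then show ?thesis using \<phi>(1) unfolding negative_def by blast
  qed
qed

text \<open>Both infima are approached from above. If \<sigma> is admissible, every l > \<sigma>^2
  has index at least m, hence a Rayleigh value at most l; if \<rho> is a Rayleigh value, every l >
  \<rho> has index at least m, and then \<open>sqrt l\<close> is admissible. Strictness of
  \<open>negative\<close> is absorbed by an arbitrarily small \<delta>.\<close>

theorem counting_eq_minmax:
  assumes m: "1 \<le> m"
  shows "(Inf {\<sigma>. 0 \<le> \<sigma> \<and> m \<le> (\<Sum>\<tau>\<in>{\<tau>. 0 \<le> \<tau> \<and> \<tau> \<le> \<sigma> \<and> mult \<tau> \<noteq> 0}. mult \<tau>)})\<^sup>2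
    = Inf (rayleigh_values m)"
proof -
  define cnt where "cnt \<sigma> = (\<Sum>\<tau>\<in>{\<tau>. 0 \<le> \<tau> \<and> \<tau> \<le> \<sigma> \<and> mult \<tau> \<noteq> 0}. mult \<tau>)" for \<sigma>
  define S where "S = {\<sigma>. 0 \<le> \<sigma> \<and> m \<le> cnt \<sigma>}"
  let ?R = "rayleigh_values m"
  have fin: "finite {\<tau>. 0 \<le> \<tau> \<and> \<tau> \<le> \<sigma> \<and> mult \<tau> \<noteq> 0}" for \<sigma>
  proof (rule finite_subset[OF _ finite_spectrum])
    show "{\<tau>. 0 \<le> \<tau> \<and> \<tau> \<le> \<sigma> \<and> mult \<tau> \<noteq> 0} \<subseteq> {\<tau>. 0 \<le> \<tau> \<and> \<tau>\<^sup>2 < \<sigma>\<^sup>2 + 1 \<and> mult \<tau> \<noteq> 0}"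
    proof (intro subsetI CollectI conjI; clarify)
      fix \<tau> assume "0 \<le> \<tau>" "\<tau> \<le> \<sigma>"
      then have "\<tau>\<^sup>2 \<le> \<sigma>\<^sup>2" by (intro power_mono)
      then show "\<tau>\<^sup>2 < \<sigma>\<^sup>2 + 1" by simp
    qed
  qed
  have S_neg: "negative l m" if "\<sigma> \<in> S" "\<sigma>\<^sup>2 < l" for \<sigma> l
  proof -
    have "cnt \<sigma> \<le> below l"
      unfolding cnt_def below_def
    proof (intro sum_mono2 finite_spectrum subsetI CollectI conjI; clarify)
      fix \<tau> assume "0 \<le> \<tau>" "\<tau> \<le> \<sigma>"
      then have "\<tau>\<^sup>2 \<le> \<sigma>\<^sup>2" by (intro power_mono)
      then show "\<tau>\<^sup>2 < l" using that by simp
    qed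
    then show ?thesis using that by (simp add: negative_iff S_def)
  qed
  have neg_S: "sqrt l \<in> S" if "negative l m" for l
  proof -
    have l: "0 < l" using negative_pos[OF that m] .
    have "below l \<le> cnt (sqrt l)"
      unfolding cnt_def below_def
      using l by (intro sum_mono2 fin) (auto intro!: real_le_rsqrt)
    then show ?thesis using that l by (simp add: negative_iff S_def)
  qed
  obtain l0 where "negative l0 m" using unbounded by auto
  then have S_ne: "S \<noteq> {}" and R_ne: "?R \<noteq> {}"
    using neg_S negative_imp_rayleigh m by blast+
  have R_bdd: "bdd_below ?R" using rayleigh_imp_negative(1)[OF _ m] by (intro bdd_belowI[of _ 0]) auto
  have S_bdd: "bdd_below S" by (intro bdd_belowI[of _ 0]) (auto simp: S_def)
  have R0: "0 \<le> Inf ?R" using R_ne rayleigh_imp_negative(1)[OF _ m] by (intro cInf_greatest) auto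
  have S0: "0 \<le> Inf S" using S_ne by (intro cInf_greatest) (auto simp: S_def)
  have "sqrt (Inf ?R) \<le> Inf S"
  proof (rule cInf_greatest[OF S_ne])
    fix \<sigma> assume \<sigma>: "\<sigma> \<in> S"
    have "Inf ?R \<le> \<sigma>\<^sup>2"
    proof (rule field_le_epsilon)
      fix \<delta> :: real assume "0 < \<delta>"
      then obtain \<rho> where "\<rho> \<in> ?R" "\<rho> \<le> \<sigma>\<^sup>2 + \<delta>"
        using negative_imp_rayleigh[OF S_neg[OF \<sigma>] m, of "\<sigma>\<^sup>2 + \<delta>"] by auto
      then show "Inf ?R \<le> \<sigma>\<^sup>2 + \<delta>" using cInf_lower[OF _ R_bdd] by force
    qed
    then show "sqrt (Inf ?R) \<le> \<sigma>" using \<sigma> by (intro real_le_lsqrt) (auto simp: S_def)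
  qed
  then have "Inf ?R \<le> (Inf S)\<^sup>2" using R0 S0 by (metis real_sqrt_le_iff real_sqrt_unique)
  moreover have "(Inf S)\<^sup>2 \<le> Inf ?R"
  proof (rule cInf_greatest[OF R_ne])
    fix \<rho> assume \<rho>: "\<rho> \<in> ?R"
    show "(Inf S)\<^sup>2 \<le> \<rho>"
    proof (rule field_le_epsilon)
      fix \<delta> :: real assume \<delta>: "0 < \<delta>"
      then have "sqrt (\<rho> + \<delta>) \<in> S" using rayleigh_imp_negative(2)[OF \<rho> m] by (intro neg_S) auto
      then have "Inf S \<le> sqrt (\<rho> + \<delta>)" using cInf_lower[OF _ S_bdd] by auto
      then have "(Inf S)\<^sup>2 \<le> (sqrt (\<rho> + \<delta>))\<^sup>2" using S0 by (intro power_mono)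
      then show "(Inf S)\<^sup>2 \<le> \<rho> + \<delta>" using rayleigh_imp_negative(1)[OF \<rho> m] \<delta> by simp
    qed
  qed
  ultimately show ?thesis by (simp add: S_def cnt_def)
qed

end

section \<open>Weak derivatives on an interval\<close>

text \<open>\<open>weak_deriv_on\<close> for an arbitrary interval, so that functions can be
  restricted to mesh cells and glued.\<close>

definition weak_deriv :: "real \<Rightarrow> real \<Rightarrow> (real \<Rightarrow> complex) \<Rightarrow> (real \<Rightarrow> complex) \<Rightarrow> bool" where
  "weak_deriv a b f g \<longleftrightarrow>
     g \<in> borel_measurable lborel \<and>
     set_integrable lborel {a..b} (\<lambda>s. (cmod (g s))^2) \<and>
     (\<forall>s\<in>{a..b}. f s = f a + (LINT t:{a..s}|lborel. g t))"

lemma weak_deriv_on_iff: "weak_deriv_on L f g \<longleftrightarrow> weak_deriv 0 L f g"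
  by (simp add: weak_deriv_on_def weak_deriv_def)

section \<open>Square integrable functions on an interval\<close>

text \<open>Measurability is asked on the interval only, since functions on an edge are arbitrary
  outside it.\<close>

definition square_integrable :: "real \<Rightarrow> real \<Rightarrow> (real \<Rightarrow> complex) \<Rightarrow> bool" where
  "square_integrable a b g \<longleftrightarrow>
    set_borel_measurable lborel {a..b} g \<and> set_integrable lborel {a..b} (\<lambda>s. (cmod (g s))^2)"

lemma set_integrable_bound:
  fixes f :: "real \<Rightarrow> complex"
  assumes "set_integrable lborel A h" "set_borel_measurable lborel A f"
    and "\<And>s. s \<in> A \<Longrightarrow> cmod (f s) \<le> h s"
  shows "set_integrable lborel A f"
  unfolding set_integrable_def
proof (rule Bochner_Integration.integrable_bound)
  show "integrable lborel (\<lambda>x. indicat_real A x *\<^sub>R h x)"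
    using assms(1) unfolding set_integrable_def .
  show "AE x in lborel. norm (indicat_real A x *\<^sub>R f x) \<le> norm (indicat_real A x *\<^sub>R h x)"
    using assms(3) by (intro AE_I2) (force simp: indicator_def)
qed (use assms(2) in \<open>simp add: set_borel_measurable_def\<close>)

lemma set_integrable_mult:
  assumes "square_integrable a b f" "square_integrable a b g"
  shows "set_integrable lborel {a..b} (\<lambda>s. f s * cnj (g s))"
proof (rule set_integrable_bound)
  show "set_integrable lborel {a..b} (\<lambda>s. (cmod (f s))\<^sup>2 + (cmod (g s))\<^sup>2)"
    using assms by (intro set_integral_add) (auto simp: square_integrable_def)
  have m: "(\<lambda>x. indicator {a..b} x *\<^sub>R f x) \<in> borel_measurable lborel"
    "(\<lambda>x. indicator {a..b} x *\<^sub>R g x) \<in> borel_measurable lborel"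
    using assms by (auto simp: square_integrable_def set_borel_measurable_def)
  have "cnj \<in> borel_measurable borel" by (intro borel_measurable_continuous_onI continuous_intros)
  from borel_measurable_times[OF m(1) measurable_compose[OF m(2) this]]
  have "(\<lambda>x. (indicat_real {a..b} x *\<^sub>R f x) * cnj (indicat_real {a..b} x *\<^sub>R g x)) \<in> borel_measurable lborel" .
  also have "(\<lambda>x. (indicat_real {a..b} x *\<^sub>R f x) * cnj (indicat_real {a..b} x *\<^sub>R g x))
      = (\<lambda>x. indicat_real {a..b} x *\<^sub>R (f x * cnj (g x)))"
    by (auto simp: indicator_def)
  finally show "set_borel_measurable lborel {a..b} (\<lambda>s. f s * cnj (g s))"
    unfolding set_borel_measurable_def .
  fix s
  have "2 * (cmod (f s) * cmod (g s)) \<le> (cmod (f s))\<^sup>2 + (cmod (g s))\<^sup>2"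
    using sum_squares_bound[of "cmod (f s)" "cmod (g s)"] by simp
  moreover have "0 \<le> cmod (f s) * cmod (g s)" by simp
  ultimately have "cmod (f s) * cmod (g s) \<le> (cmod (f s))\<^sup>2 + (cmod (g s))\<^sup>2" by linarith
  then show "cmod (f s * cnj (g s)) \<le> (cmod (f s))\<^sup>2 + (cmod (g s))\<^sup>2"
    by (simp add: norm_mult)
qed

lemma square_integrable_continuous:
  assumes "continuous_on {a..b} f"
  shows "square_integrable a b f"
proof -
  have "continuous_on {a..b} (\<lambda>s. (cmod (f s))\<^sup>2)" using assms by (intro continuous_intros)
  then have "set_integrable lborel {a..b} (\<lambda>s. (cmod (f s))\<^sup>2)"
    by (rule borel_integrable_atLeastAtMost')
  moreover have "set_borel_measurable lborel {a..b} f"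
    using borel_measurable_continuous_on_indicator[OF _ assms] by (simp add: set_borel_measurable_def)
  ultimately show ?thesis by (simp add: square_integrable_def)
qed

lemma square_integrable_const: "square_integrable a b (\<lambda>_. c)"
  by (intro square_integrable_continuous continuous_intros)

lemma square_integrable_imp_integrable:
  assumes "square_integrable a b f"
  shows "set_integrable lborel {a..b} f"
  using set_integrable_mult[OF assms square_integrable_const[of a b 1]] by simp

lemma square_integrable_add:
  assumes "square_integrable a b f" "square_integrable a b g"
  shows "square_integrable a b (\<lambda>s. f s + g s)"
proof -
  have m: "(\<lambda>x. indicator {a..b} x *\<^sub>R f x) \<in> borel_measurable lborel"
    "(\<lambda>x. indicator {a..b} x *\<^sub>R g x) \<in> borel_measurable lborel"
    using assms by (auto simp: square_integrable_def set_borel_measurable_def)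
  from borel_measurable_add[OF this]
  have m: "set_borel_measurable lborel {a..b} (\<lambda>s. f s + g s)"
    by (simp add: set_borel_measurable_def scaleR_add_right)
  \<comment> \<open>The expansion of (f + g) times its conjugate consists of products already known
    to be integrable; the real statement is read off from the complex one.\<close>
  have "set_integrable lborel {a..b} (\<lambda>s. f s * cnj (f s) + f s * cnj (g s) + (g s * cnj (f s) + g s * cnj (g s)))"
    using assms by (intro set_integral_add set_integrable_mult)
  then have "set_integrable lborel {a..b} (\<lambda>s. complex_of_real ((cmod (f s + g s))\<^sup>2))"
    by (simp only: complex_norm_square) (simp add: algebra_simps)
  then have "set_integrable lborel {a..b} (\<lambda>s. (cmod (f s + g s))\<^sup>2)"
  proof -
    assume "set_integrable lborel {a..b} (\<lambda>s. complex_of_real ((cmod (f s + g s))\<^sup>2))"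
    then have "integrable lborel (\<lambda>x. complex_of_real (indicat_real {a..b} x * (cmod (f x + g x))\<^sup>2))"
      unfolding set_integrable_def scaleR_conv_of_real of_real_mult .
    then show ?thesis
      unfolding complex_of_real_integrable_eq set_integrable_def real_scaleR_def .
  qed
  then show ?thesis using m by (simp add: square_integrable_def)
qed

lemma square_integrable_scale:
  assumes "square_integrable a b f"
  shows "square_integrable a b (\<lambda>s. c * f s)"
proof -
  have "(\<lambda>x. c * (indicat_real {a..b} x *\<^sub>R f x)) \<in> borel_measurable lborel"
    using assms by (intro borel_measurable_times) (auto simp: square_integrable_def set_borel_measurable_def)
  moreover have "set_integrable lborel {a..b} (\<lambda>s. (cmod c)\<^sup>2 * (cmod (f s))\<^sup>2)"
    using assms by (intro set_integrable_mult_right) (auto simp: square_integrable_def)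
  ultimately show ?thesis
    by (simp add: square_integrable_def set_borel_measurable_def norm_mult power_mult_distrib)
qed

lemma square_integrable_subset:
  assumes "square_integrable a b f" "a \<le> c" "d \<le> b"
  shows "square_integrable c d f"
proof -
  have "{c..d} \<subseteq> {a..b}" using assms by auto
  then show ?thesis
    using assms set_integrable_subset[of lborel "{a..b}" _ "{c..d}"] set_borel_measurable_subset[of lborel "{a..b}" _ "{c..d}"]
    by (auto simp: square_integrable_def)
qed

section \<open>Calculus of weak derivatives\<close>

lemma weak_derivD:
  "weak_deriv a b f g \<Longrightarrow> a \<le> s \<Longrightarrow> s \<le> b \<Longrightarrow> f s = f a + (LINT t:{a..s}|lborel. g t)"
  unfolding weak_deriv_def by (meson atLeastAtMost_iff)

lemma weak_derivI:
  assumes "g \<in> borel_measurable lborel" "square_integrable a b g"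
    and "\<And>s. a \<le> s \<Longrightarrow> s \<le> b \<Longrightarrow> f s = f a + (LINT t:{a..s}|lborel. g t)"
  shows "weak_deriv a b f g"
  unfolding weak_deriv_def
  by (intro conjI ballI assms) (use assms(2) in \<open>simp_all add: square_integrable_def\<close>)

lemma weak_deriv_measurable: "weak_deriv a b f g \<Longrightarrow> g \<in> borel_measurable lborel"
  unfolding weak_deriv_def by blast

lemma weak_deriv_square_integrable:
  assumes "weak_deriv a b f g"
  shows "square_integrable a b g"
  using assms by (auto simp: weak_deriv_def square_integrable_def set_borel_measurable_def)

lemma LINT_combine:
  fixes g :: "real \<Rightarrow> 'a::euclidean_space"
  assumes "set_integrable lborel {a..b} g" "a \<le> c" "c \<le> d" "d \<le> b"
  shows "(LINT t:{a..d}|lborel. g t) = (LINT t:{a..c}|lborel. g t) + (LINT t:{c..d}|lborel. g t)"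
proof -
  have *: "set_integrable lborel {x..y} g" if "a \<le> x" "y \<le> b" for x y
    using that by (intro set_integrable_subset[OF assms(1)]) auto
  have "integral {a..d} g = integral {a..c} g + integral {c..d} g"
    using set_borel_integral_eq_integral(1)[OF *[of a d]] assms by (intro Henstock_Kurzweil_Integration.integral_combine[symmetric]) auto
  then show ?thesis
    using set_borel_integral_eq_integral(2)[OF *] assms by simp
qed

lemma weak_deriv_continuous:
  assumes "weak_deriv a b f g"
  shows "continuous_on {a..b} f"
proof -
  have g: "set_integrable lborel {a..b} g"
    using assms weak_deriv_square_integrable square_integrable_imp_integrable by blast
  have eq: "f s = f a + integral {a..s} g" if "s \<in> {a..b}" for s
  proof -
    have "set_integrable lborel {a..s} g" using g that by (intro set_integrable_subset[OF g]) auto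
    from set_borel_integral_eq_integral(2)[OF this] show ?thesis
      using weak_derivD[OF assms, of s] that by simp
  qed
  have "continuous_on {a..b} (\<lambda>s. f a + integral {a..s} g)"
    using set_borel_integral_eq_integral(1)[OF g] by (intro continuous_intros indefinite_integral_continuous_1)
  then show ?thesis by (rule continuous_on_eq) (rule eq[symmetric])
qed

lemma weak_deriv_diff:
  assumes "weak_deriv a b f g" "a \<le> r" "r \<le> s" "s \<le> b"
  shows "f s = f r + (LINT t:{r..s}|lborel. g t)"
proof -
  have g: "set_integrable lborel {a..b} g"
    using assms weak_deriv_square_integrable square_integrable_imp_integrable by blast
  have "f r = f a + (LINT t:{a..r}|lborel. g t)" "f s = f a + (LINT t:{a..s}|lborel. g t)"
    by (rule weak_derivD[OF assms(1)]; use assms in simp)+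
  then show ?thesis using LINT_combine[OF g assms(2-4)] by simp
qed

lemma weak_deriv_restrict:
  assumes "weak_deriv a b f g" "a \<le> c" "d \<le> b"
  shows "weak_deriv c d f g"
proof (rule weak_derivI)
  show "square_integrable c d g"
    using square_integrable_subset[OF weak_deriv_square_integrable[OF assms(1)]] assms by blast
  show "f s = f c + (LINT t:{c..s}|lborel. g t)" if "c \<le> s" "s \<le> d" for s
    by (rule weak_deriv_diff[OF assms(1)]) (use assms that in auto)
qed (rule weak_deriv_measurable[OF assms(1)])

lemma weak_deriv_glue:
  assumes "weak_deriv a b f g" "weak_deriv b c f g" "a \<le> b" "b \<le> c"
  shows "weak_deriv a c f g"
proof (rule weak_derivI)
  show m: "g \<in> borel_measurable lborel" by (rule weak_deriv_measurable[OF assms(1)])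
  have U: "{a..b} \<union> {b..c} = {a..c}" using assms by auto
  have "set_integrable lborel ({a..b} \<union> {b..c}) (\<lambda>s. (cmod (g s))\<^sup>2)"
    using weak_deriv_square_integrable[OF assms(1)] weak_deriv_square_integrable[OF assms(2)]
    by (intro set_integrable_Un) (auto simp: square_integrable_def)
  then show sq: "square_integrable a c g"
    using m by (auto simp: U square_integrable_def set_borel_measurable_def)
  then have g: "set_integrable lborel {a..c} g" by (rule square_integrable_imp_integrable)
  show "f s = f a + (LINT t:{a..s}|lborel. g t)" if s: "a \<le> s" "s \<le> c" for s
  proof (cases "s \<le> b")
    case True
    then show ?thesis using weak_derivD[OF assms(1)] s by blast
  next
    case False
    then have "f s = f b + (LINT t:{b..s}|lborel. g t)" by (intro weak_derivD[OF assms(2)]) (use s in auto)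
    moreover have "f b = f a + (LINT t:{a..b}|lborel. g t)" by (intro weak_derivD[OF assms(1)]) (use assms(3) in auto)
    ultimately show ?thesis using LINT_combine[OF g assms(3), of s] False s by simp
  qed
qed

lemma weak_deriv_add:
  assumes "weak_deriv a b f g" "weak_deriv a b f' g'"
  shows "weak_deriv a b (\<lambda>s. f s + f' s) (\<lambda>s. g s + g' s)"
proof (rule weak_derivI)
  note sq = weak_deriv_square_integrable[OF assms(1)] weak_deriv_square_integrable[OF assms(2)]
  show "square_integrable a b (\<lambda>s. g s + g' s)" using sq by (rule square_integrable_add)
  fix s assume s: "a \<le> s" "s \<le> b"
  have "(LINT t:{a..s}|lborel. g t + g' t) = (LINT t:{a..s}|lborel. g t) + (LINT t:{a..s}|lborel. g' t)"
    using s by (intro set_integral_add square_integrable_imp_integrable square_integrable_subset[OF sq(1)]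
        square_integrable_subset[OF sq(2)]) auto
  then show "f s + f' s = f a + f' a + (LINT t:{a..s}|lborel. g t + g' t)"
    using weak_derivD[OF assms(1) s] weak_derivD[OF assms(2) s] by simp
qed (intro borel_measurable_add weak_deriv_measurable[OF assms(1)] weak_deriv_measurable[OF assms(2)])

lemma weak_deriv_scale:
  assumes "weak_deriv a b f g"
  shows "weak_deriv a b (\<lambda>s. c * f s) (\<lambda>s. c * g s)"
proof (rule weak_derivI)
  show "square_integrable a b (\<lambda>s. c * g s)"
    by (rule square_integrable_scale[OF weak_deriv_square_integrable[OF assms]])
  fix s assume s: "a \<le> s" "s \<le> b"
  show "c * f s = c * f a + (LINT t:{a..s}|lborel. c * g t)"
    using weak_derivD[OF assms s] by (simp add: ring_distribs)
qed (intro borel_measurable_times weak_deriv_measurable[OF assms] borel_measurable_const)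

lemma weak_deriv_cong:
  assumes "weak_deriv a b f g" "\<And>s. a \<le> s \<Longrightarrow> s \<le> b \<Longrightarrow> f' s = f s"
  shows "weak_deriv a b f' g"
proof (rule weak_derivI)
  fix s assume s: "a \<le> s" "s \<le> b"
  then show "f' s = f' a + (LINT t:{a..s}|lborel. g t)"
    using weak_derivD[OF assms(1) s] assms(2)[of s] assms(2)[of a] by simp
qed (use weak_deriv_measurable[OF assms(1)] weak_deriv_square_integrable[OF assms(1)] in auto)

text \<open>Lets derivatives of adjacent pieces be merged although they disagree at the common node,
  and lets a derivative be exchanged for a continuous representative.\<close>

lemma weak_deriv_AE_cong:
  assumes f: "weak_deriv a b f g" and g': "g' \<in> borel_measurable lborel"
    and ae: "AE s in lborel. s \<in> {a..b} \<longrightarrow> g' s = g s"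
  shows "weak_deriv a b f g'"
proof (rule weak_derivI)
  have g: "g \<in> borel_measurable lborel" by (rule weak_deriv_measurable[OF f])
  have "set_integrable lborel {a..b} (\<lambda>s. (cmod (g s))\<^sup>2)"
    using weak_deriv_square_integrable[OF f] by (simp add: square_integrable_def)
  then have "set_integrable lborel {a..b} (\<lambda>s. (cmod (g' s))\<^sup>2)"
    unfolding set_integrable_def
  proof (rule integrable_cong_AE_imp)
    show "(\<lambda>x. indicat_real {a..b} x *\<^sub>R (cmod (g' x))\<^sup>2) \<in> borel_measurable lborel"
      using g' by measurable
    show "AE x in lborel. indicat_real {a..b} x *\<^sub>R (cmod (g x))\<^sup>2 = indicat_real {a..b} x *\<^sub>R (cmod (g' x))\<^sup>2"
      using ae by eventually_elim (auto simp: indicator_def)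
  qed
  then show "square_integrable a b g'"
    using g' by (auto simp: square_integrable_def set_borel_measurable_def)
  fix s assume s: "a \<le> s" "s \<le> b"
  have "(LINT t:{a..s}|lborel. g t) = (LINT t:{a..s}|lborel. g' t)"
    unfolding set_lebesgue_integral_def
  proof (rule integral_cong_AE)
    show "AE x in lborel. indicat_real {a..s} x *\<^sub>R g x = indicat_real {a..s} x *\<^sub>R g' x"
      using ae by eventually_elim (use s in \<open>auto simp: indicator_def\<close>)
  qed (use g g' in auto)
  then show "f s = f a + (LINT t:{a..s}|lborel. g' t)" using weak_derivD[OF f s] by simp
qed (rule g')

text \<open>The indicator makes the derivative Borel on the whole line, as \<open>weak_deriv\<close>
  demands.\<close>

lemma weak_deriv_indefinite:
  assumes "square_integrable a b g"
  shows "weak_deriv a b (\<lambda>s. LINT t:{a..s}|lborel. g t) (\<lambda>s. indicat_real {a..b} s *\<^sub>R g s)"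
proof (rule weak_derivI)
  show m: "(\<lambda>s. indicat_real {a..b} s *\<^sub>R g s) \<in> borel_measurable lborel"
    using assms by (simp add: square_integrable_def set_borel_measurable_def)
  have "(\<lambda>x. indicat_real {a..b} x *\<^sub>R (cmod (indicat_real {a..b} x *\<^sub>R g x))\<^sup>2) =
      (\<lambda>x. indicat_real {a..b} x *\<^sub>R (cmod (g x))\<^sup>2)"
    by (auto simp: indicator_def)
  then have "set_integrable lborel {a..b} (\<lambda>s. (cmod (indicat_real {a..b} s *\<^sub>R g s))\<^sup>2)"
    using assms by (simp add: square_integrable_def set_integrable_def)
  then show "square_integrable a b (\<lambda>s. indicat_real {a..b} s *\<^sub>R g s)"
  proof -
    have "(\<lambda>x. indicat_real {a..b} x *\<^sub>R (indicat_real {a..b} x *\<^sub>R g x)) = (\<lambda>x. indicat_real {a..b} x *\<^sub>R g x)"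
      by (auto simp: indicator_def)
    moreover assume "set_integrable lborel {a..b} (\<lambda>s. (cmod (indicat_real {a..b} s *\<^sub>R g s))\<^sup>2)"
    ultimately show ?thesis
      using m unfolding square_integrable_def set_borel_measurable_def by (simp only: simp_thms)
  qed
  fix s assume s: "a \<le> s" "s \<le> b"
  have "(LINT t:{a..a}|lborel. g t) = 0"
  proof -
    have "AE t in lborel. indicat_real {a..a} t *\<^sub>R g t = 0"
      using AE_lborel_singleton[of a] by eventually_elim auto
    then show ?thesis unfolding set_lebesgue_integral_def by (rule integral_eq_zero_AE)
  qed
  moreover have "(LINT t:{a..s}|lborel. indicat_real {a..b} t *\<^sub>R g t) = (LINT t:{a..s}|lborel. g t)"
    using s unfolding set_lebesgue_integral_def
    by (intro Bochner_Integration.integral_cong) (auto simp: indicator_def)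
  ultimately show "(LINT t:{a..s}|lborel. g t) = (LINT t:{a..a}|lborel. g t) +
      (LINT t:{a..s}|lborel. indicat_real {a..b} t *\<^sub>R g t)" by simp
qed

lemma weak_deriv_smooth:
  assumes "\<And>x. (f has_vector_derivative g x) (at x)" "continuous_on UNIV g"
  shows "weak_deriv a b f g"
proof (rule weak_derivI)
  show "g \<in> borel_measurable lborel" using assms(2) borel_measurable_continuous_onI by auto
  have c: "continuous_on A g" for A using assms(2) continuous_on_subset by blast
  then show "square_integrable a b g" by (intro square_integrable_continuous)
  fix s assume s: "a \<le> s" "s \<le> b"
  have "set_integrable lborel {a..s} g"
    by (intro square_integrable_imp_integrable square_integrable_continuous c)
  then have "(LINT t:{a..s}|lborel. g t) = integral {a..s} g" by (rule set_borel_integral_eq_integral(2))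
  also have "\<dots> = f s - f a"
    using s assms(1) by (intro integral_unique fundamental_theorem_of_calculus)
      (auto intro: has_vector_derivative_at_within)
  finally show "f s = f a + (LINT t:{a..s}|lborel. g t)" by simp
qed

text \<open>Integration by parts for absolutely continuous functions: by Fubini's theorem the
  integral of g1(s) g2(t) over the square splits along the diagonal into two triangles, whose
  iterated integrals are the two summands.\<close>

lemma LINT_product:
  fixes g1 g2 :: "real \<Rightarrow> complex"
  assumes g1: "set_integrable lborel {a..b} g1" and g2: "set_integrable lborel {a..b} g2"
  shows "set_integrable lborel {a..b} (\<lambda>s. g1 s * (LINT t:{a..s}|lborel. g2 t))"
    and "set_integrable lborel {a..b} (\<lambda>s. g2 s * (LINT t:{a..s}|lborel. g1 t))"
    and "(LINT s:{a..b}|lborel. g1 s * (LINT t:{a..s}|lborel. g2 t)) +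
      (LINT s:{a..b}|lborel. g2 s * (LINT t:{a..s}|lborel. g1 t)) =
      (LINT s:{a..b}|lborel. g1 s) * (LINT s:{a..b}|lborel. g2 s)"
proof -
  define G1 where "G1 = (\<lambda>x. indicat_real {a..b} x *\<^sub>R g1 x)"
  define G2 where "G2 = (\<lambda>x. indicat_real {a..b} x *\<^sub>R g2 x)"
  have int: "integrable lborel G1" "integrable lborel G2"
    using g1 g2 by (auto simp: G1_def G2_def set_integrable_def)
  have [measurable]: "G1 \<in> borel_measurable lborel" "G2 \<in> borel_measurable lborel"
    using int by auto
  define H where "H = (\<lambda>(s, t). G1 s * G2 t)"
  have H_int: "integrable (lborel \<Otimes>\<^sub>M lborel) H"
  proof (rule lborel_pair.Fubini_integrable)
    show "H \<in> borel_measurable (lborel \<Otimes>\<^sub>M lborel)" unfolding H_def by measurable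
    have "integrable lborel (\<lambda>x. norm (G1 x) * (LINT y|lborel. norm (G2 y)))"
      using int by (intro integrable_mult_left integrable_norm)
    then show "integrable lborel (\<lambda>x. LINT y|lborel. norm (H (x, y)))"
      by (simp add: H_def norm_mult)
    show "AE x in lborel. integrable lborel (\<lambda>y. H (x, y))"
      using int by (simp add: H_def)
  qed
  define P where "P = {p::real \<times> real. snd p \<le> fst p}"
  define N where "N = {p::real \<times> real. fst p < snd p}"
  have P: "P \<in> sets (lborel \<Otimes>\<^sub>M lborel)"
    unfolding P_def lborel_prod sets_lborel
    by (intro borel_closed closed_Collect_le continuous_intros)
  have N: "N \<in> sets (lborel \<Otimes>\<^sub>M lborel)"
    unfolding N_def lborel_prod sets_lborel
    by (intro borel_open open_Collect_less continuous_intros)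
  have KP: "integrable (lborel \<Otimes>\<^sub>M lborel) (\<lambda>p. indicat_real P p *\<^sub>R H p)"
    and KN: "integrable (lborel \<Otimes>\<^sub>M lborel) (\<lambda>p. indicat_real N p *\<^sub>R H p)"
    using integrable_mult_indicator[OF P H_int] integrable_mult_indicator[OF N H_int] .
  have inner: "(LINT t|lborel. indicat_real {..s} t *\<^sub>R G t) = (LINT t:{a..s}|lborel. g t)"
    if "s \<in> {a..b}" "G = (\<lambda>x. indicat_real {a..b} x *\<^sub>R g x)" for s g and G :: "real \<Rightarrow> complex"
    unfolding set_lebesgue_integral_def that(2)
    using that(1) by (intro Bochner_Integration.integral_cong) (auto simp: indicator_def)
  have EP: "(LINT t|lborel. indicat_real P (s, t) *\<^sub>R H (s, t)) =
      indicat_real {a..b} s *\<^sub>R (g1 s * (LINT t:{a..s}|lborel. g2 t))" for s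
  proof -
    have "(LINT t|lborel. indicat_real P (s, t) *\<^sub>R H (s, t)) = (LINT t|lborel. G1 s * (indicat_real {..s} t *\<^sub>R G2 t))"
      by (intro Bochner_Integration.integral_cong) (auto simp: P_def H_def indicator_def)
    also have "\<dots> = G1 s * (LINT t|lborel. indicat_real {..s} t *\<^sub>R G2 t)"
      by (rule integral_mult_right_zero)
    also have "\<dots> = indicat_real {a..b} s *\<^sub>R (g1 s * (LINT t:{a..s}|lborel. g2 t))"
      using inner[of s G2 g2] by (cases "s \<in> {a..b}") (auto simp: G1_def G2_def)
    finally show ?thesis .
  qed
  have EN: "(LINT s|lborel. indicat_real N (s, t) *\<^sub>R H (s, t)) =
      indicat_real {a..b} t *\<^sub>R (g2 t * (LINT s:{a..t}|lborel. g1 s))" for t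
  proof -
    \<comment> \<open>The open triangle has the slice s < t, the half-line includes s = t; the two
      differ in a single point.\<close>
    have "AE s in lborel. indicat_real N (s, t) *\<^sub>R H (s, t) = G2 t * (indicat_real {..t} s *\<^sub>R G1 s)"
      using AE_lborel_singleton[of t] by eventually_elim (auto simp: N_def H_def indicator_def)
    then have "(LINT s|lborel. indicat_real N (s, t) *\<^sub>R H (s, t)) = (LINT s|lborel. G2 t * (indicat_real {..t} s *\<^sub>R G1 s))"
      using N P by (intro integral_cong_AE) (auto simp: N_def H_def)
    also have "\<dots> = G2 t * (LINT s|lborel. indicat_real {..t} s *\<^sub>R G1 s)"
      by (rule integral_mult_right_zero)
    also have "\<dots> = indicat_real {a..b} t *\<^sub>R (g2 t * (LINT s:{a..t}|lborel. g1 s))"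
      using inner[of t G1 g1] by (cases "t \<in> {a..b}") (auto simp: G1_def G2_def)
    finally show ?thesis .
  qed
  show 1: "set_integrable lborel {a..b} (\<lambda>s. g1 s * (LINT t:{a..s}|lborel. g2 t))"
    using lborel_pair.integrable_fst'[OF KP] by (simp only: EP set_integrable_def)
  have KN': "integrable (lborel \<Otimes>\<^sub>M lborel) (\<lambda>(s, t). indicat_real N (s, t) *\<^sub>R H (s, t))"
    using KN by (simp add: case_prod_unfold)
  show 2: "set_integrable lborel {a..b} (\<lambda>s. g2 s * (LINT t:{a..s}|lborel. g1 t))"
    using lborel_pair.integrable_snd[OF KN'] by (simp only: EN set_integrable_def)
  let ?PP = "lborel \<Otimes>\<^sub>M lborel :: (real \<times> real) measure"
  have "H p = indicat_real P p *\<^sub>R H p + indicat_real N p *\<^sub>R H p" for p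
    by (auto simp: P_def N_def indicator_def)
  then have "(LINT p|?PP. H p) =
      (LINT p|?PP. indicat_real P p *\<^sub>R H p + indicat_real N p *\<^sub>R H p)"
    by (intro Bochner_Integration.integral_cong) auto
  also have "\<dots> = (LINT p|?PP. indicat_real P p *\<^sub>R H p) + (LINT p|?PP. indicat_real N p *\<^sub>R H p)"
    using KP KN by (rule Bochner_Integration.integral_add)
  also have "(LINT p|?PP. indicat_real P p *\<^sub>R H p) = (LINT s:{a..b}|lborel. g1 s * (LINT t:{a..s}|lborel. g2 t))"
    using lborel_pair.integral_fst'[OF KP] by (simp only: EP set_lebesgue_integral_def)
  also have "(LINT p|?PP. indicat_real N p *\<^sub>R H p) = (LINT s:{a..b}|lborel. g2 s * (LINT t:{a..s}|lborel. g1 t))"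
    using lborel_pair.integral_snd[OF KN'] by (simp only: EN set_lebesgue_integral_def case_prod_unfold prod.collapse)
  finally have sum: "(LINT p|?PP. H p) = (LINT s:{a..b}|lborel. g1 s * (LINT t:{a..s}|lborel. g2 t)) +
      (LINT s:{a..b}|lborel. g2 s * (LINT t:{a..s}|lborel. g1 t))" .
  show "(LINT s:{a..b}|lborel. g1 s * (LINT t:{a..s}|lborel. g2 t)) +
      (LINT s:{a..b}|lborel. g2 s * (LINT t:{a..s}|lborel. g1 t)) =
      (LINT s:{a..b}|lborel. g1 s) * (LINT s:{a..b}|lborel. g2 s)"
  proof -
    have "(LINT p|?PP. H p) = (LINT x|lborel. LINT y|lborel. G1 x * G2 y)"
      using lborel_pair.integral_fst'[OF H_int] by (simp only: H_def prod.case)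
    also have "\<dots> = (LINT x|lborel. G1 x * (LINT y|lborel. G2 y))"
      by (simp only: integral_mult_right_zero)
    also have "\<dots> = (LINT x|lborel. G1 x) * (LINT y|lborel. G2 y)"
      by (rule integral_mult_left_zero)
    finally show ?thesis
      unfolding sum[symmetric] by (simp only: G1_def G2_def set_lebesgue_integral_def)
  qed
qed

lemma square_integrable_cnj: "square_integrable a b f \<Longrightarrow> square_integrable a b (\<lambda>s. cnj (f s))"
proof -
  assume f: "square_integrable a b f"
  have "cnj \<in> borel_measurable borel" by (intro borel_measurable_continuous_onI continuous_intros)
  from measurable_compose[OF _ this, of "\<lambda>x. indicat_real {a..b} x *\<^sub>R f x" lborel]
  show ?thesis using f by (simp add: square_integrable_def set_borel_measurable_def)
qed

lemma weak_deriv_cnj: "weak_deriv a b f g \<Longrightarrow> weak_deriv a b (\<lambda>s. cnj (f s)) (\<lambda>s. cnj (g s))"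
proof (rule weak_derivI)
  assume f: "weak_deriv a b f g"
  have "cnj \<in> borel_measurable borel" by (intro borel_measurable_continuous_onI continuous_intros)
  from measurable_compose[OF weak_deriv_measurable[OF f] this]
  show "(\<lambda>s. cnj (g s)) \<in> borel_measurable lborel" .
  show "square_integrable a b (\<lambda>s. cnj (g s))"
    by (intro square_integrable_cnj weak_deriv_square_integrable[OF f])
  fix s assume s: "a \<le> s" "s \<le> b"
  have "(LINT t:{a..s}|lborel. cnj (g t)) = cnj (LINT t:{a..s}|lborel. g t)"
    unfolding set_lebesgue_integral_def complex_cnj_scaleR[symmetric] by (rule Bochner_Integration.integral_cnj)
  then show "cnj (f s) = cnj (f a) + (LINT t:{a..s}|lborel. cnj (g t))"
    using weak_derivD[OF f s] by simp
qed

lemma set_integrable_mult':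
  assumes "square_integrable a b f" "square_integrable a b g"
  shows "set_integrable lborel {a..b} (\<lambda>s. f s * g s)"
  using set_integrable_mult[OF assms(1) square_integrable_cnj[OF assms(2)]] by simp

lemma weak_deriv_product:
  assumes f: "weak_deriv a b f g" and f': "weak_deriv a b f' g'" and "a \<le> b"
  shows "(LINT s:{a..b}|lborel. g s * f' s) + (LINT s:{a..b}|lborel. g' s * f s) = f b * f' b - f a * f' a"
proof -
  have g: "set_integrable lborel {a..b} g" and g': "set_integrable lborel {a..b} g'"
    by (intro square_integrable_imp_integrable weak_deriv_square_integrable[OF f] weak_deriv_square_integrable[OF f'])+
  note P = LINT_product[OF g g']
  have "(LINT s:{a..b}|lborel. g s * f' s) = (LINT s:{a..b}|lborel. g s * f' a + g s * (LINT t:{a..s}|lborel. g' t))"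
  proof (rule set_lebesgue_integral_cong, simp, intro allI impI)
    fix s assume s: "s \<in> {a..b}"
    show "g s * f' s = g s * f' a + g s * (LINT t:{a..s}|lborel. g' t)"
      using weak_derivD[OF f', of s] s by (simp only: distrib_left[symmetric]) simp
  qed
  also have "\<dots> = (LINT s:{a..b}|lborel. g s) * f' a + (LINT s:{a..b}|lborel. g s * (LINT t:{a..s}|lborel. g' t))"
    using g P(1) by (subst set_integral_add) auto
  finally have 1: "(LINT s:{a..b}|lborel. g s * f' s) =
    (LINT s:{a..b}|lborel. g s) * f' a + (LINT s:{a..b}|lborel. g s * (LINT t:{a..s}|lborel. g' t))" .
  have "(LINT s:{a..b}|lborel. g' s * f s) = (LINT s:{a..b}|lborel. g' s * f a + g' s * (LINT t:{a..s}|lborel. g t))"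
  proof (rule set_lebesgue_integral_cong, simp, intro allI impI)
    fix s assume s: "s \<in> {a..b}"
    show "g' s * f s = g' s * f a + g' s * (LINT t:{a..s}|lborel. g t)"
      using weak_derivD[OF f, of s] s by (simp only: distrib_left[symmetric]) simp
  qed
  also have "\<dots> = (LINT s:{a..b}|lborel. g' s) * f a + (LINT s:{a..b}|lborel. g' s * (LINT t:{a..s}|lborel. g t))"
    using g' P(2) by (subst set_integral_add) auto
  finally have 2: "(LINT s:{a..b}|lborel. g' s * f s) =
    (LINT s:{a..b}|lborel. g' s) * f a + (LINT s:{a..b}|lborel. g' s * (LINT t:{a..s}|lborel. g t))" .
  have e: "(LINT s:{a..b}|lborel. g s) = f b - f a" "(LINT s:{a..b}|lborel. g' s) = f' b - f' a"
    using weak_derivD[OF f \<open>a \<le> b\<close> order_refl] weak_derivD[OF f' \<open>a \<le> b\<close> order_refl]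
    by (simp_all only: add_diff_cancel_left')
  have "(LINT s:{a..b}|lborel. g s * f' s) + (LINT s:{a..b}|lborel. g' s * f s) =
    (f b - f a) * f' a + (f' b - f' a) * f a + (f b - f a) * (f' b - f' a)"
    using P(3) unfolding 1 2 e by (simp only: add.assoc add.left_commute)
  then show ?thesis by (simp add: algebra_simps)
qed

lemma integration_by_parts_weak:
  assumes u: "weak_deriv a b v w" and h: "weak_deriv a b h \<gamma>" and "a \<le> b"
  shows "(LINT s:{a..b}|lborel. v s * cnj (\<gamma> s)) = v b * cnj (h b) - v a * cnj (h a) - (LINT s:{a..b}|lborel. w s * cnj (h s))"
  using weak_deriv_product[OF u weak_deriv_cnj[OF h] \<open>a \<le> b\<close>] by (simp add: algebra_simps)

section \<open>Uniqueness of the weak derivative, definiteness, Poincare's inequality\<close>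

text \<open>Half-lines form an intersection-stable generator of the Borel sets, so the integral
  vanishes over every Borel set, and a function with this property is zero almost
  everywhere.\<close>

lemma AE_zero_of_LINT_zero:
  fixes g :: "real \<Rightarrow> complex"
  assumes g: "set_integrable lborel {a..b} g" and z: "\<And>s. a \<le> s \<Longrightarrow> s \<le> b \<Longrightarrow> (LINT t:{a..s}|lborel. g t) = 0"
    and "a \<le> b"
  shows "AE s in lborel. s \<in> {a..b} \<longrightarrow> g s = 0"
proof -
  define G where "G = (\<lambda>x. indicat_real {a..b} x *\<^sub>R g x)"
  have int: "integrable lborel G" using g by (simp add: G_def set_integrable_def)
  have setint: "set_integrable lborel A G" if "A \<in> sets borel" for A
    unfolding set_integrable_def using int that by (intro integrable_mult_indicator) auto
  have atMost: "(LINT x:{..s}|lborel. G x) = 0" for s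
  proof -
    consider "s < a" | "a \<le> s" "s \<le> b" | "b < s" by linarith
    then show ?thesis
    proof cases
      case 1
      then have "(LINT x:{..s}|lborel. G x) = (LINT x:{..s}|lborel. 0)"
        by (intro set_lebesgue_integral_cong) (auto simp: G_def)
      then show ?thesis by simp
    next
      case 2
      then have "(LINT x:{..s}|lborel. G x) = (LINT x:{a..s}|lborel. g x)"
        unfolding set_lebesgue_integral_def G_def
        by (intro Bochner_Integration.integral_cong) (auto simp: indicator_def)
      then show ?thesis using z 2 by simp
    next
      case 3
      then have "(LINT x:{..s}|lborel. G x) = (LINT x:{a..b}|lborel. g x)"
        unfolding set_lebesgue_integral_def G_def
        by (intro Bochner_Integration.integral_cong) (auto simp: indicator_def)
      then show ?thesis using z \<open>a \<le> b\<close> by simp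
    qed
  qed
  have total: "(LINT x|lborel. G x) = 0"
    using z[of b] \<open>a \<le> b\<close> by (simp add: G_def set_lebesgue_integral_def)
  have "(LINT x:A|lborel. G x) = 0" if A: "A \<in> sets borel" for A
  proof -
    have borel: "sets borel = sigma_sets UNIV (range (\<lambda>a::real. {..a}))"
      unfolding borel_eq_atMost by simp
    have stable: "Int_stable (range (\<lambda>a::real. {..a}))"
      by (auto simp: Int_stable_def)
    have "A \<in> sigma_sets UNIV (range (\<lambda>a::real. {..a}))" using A borel by simp
    note A' = this
    have "range (\<lambda>a::real. {..a}) \<subseteq> Pow UNIV" by simp
    from stable this A' show ?thesis
    proof (induction rule: sigma_sets_induct_disjoint)
      case (basic A)
      then show ?case using atMost by auto
    next
      case empty
      show ?case by (simp add: set_lebesgue_integral_def)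
    next
      case (compl A)
      then have A: "A \<in> sets borel" using borel by simp
      have "(LINT x:UNIV - A|lborel. G x) + (LINT x:A|lborel. G x) = (LINT x:(UNIV - A) \<union> A|lborel. G x)"
        using A by (intro set_integral_Un[symmetric] setint) auto
      also have "(UNIV - A) \<union> A = UNIV" by auto
      finally show ?case using compl total by (simp add: set_lebesgue_integral_def)
    next
      case (union A)
      have A: "A i \<in> sets borel" for i using range_subsetD[OF union.hyps(2), of i] borel by simp
      have "(LINT x:(\<Union>i. A i)|lborel. G x) = (\<Sum>i. LINT x:A i|lborel. G x)"
      proof (rule lebesgue_integral_countable_add)
        show "set_integrable lborel (\<Union>i. A i) G" using A by (intro setint) auto
        show "A i \<inter> A j = {}" if "i \<noteq> j" for i j
          using union.hyps that by (auto simp: disjoint_family_on_def)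
      qed (use A in auto)
      also have "\<dots> = 0" using union by simp
      finally show ?case .
    qed
  qed
  then have "AE x in lborel. G x = 0" using sigma_finite_measure.density_zero[OF sigma_finite_lborel int] by auto
  then show ?thesis by eventually_elim (auto simp: G_def)
qed

lemma weak_deriv_unique:
  assumes "weak_deriv a b f g" "weak_deriv a b f g'" "a \<le> b"
  shows "AE s in lborel. s \<in> {a..b} \<longrightarrow> g s = g' s"
proof -
  have g: "set_integrable lborel {a..b} g" "set_integrable lborel {a..b} g'"
    by (intro square_integrable_imp_integrable weak_deriv_square_integrable[OF assms(1)] weak_deriv_square_integrable[OF assms(2)])+
  have "AE s in lborel. s \<in> {a..b} \<longrightarrow> g s - g' s = 0"
  proof (rule AE_zero_of_LINT_zero[OF set_integral_diff(1)[OF g] _ \<open>a \<le> b\<close>])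
    fix s assume s: "a \<le> s" "s \<le> b"
    have "(LINT t:{a..s}|lborel. g t - g' t) = (LINT t:{a..s}|lborel. g t) - (LINT t:{a..s}|lborel. g' t)"
      using s by (intro set_integral_diff set_integrable_subset[OF g(1)] set_integrable_subset[OF g(2)]) auto
    moreover have "(LINT t:{a..s}|lborel. g t) = (LINT t:{a..s}|lborel. g' t)"
      using weak_derivD[OF assms(1) s] weak_derivD[OF assms(2) s] by (metis add_left_cancel)
    ultimately show "(LINT t:{a..s}|lborel. g t - g' t) = 0" by simp
  qed
  then show ?thesis by simp
qed

lemma LINT_norm_square: "(LINT s:A|lborel. f s * cnj (f s)) = complex_of_real (LINT s:A|lborel. (cmod (f s))\<^sup>2)"
  unfolding set_integral_complex_of_real[symmetric] by (simp only: complex_norm_square)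

lemma AE_zero_of_norm_square:
  assumes f: "square_integrable a b f" and z: "(LINT s:{a..b}|lborel. (cmod (f s))\<^sup>2) = 0"
  shows "AE s in lborel. s \<in> {a..b} \<longrightarrow> f s = 0"
proof -
  have "integrable lborel (\<lambda>s. indicat_real {a..b} s *\<^sub>R (cmod (f s))\<^sup>2)"
    using f by (simp add: square_integrable_def set_integrable_def)
  from integral_nonneg_eq_0_iff_AE[OF this] z
  have "AE s in lborel. indicat_real {a..b} s *\<^sub>R (cmod (f s))\<^sup>2 = 0"
    by (simp add: set_lebesgue_integral_def)
  then show ?thesis by eventually_elim auto
qed

lemma zero_of_norm_square:
  fixes a b :: real
  assumes f: "continuous_on {a..b} f" and z: "(LINT s:{a..b}|lborel. (cmod (f s))\<^sup>2) = 0"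
    and s: "a < b" "s \<in> {a..b}"
  shows "f s = 0"
proof -
  have "set_integrable lborel {a..b} (\<lambda>s. (cmod (f s))\<^sup>2)"
    using square_integrable_continuous[OF f] by (simp add: square_integrable_def)
  then have "integral {a..b} (\<lambda>s. (cmod (f s))\<^sup>2) = 0" using z set_borel_integral_eq_integral(2) by metis
  moreover have "continuous_on {a..b} (\<lambda>s. (cmod (f s))\<^sup>2)" using f by (intro continuous_intros)
  ultimately have "\<forall>s\<in>{a..b}. (cmod (f s))\<^sup>2 = 0"
    using integral_eq_0_iff[of a b "\<lambda>s. (cmod (f s))\<^sup>2"] s(1) by simp
  then have "(cmod (f s))\<^sup>2 = 0" using s(2) by blast
  then show ?thesis by simp
qed

text \<open>Since h vanishes at the left end, |h| is pointwise at most the integral of |\<gamma>|,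
  which Cauchy-Schwarz bounds; integrating the pointwise bound gives the crude constant (b - a)^2,
  which suffices for a fine mesh.\<close>

lemma poincare:
  assumes h: "weak_deriv a b h \<gamma>" "h a = 0" and "a < b"
  shows "(LINT s:{a..b}|lborel. (cmod (h s))\<^sup>2) \<le> (b - a)\<^sup>2 * (LINT s:{a..b}|lborel. (cmod (\<gamma> s))\<^sup>2)"
proof -
  let ?I = "LINT s:{a..b}|lborel. cmod (\<gamma> s)" and ?A = "LINT s:{a..b}|lborel. (cmod (\<gamma> s))\<^sup>2"
  have sq: "square_integrable a b \<gamma>" by (rule weak_deriv_square_integrable[OF h(1)])
  have \<gamma>: "set_integrable lborel {a..b} \<gamma>" by (rule square_integrable_imp_integrable[OF sq])
  have n: "set_integrable lborel {a..b} (\<lambda>s. cmod (\<gamma> s))" using \<gamma> by (rule set_integrable_norm)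
  have n2: "set_integrable lborel {a..b} (\<lambda>s. (cmod (\<gamma> s))\<^sup>2)" using sq by (simp add: square_integrable_def)
  have c: "set_integrable lborel {a..b} (\<lambda>s. t)" for t :: real
    by (intro borel_integrable_atLeastAtMost' continuous_intros)
  have Lc: "(LINT s:{a..b}|lborel. t) = t * (b - a)" for t :: real
    using \<open>a < b\<close> by (simp add: set_lebesgue_integral_def)
  have cs: "?I\<^sup>2 \<le> (b - a) * ?A"
  proof -
    \<comment> \<open>The mean of |\<gamma>|: the integral of (|\<gamma>| - t)^2 is non-negative,
      which is Cauchy-Schwarz against the constant 1.\<close>
    define t where "t = ?I / (b - a)"
    have "0 \<le> (LINT s:{a..b}|lborel. (cmod (\<gamma> s) - t)\<^sup>2)"
      unfolding set_lebesgue_integral_def by (intro Bochner_Integration.integral_nonneg) auto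
    also have "\<dots> = (LINT s:{a..b}|lborel. (cmod (\<gamma> s))\<^sup>2 + (- 2 * t) * cmod (\<gamma> s) + t\<^sup>2)"
      by (simp add: power2_diff algebra_simps)
    also have "\<dots> = ?A + (- 2 * t) * ?I + t\<^sup>2 * (b - a)"
    proof -
      have m: "set_integrable lborel {a..b} (\<lambda>s. (- 2 * t) * cmod (\<gamma> s))"
        using n by (rule set_integrable_mult_right)
      show ?thesis
        by (simp only: set_integral_add(2)[OF set_integral_add(1)[OF n2 m] c] set_integral_add(2)[OF n2 m]
            set_integral_mult_right Lc)
    qed
    also have "\<dots> = ?A - ?I\<^sup>2 / (b - a)"
    proof -
      have tI: "t * (b - a) = ?I" using \<open>a < b\<close> by (simp add: t_def)
      have "t\<^sup>2 * (b - a) = t * ?I" unfolding tI[symmetric] by (simp add: power2_eq_square)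
      moreover have "?I\<^sup>2 / (b - a) = t * ?I" by (simp add: t_def power2_eq_square)
      ultimately show ?thesis by simp
    qed
    finally show ?thesis using \<open>a < b\<close> by (simp add: field_simps)
  qed
  have bound: "(cmod (h s))\<^sup>2 \<le> (b - a) * ?A" if s: "s \<in> {a..b}" for s
  proof -
    have sub: "{a..s} \<subseteq> {a..b}" using s by auto
    have "h s = (LINT t:{a..s}|lborel. \<gamma> t)" using weak_derivD[OF h(1), of s] h(2) s by simp
    then have "cmod (h s) \<le> (LINT t:{a..s}|lborel. cmod (\<gamma> t))"
      using set_integral_norm_bound[OF set_integrable_subset[OF \<gamma> _ sub]] by simp
    also have "\<dots> \<le> ?I"
    proof -
      have "?I = (LINT t:{a..s}|lborel. cmod (\<gamma> t)) + (LINT t:{s..b}|lborel. cmod (\<gamma> t))"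
        using LINT_combine[OF n, of s b] s by simp
      moreover have "0 \<le> (LINT t:{s..b}|lborel. cmod (\<gamma> t))"
        unfolding set_lebesgue_integral_def by (intro Bochner_Integration.integral_nonneg) auto
      ultimately show ?thesis by simp
    qed
    finally have "(cmod (h s))\<^sup>2 \<le> ?I\<^sup>2" by (intro power_mono) auto
    then show ?thesis using cs by simp
  qed
  have "set_integrable lborel {a..b} (\<lambda>s. (cmod (h s))\<^sup>2)"
    using square_integrable_continuous[OF weak_deriv_continuous[OF h(1)]] by (simp add: square_integrable_def)
  then have "(LINT s:{a..b}|lborel. (cmod (h s))\<^sup>2) \<le> (LINT s:{a..b}|lborel. (b - a) * ?A)"
    using bound by (intro set_integral_mono c) auto
  also have "\<dots> = (b - a)\<^sup>2 * ?A" by (simp add: Lc power2_eq_square)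
  finally show ?thesis .
qed

section \<open>Solutions of the eigenvalue equation on an interval\<close>

definition osc_cos :: "real \<Rightarrow> real \<Rightarrow> real"
  where "osc_cos l x = cos (sqrt l * x)"

text \<open>The branch at \<open>l = 0\<close> is the limit of the other, so that \<open>sol\<close>
  is affine at zero energy and the calculus below covers all non-negative l at once.\<close>

definition osc_sin :: "real \<Rightarrow> real \<Rightarrow> real"
  where "osc_sin l x = (if l = 0 then x else sin (sqrt l * x) / sqrt l)"

definition sol :: "real \<Rightarrow> complex \<Rightarrow> complex \<Rightarrow> real \<Rightarrow> complex"
  where "sol l p k x = p * of_real (osc_cos l x) + k * of_real (osc_sin l x)"

lemma osc_0 [simp]: "osc_cos l 0 = 1" "osc_sin l 0 = 0"
  by (auto simp: osc_cos_def osc_sin_def)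

lemma sol_0 [simp]: "sol l p k 0 = p"
  by (simp add: sol_def)

lemma osc_cos_deriv: "0 \<le> l \<Longrightarrow> (osc_cos l has_real_derivative - l * osc_sin l x) (at x)"
  unfolding osc_cos_def osc_sin_def
  by (auto intro!: derivative_eq_intros simp: divide_simps)

lemma osc_sin_deriv: "0 \<le> l \<Longrightarrow> (osc_sin l has_real_derivative osc_cos l x) (at x)"
  by (cases "l = 0") (auto simp: osc_cos_def osc_sin_def[abs_def] mult.assoc intro!: derivative_eq_intros)

lemma sol_deriv:
  assumes "0 \<le> l"
  shows "(sol l p k has_vector_derivative sol l k (- of_real l * p) x) (at x)"
proof -
  have *: "(sol l p k has_vector_derivative
      p * of_real (- l * osc_sin l x) + k * of_real (osc_cos l x)) (at x)"
    unfolding sol_def[abs_def]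
    using osc_cos_deriv[OF assms, of x] osc_sin_deriv[OF assms, of x]
    by (intro has_vector_derivative_add has_vector_derivative_mult_right has_vector_derivative_of_real)
       (auto simp: has_real_derivative_iff_has_vector_derivative)
  have "p * of_real (- l * osc_sin l x) + k * of_real (osc_cos l x) = sol l k (- of_real l * p) x"
    by (simp add: sol_def)
  with * show ?thesis by (simp only:)
qed

lemma sol_shift_deriv:
  assumes "0 \<le> l"
  shows "((\<lambda>x. sol l p k (x - c)) has_vector_derivative sol l k (- of_real l * p) (x - c)) (at x)"
proof -
  have "((\<lambda>x. x - c) has_vector_derivative 1) (at x)"
    by (auto intro!: derivative_eq_intros)
  from vector_diff_chain_at[OF this sol_deriv[OF assms]] show ?thesis by (simp add: o_def)
qed

lemma sol_continuous: "0 \<le> l \<Longrightarrow> continuous_on A (\<lambda>x. sol l p k (x - c))"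
  by (intro continuous_at_imp_continuous_on ballI has_vector_derivative_continuous[OF sol_shift_deriv])

lemma sol_weak_deriv:
  "0 \<le> l \<Longrightarrow> weak_deriv a b (\<lambda>x. sol l p k (x - c)) (\<lambda>x. sol l k (- of_real l * p) (x - c))"
  by (intro weak_deriv_smooth sol_shift_deriv sol_continuous)

lemma sol_weak_deriv_0:
  "0 \<le> l \<Longrightarrow> weak_deriv a b (sol l p k) (sol l k (- of_real l * p))"
  using sol_weak_deriv[of l a b p k 0] by simp

lemma sol_neg: "sol l (- of_real l * p) (- of_real l * k) x = - of_real l * sol l p k x"
  by (simp add: sol_def algebra_simps)

text \<open>Green's formula for a solution against any weakly differentiable h. The shift
  \<open>c\<close> places the base point of the solution at the left end of a mesh cell.\<close>

lemma sol_by_parts: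
  assumes l: "0 \<le> l" and "a \<le> b" and h: "weak_deriv a b h \<gamma>"
  shows "(LINT s:{a..b}|lborel. sol l k (- of_real l * p) (s - c) * cnj (\<gamma> s)) =
    sol l k (- of_real l * p) (b - c) * cnj (h b) - sol l k (- of_real l * p) (a - c) * cnj (h a)
    + of_real l * (LINT s:{a..b}|lborel. sol l p k (s - c) * cnj (h s))"
proof -
  have w: "weak_deriv a b (\<lambda>x. sol l k (- of_real l * p) (x - c)) (\<lambda>x. - of_real l * sol l p k (x - c))"
    using sol_weak_deriv[OF l, of a b k "- of_real l * p" c] by (simp only: sol_neg)
  have "(LINT s:{a..b}|lborel. - of_real l * sol l p k (s - c) * cnj (h s)) =
      - of_real l * (LINT s:{a..b}|lborel. sol l p k (s - c) * cnj (h s))"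
    by (simp only: mult.assoc set_integral_mult_right)
  then show ?thesis using integration_by_parts_weak[OF w h \<open>a \<le> b\<close>] by simp
qed

text \<open>The mesh condition gives sqrt l * d \<le> 1 < pi, so l lies below the first Dirichlet
  eigenvalue of an interval of length d.\<close>

lemma osc_sin_pos:
  assumes "0 \<le> l" "0 < d" "d\<^sup>2 * (l + 1) \<le> 1"
  shows "0 < osc_sin l d"
proof (cases "l = 0")
  case False
  then have "0 < sqrt l * d" using assms by simp
  moreover have "(sqrt l * d)\<^sup>2 \<le> 1"
    using assms by (simp add: power_mult_distrib algebra_simps) (smt (verit) zero_le_power2)
  then have "sqrt l * d \<le> 1" by (simp add: power2_le_iff_abs_le abs_square_le_1)
  then have "sqrt l * d < pi" using pi_gt3 by linarith
  ultimately have "0 < sin (sqrt l * d)" by (intro sin_gt_zero)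
  then show ?thesis using False assms by (simp add: osc_sin_def)
qed (use assms in \<open>auto simp: osc_sin_def\<close>)

lemma LINT_singleton: "(LINT t:{a}|lborel. g t) = (0 :: 'a::{banach, second_countable_topology})"
  for a :: real
proof -
  have "AE t in lborel. indicat_real {a} t *\<^sub>R g t = 0"
    using AE_lborel_singleton[of a] by eventually_elim auto
  then show ?thesis unfolding set_lebesgue_integral_def by (rule integral_eq_zero_AE)
qed

section \<open>Decomposition along a mesh\<close>

text \<open>On each cell take the solution with the prescribed end values. Against a function
  vanishing at all nodes, integration by parts leaves no boundary terms, which gives the
  orthogonality. The induction glues one cell at a time.\<close>

lemma mesh_interpolation:
  assumes l: "0 \<le> l" and \<delta>: "0 < \<delta>" "\<delta>\<^sup>2 * (l + 1) \<le> 1"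
  shows "\<exists>u g. weak_deriv 0 (real r * \<delta>) u g \<and> (\<forall>k\<le>r. u (real k * \<delta>) = v (real k * \<delta>)) \<and>
    (\<forall>h \<gamma>. weak_deriv 0 (real r * \<delta>) h \<gamma> \<longrightarrow> (\<forall>k\<le>r. h (real k * \<delta>) = 0) \<longrightarrow>
      (LINT s:{0..real r * \<delta>}|lborel. g s * cnj (\<gamma> s)) = of_real l * (LINT s:{0..real r * \<delta>}|lborel. u s * cnj (h s)))"
proof (induction r)
  case 0
  have w: "weak_deriv 0 0 (\<lambda>_. v 0) (\<lambda>_. 0)" by (intro weak_deriv_smooth) auto
  show ?case
    by (rule exI[of _ "\<lambda>_. v 0"], rule exI[of _ "\<lambda>_. 0"]) (simp add: LINT_singleton w)
next
  case (Suc r)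
  define a where "a = real r * \<delta>"
  define b where "b = real (Suc r) * \<delta>"
  have ab: "0 \<le> a" "a \<le> b" "b - a = \<delta>" using \<delta> by (auto simp: a_def b_def algebra_simps)
  obtain u g where u: "weak_deriv 0 a u g" "\<And>k. k \<le> r \<Longrightarrow> u (real k * \<delta>) = v (real k * \<delta>)"
    "\<And>h \<gamma>. weak_deriv 0 a h \<gamma> \<Longrightarrow> \<forall>k\<le>r. h (real k * \<delta>) = 0 \<Longrightarrow>
      (LINT s:{0..a}|lborel. g s * cnj (\<gamma> s)) = of_real l * (LINT s:{0..a}|lborel. u s * cnj (h s))"
    using Suc.IH unfolding a_def by blast
  have sin: "osc_sin l \<delta> \<noteq> 0" using osc_sin_pos[OF l \<delta>] by simp
  \<comment> \<open>The slope at \<open>a\<close> for which the solution starting with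
    \<open>v a\<close> reaches \<open>v b\<close>; dividing is legitimate by
    \<open>osc_sin_pos\<close>.\<close>
  define k where "k = (v b - v a * of_real (osc_cos l \<delta>)) / of_real (osc_sin l \<delta>)"
  define U where "U = (\<lambda>x. sol l (v a) k (x - a))"
  define G where "G = (\<lambda>x. sol l k (- of_real l * v a) (x - a))"
  have U: "U a = v a" "U b = v b" using sin by (auto simp: U_def ab sol_def k_def)
  have UG: "weak_deriv a b U G" unfolding U_def G_def by (rule sol_weak_deriv[OF l])
  define u' where "u' = (\<lambda>x. if x \<le> a then u x else U x)"
  define g' where "g' = (\<lambda>x. if x \<le> a then g x else G x)"
  have m: "g' \<in> borel_measurable lborel"
    unfolding g'_def using weak_deriv_measurable[OF u(1)] weak_deriv_measurable[OF UG]
    by (intro measurable_If) auto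
  have "weak_deriv 0 a u g'"
    by (rule weak_deriv_AE_cong[OF u(1) m]) (auto simp: g'_def)
  then have 1: "weak_deriv 0 a u' g'" by (rule weak_deriv_cong) (simp add: u'_def)
  have G': "AE s in lborel. s \<in> {a..b} \<longrightarrow> g' s = G s"
    using AE_lborel_singleton[of a] by eventually_elim (auto simp: g'_def)
  then have "weak_deriv a b U g'" by (rule weak_deriv_AE_cong[OF UG m])
  moreover have ua: "u a = v a" using u(2)[of r] by (simp add: a_def)
  ultimately have 2: "weak_deriv a b u' g'"
    by (elim weak_deriv_cong) (use U in \<open>auto simp: u'_def\<close>)
  note 12 = weak_deriv_glue[OF 1 2 ab(1,2)]
  have nodes: "u' (real j * \<delta>) = v (real j * \<delta>)" if "j \<le> Suc r" for j
  proof (cases "j = Suc r")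
    case True
    then show ?thesis using U(2) \<delta> by (simp add: u'_def b_def a_def algebra_simps)
  next
    case False
    then have "real j * \<delta> \<le> a" using that \<delta> by (simp add: a_def)
    then show ?thesis using u(2)[of j] False that by (simp add: u'_def)
  qed
  have "(LINT s:{0..b}|lborel. g' s * cnj (\<gamma> s)) = of_real l * (LINT s:{0..b}|lborel. u' s * cnj (h s))"
    if h: "weak_deriv 0 b h \<gamma>" and z: "\<forall>j\<le>Suc r. h (real j * \<delta>) = 0" for h \<gamma>
  proof -
    have h1: "weak_deriv 0 a h \<gamma>" and h2: "weak_deriv a b h \<gamma>"
      by (rule weak_deriv_restrict[OF h]; use ab in simp)+
    have hab: "h a = 0" "h b = 0" using z[rule_format, of r] z[rule_format, of "Suc r"] by (auto simp: a_def b_def)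
    have i1: "set_integrable lborel {0..b} (\<lambda>s. g' s * cnj (\<gamma> s))"
      by (intro set_integrable_mult weak_deriv_square_integrable[OF 12] weak_deriv_square_integrable[OF h])
    have i2: "set_integrable lborel {0..b} (\<lambda>s. u' s * cnj (h s))"
      by (intro set_integrable_mult square_integrable_continuous weak_deriv_continuous[OF 12] weak_deriv_continuous[OF h])
    have g1: "(LINT s:{0..a}|lborel. g' s * cnj (\<gamma> s)) = (LINT s:{0..a}|lborel. g s * cnj (\<gamma> s))"
      by (rule set_lebesgue_integral_cong) (auto simp: g'_def)
    have u1: "(LINT s:{0..a}|lborel. u' s * cnj (h s)) = (LINT s:{0..a}|lborel. u s * cnj (h s))"
      by (rule set_lebesgue_integral_cong) (auto simp: u'_def)
    have u2: "(LINT s:{a..b}|lborel. u' s * cnj (h s)) = (LINT s:{a..b}|lborel. U s * cnj (h s))"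
      by (rule set_lebesgue_integral_cong) (use ua U in \<open>auto simp: u'_def\<close>)
    have g2: "(LINT s:{a..b}|lborel. g' s * cnj (\<gamma> s)) = (LINT s:{a..b}|lborel. G s * cnj (\<gamma> s))"
      unfolding set_lebesgue_integral_def
    proof (rule integral_cong_AE)
      have \<gamma>m: "(\<lambda>s. cnj (\<gamma> s)) \<in> borel_measurable lborel"
        by (rule weak_deriv_measurable[OF weak_deriv_cnj[OF h]])
      show "(\<lambda>x. indicat_real {a..b} x *\<^sub>R (g' x * cnj (\<gamma> x))) \<in> borel_measurable lborel"
        by (intro borel_measurable_scaleR borel_measurable_times m \<gamma>m) auto
      show "(\<lambda>x. indicat_real {a..b} x *\<^sub>R (G x * cnj (\<gamma> x))) \<in> borel_measurable lborel"
        by (intro borel_measurable_scaleR borel_measurable_times weak_deriv_measurable[OF UG] \<gamma>m) auto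
      show "AE x in lborel. indicat_real {a..b} x *\<^sub>R (g' x * cnj (\<gamma> x)) = indicat_real {a..b} x *\<^sub>R (G x * cnj (\<gamma> x))"
        using G' by eventually_elim (auto simp: indicator_def)
    qed
    have "(LINT s:{a..b}|lborel. G s * cnj (\<gamma> s)) = of_real l * (LINT s:{a..b}|lborel. U s * cnj (h s))"
      unfolding U_def G_def using sol_by_parts[OF l ab(2) h2, of k "v a" a] hab by simp
    moreover have "(LINT s:{0..a}|lborel. g s * cnj (\<gamma> s)) = of_real l * (LINT s:{0..a}|lborel. u s * cnj (h s))"
      using u(3)[OF h1] z by simp
    ultimately show ?thesis
      unfolding LINT_combine[OF i1 ab(1,2) order_refl] LINT_combine[OF i2 ab(1,2) order_refl]
        g1 u1 g2 u2 by (simp only: distrib_left)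
  qed
  with 12 nodes show ?case unfolding b_def by blast
qed

lemma mesh_poincare:
  assumes h: "weak_deriv 0 (real r * \<delta>) h \<gamma>" "\<And>k. k < r \<Longrightarrow> h (real k * \<delta>) = 0" and \<delta>: "0 < \<delta>"
  shows "(LINT s:{0..real r * \<delta>}|lborel. (cmod (h s))\<^sup>2) \<le> \<delta>\<^sup>2 * (LINT s:{0..real r * \<delta>}|lborel. (cmod (\<gamma> s))\<^sup>2)"
  using h
proof (induction r)
  case 0
  then show ?case by (simp add: LINT_singleton)
next
  case (Suc r)
  define a where "a = real r * \<delta>"
  define b where "b = real (Suc r) * \<delta>"
  have ab: "0 \<le> a" "a < b" "b - a = \<delta>" using \<delta> by (auto simp: a_def b_def algebra_simps)
  have h: "weak_deriv 0 b h \<gamma>" using Suc.prems by (simp add: b_def)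
  have h1: "weak_deriv 0 a h \<gamma>" and h2: "weak_deriv a b h \<gamma>"
    by (rule weak_deriv_restrict[OF h]; use ab in simp)+
  have i1: "set_integrable lborel {0..b} (\<lambda>s. (cmod (h s))\<^sup>2)"
    using square_integrable_continuous[OF weak_deriv_continuous[OF h]] by (simp add: square_integrable_def)
  have i2: "set_integrable lborel {0..b} (\<lambda>s. (cmod (\<gamma> s))\<^sup>2)"
    using weak_deriv_square_integrable[OF h] by (simp add: square_integrable_def)
  have "(LINT s:{0..a}|lborel. (cmod (h s))\<^sup>2) \<le> \<delta>\<^sup>2 * (LINT s:{0..a}|lborel. (cmod (\<gamma> s))\<^sup>2)"
    unfolding a_def by (rule Suc.IH) (use h1 Suc.prems in \<open>auto simp: a_def\<close>)
  moreover have "(LINT s:{a..b}|lborel. (cmod (h s))\<^sup>2) \<le> \<delta>\<^sup>2 * (LINT s:{a..b}|lborel. (cmod (\<gamma> s))\<^sup>2)"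
    using poincare[OF h2 _ ab(2)] Suc.prems(2)[of r] by (simp add: a_def[symmetric] ab(3))
  ultimately show ?case
    unfolding b_def[symmetric] LINT_combine[OF i1 ab(1) less_imp_le[OF ab(2)] order_refl]
      LINT_combine[OF i2 ab(1) less_imp_le[OF ab(2)] order_refl]
    by (simp add: distrib_left)
qed

text \<open>Energy method: for the difference z with derivative Z the quantity |Z|^2 + l |z|^2 keeps
  its initial value 0. This yields Z = 0 even for l = 0, and then z = 0. The function
  \<open>y'\<close> is a representative of \<open>y\<close> that may differ from it off the
  interval.\<close>

lemma ode_unique:
  assumes l: "0 \<le> l" and L: "0 \<le> L"
    and y: "weak_deriv 0 L y Y" and Y: "weak_deriv 0 L Y (\<lambda>s. - of_real l * y' s)"
    and y': "\<And>s. s \<in> {0..L} \<Longrightarrow> y' s = y s" and s: "s \<in> {0..L}"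
  shows "y s = sol l (y 0) (Y 0) s"
proof -
  define z where "z = (\<lambda>s. y s + (- 1) * sol l (y 0) (Y 0) s)"
  define Z where "Z = (\<lambda>s. Y s + (- 1) * sol l (Y 0) (- of_real l * y 0) s)"
  define z' where "z' = (\<lambda>s. - of_real l * y' s + (- 1) * (- of_real l * sol l (y 0) (Y 0) s))"
  have z: "weak_deriv 0 L z Z"
    unfolding z_def Z_def by (intro weak_deriv_add weak_deriv_scale y sol_weak_deriv_0 l)
  have Z: "weak_deriv 0 L Z z'"
    using weak_deriv_add[OF Y weak_deriv_scale[OF sol_weak_deriv_0[OF l, of 0 L "Y 0" "- of_real l * y 0"], of "- 1"]]
    unfolding Z_def z'_def by (simp only: sol_neg)
  have z'z: "z' t = - of_real l * z t" if "t \<in> {0..L}" for t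
    using y'[OF that] by (simp add: z'_def z_def algebra_simps)
  have z0: "z 0 = 0" "Z 0 = 0" by (simp_all add: z_def Z_def)
  have Z_zero: "Z t = 0" if t: "t \<in> {0..L}" for t
  proof -
    have zt: "weak_deriv 0 t z Z" and Zt: "weak_deriv 0 t Z z'"
      using weak_deriv_restrict[OF z order_refl, of t] weak_deriv_restrict[OF Z order_refl, of t] t by auto
    have "0 \<le> t" using t by simp
    have zz: "square_integrable 0 t z" "square_integrable 0 t Z"
      by (rule square_integrable_continuous[OF weak_deriv_continuous[OF zt]],
          rule square_integrable_continuous[OF weak_deriv_continuous[OF Zt]])
    let ?A = "LINT s:{0..t}|lborel. Z s * cnj (z s)"
    let ?B = "LINT s:{0..t}|lborel. cnj (Z s) * z s"
    have 1: "?A + ?B = z t * cnj (z t)"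
      using weak_deriv_product[OF zt weak_deriv_cnj[OF zt] \<open>0 \<le> t\<close>] z0 by simp
    have "(LINT s:{0..t}|lborel. z' s * cnj (Z s)) = (LINT s:{0..t}|lborel. - of_real l * (cnj (Z s) * z s))"
      by (rule set_lebesgue_integral_cong) (use z'z t in auto)
    moreover have "(LINT s:{0..t}|lborel. cnj (z' s) * Z s) = (LINT s:{0..t}|lborel. - of_real l * (Z s * cnj (z s)))"
      by (rule set_lebesgue_integral_cong) (use z'z t in auto)
    ultimately have E: "Z t * cnj (Z t) = - of_real l * ?B + - of_real l * ?A"
      using weak_deriv_product[OF Zt weak_deriv_cnj[OF Zt] \<open>0 \<le> t\<close>] z0
      by (simp only: set_integral_mult_right) simp
    have "Z t * cnj (Z t) + of_real l * (z t * cnj (z t)) = 0"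
      unfolding E 1[symmetric] by (simp add: algebra_simps)
    then have "of_real ((cmod (Z t))\<^sup>2 + l * (cmod (z t))\<^sup>2) = (0 :: complex)"
      by (simp only: of_real_add of_real_mult complex_norm_square)
    then have "(cmod (Z t))\<^sup>2 + l * (cmod (z t))\<^sup>2 = 0" by (simp only: of_real_eq_0_iff)
    then have "(cmod (Z t))\<^sup>2 = 0" using l by (smt (verit) mult_nonneg_nonneg zero_le_power2)
    then show ?thesis by simp
  qed
  have "z s = z 0 + (LINT t:{0..s}|lborel. Z t)" by (rule weak_derivD[OF z]) (use s in auto)
  also have "(LINT t:{0..s}|lborel. Z t) = (LINT t:{0..s}|lborel. 0)"
    by (rule set_lebesgue_integral_cong) (use Z_zero s in auto)
  finally show ?thesis using z0 by (simp add: z_def)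
qed

text \<open>The du Bois-Reymond argument: testing with the primitive of \<open>u' + l W\<close> minus its mean, where
  \<open>W' = u\<close>, shows that this function is constant, so that \<open>u\<close> is a classical solution.\<close>

lemma weak_eigenfunction:
  assumes L: "0 < L" and l: "0 \<le> l" and u: "weak_deriv 0 L u g"
    and eq: "\<And>h \<gamma>. \<lbrakk>weak_deriv 0 L h \<gamma>; h 0 = 0; h L = 0\<rbrakk> \<Longrightarrow>
      (LINT s:{0..L}|lborel. g s * cnj (\<gamma> s)) = of_real l * (LINT s:{0..L}|lborel. u s * cnj (h s))"
  shows "\<exists>k. \<forall>s\<in>{0..L}. u s = sol l (u 0) k s"
proof -
  have u_sq: "square_integrable 0 L u"
    by (rule square_integrable_continuous[OF weak_deriv_continuous[OF u]])
  note g_sq = weak_deriv_square_integrable[OF u]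
  define W where "W = (\<lambda>s. LINT t:{0..s}|lborel. u t)"
  define u' where "u' = (\<lambda>s. indicat_real {0..L} s *\<^sub>R u s)"
  have W: "weak_deriv 0 L W u'" unfolding W_def u'_def by (rule weak_deriv_indefinite[OF u_sq])
  have W_sq: "square_integrable 0 L W"
    by (rule square_integrable_continuous[OF weak_deriv_continuous[OF W]])
  \<comment> \<open>The mean, which makes the primitive \<open>h\<close> of \<open>r\<close> vanish
    at \<open>L\<close> as well, so that it is an admissible test function.\<close>
  define c where "c = (LINT s:{0..L}|lborel. g s + of_real l * W s) / of_real L"
  define r where "r = (\<lambda>s. (g s + of_real l * W s) + (- c))"
  have r_sq: "square_integrable 0 L r"
    unfolding r_def by (intro square_integrable_add g_sq square_integrable_scale W_sq square_integrable_const)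
  have gW: "set_integrable lborel {0..L} (\<lambda>s. g s + of_real l * W s)"
    by (intro square_integrable_imp_integrable square_integrable_add g_sq square_integrable_scale W_sq)
  have cc: "set_integrable lborel {0..L} (\<lambda>s. a)" for a :: complex
    by (intro square_integrable_imp_integrable square_integrable_const)
  define h where "h = (\<lambda>s. LINT t:{0..s}|lborel. r t)"
  define \<gamma> where "\<gamma> = (\<lambda>s. indicat_real {0..L} s *\<^sub>R r s)"
  have h: "weak_deriv 0 L h \<gamma>" unfolding h_def \<gamma>_def by (rule weak_deriv_indefinite[OF r_sq])
  have h0: "h 0 = 0" by (simp add: h_def LINT_singleton)
  have hL: "h L = 0"
  proof -
    have "h L = (LINT s:{0..L}|lborel. g s + of_real l * W s) + (LINT s:{0..L}|lborel. - c)"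
      unfolding h_def r_def by (rule set_integral_add(2)[OF gW cc])
    also have "(LINT s:{0..L}|lborel. - c) = - c * of_real L"
      using L by (simp add: set_lebesgue_integral_def scaleR_conv_of_real)
    finally show ?thesis using L by (simp add: c_def)
  qed
  have W0: "W 0 = 0" by (simp add: W_def LINT_singleton)
  note \<gamma>_sq = weak_deriv_square_integrable[OF h]
  have i1: "set_integrable lborel {0..L} (\<lambda>s. g s * cnj (\<gamma> s))" by (intro set_integrable_mult g_sq \<gamma>_sq)
  have i2: "set_integrable lborel {0..L} (\<lambda>s. of_real l * (W s * cnj (\<gamma> s)))"
    by (intro set_integrable_mult_right set_integrable_mult W_sq \<gamma>_sq)
  have i3: "set_integrable lborel {0..L} (\<lambda>s. (- c) * cnj (\<gamma> s))"
    by (intro set_integrable_mult square_integrable_const \<gamma>_sq)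
  \<comment> \<open>The g-term equals l times the integral of u against h by hypothesis, the W-term
    cancels it after integration by parts, and the constant c meets a function of mean zero.\<close>
  have "(LINT s:{0..L}|lborel. \<gamma> s * cnj (\<gamma> s)) =
      (LINT s:{0..L}|lborel. (g s * cnj (\<gamma> s) + of_real l * (W s * cnj (\<gamma> s))) + (- c) * cnj (\<gamma> s))"
    by (rule set_lebesgue_integral_cong) (auto simp: \<gamma>_def r_def algebra_simps)
  also have "\<dots> = (LINT s:{0..L}|lborel. g s * cnj (\<gamma> s)) + of_real l * (LINT s:{0..L}|lborel. W s * cnj (\<gamma> s))
      + (- c) * (LINT s:{0..L}|lborel. cnj (\<gamma> s))"
    by (simp only: set_integral_add(2)[OF set_integral_add(1)[OF i1 i2] i3] set_integral_add(2)[OF i1 i2] set_integral_mult_right)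
  also have "(LINT s:{0..L}|lborel. W s * cnj (\<gamma> s)) = - (LINT s:{0..L}|lborel. u s * cnj (h s))"
  proof -
    have "(LINT s:{0..L}|lborel. u' s * cnj (h s)) = (LINT s:{0..L}|lborel. u s * cnj (h s))"
      by (rule set_lebesgue_integral_cong) (auto simp: u'_def)
    then show ?thesis
      using integration_by_parts_weak[OF W h less_imp_le[OF L]] hL W0 by simp
  qed
  also have "(LINT s:{0..L}|lborel. cnj (\<gamma> s)) = 0"
    using weak_derivD[OF weak_deriv_cnj[OF h], of L] hL h0 L by simp
  also have "(LINT s:{0..L}|lborel. g s * cnj (\<gamma> s)) = of_real l * (LINT s:{0..L}|lborel. u s * cnj (h s))"
    by (rule eq[OF h h0 hL])
  finally have "(LINT s:{0..L}|lborel. \<gamma> s * cnj (\<gamma> s)) = 0" by simp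
  then have "(LINT s:{0..L}|lborel. (cmod (\<gamma> s))\<^sup>2) = 0" by (simp add: LINT_norm_square)
  from AE_zero_of_norm_square[OF \<gamma>_sq this]
  have ae: "AE s in lborel. s \<in> {0..L} \<longrightarrow> \<gamma> s = 0" .
  \<comment> \<open>The representative of the derivative of u that is itself weakly
    differentiable.\<close>
  define Y where "Y = (\<lambda>s. - of_real l * W s + c)"
  define Y' where "Y' = (\<lambda>s. indicat_real {0..L} s *\<^sub>R Y s)"
  have Y: "weak_deriv 0 L Y (\<lambda>s. - of_real l * u' s)"
  proof -
    have "weak_deriv 0 L (\<lambda>_. c) (\<lambda>_. 0)" by (intro weak_deriv_smooth) auto
    from weak_deriv_add[OF weak_deriv_scale[OF W] this] show ?thesis by (simp only: Y_def add_0_right)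
  qed
  have Y'm: "Y' \<in> borel_measurable lborel"
    using square_integrable_continuous[OF weak_deriv_continuous[OF Y]]
    by (simp add: Y'_def square_integrable_def set_borel_measurable_def)
  have "weak_deriv 0 L u Y'"
    by (rule weak_deriv_AE_cong[OF u Y'm])
      (use ae in \<open>eventually_elim; auto simp: Y'_def Y_def \<gamma>_def r_def algebra_simps add_eq_0_iff\<close>)
  have uY: "u s = sol l (u 0) (Y 0) s" if s: "s \<in> {0..L}" for s
  proof -
    have Yw: "weak_deriv 0 L Y' (\<lambda>s. - of_real l * u' s)"
      by (rule weak_deriv_cong[OF Y]) (simp add: Y'_def)
    have "u s = sol l (u 0) (Y' 0) s"
      by (rule ode_unique[OF l less_imp_le[OF L] \<open>weak_deriv 0 L u Y'\<close> Yw _ s]) (simp add: u'_def)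
    then show ?thesis using L by (simp add: Y'_def)
  qed
  then show ?thesis by blast
qed

section \<open>The quadratic forms of the quantum graph\<close>

definition edge_deriv :: "real \<Rightarrow> (real \<Rightarrow> complex) \<Rightarrow> real \<Rightarrow> complex"
  where "edge_deriv L f = (SOME g. weak_deriv_on L f g)"

definition edge_L2 :: "real \<Rightarrow> (real \<Rightarrow> complex) \<Rightarrow> (real \<Rightarrow> complex) \<Rightarrow> complex"
  where "edge_L2 L f g = (LINT s:{0..L}|lborel. f s * cnj (g s))"

definition edge_dir :: "real \<Rightarrow> (real \<Rightarrow> complex) \<Rightarrow> (real \<Rightarrow> complex) \<Rightarrow> complex"
  where "edge_dir L f g = edge_L2 L (edge_deriv L f) (edge_deriv L g)"

lemma edge_deriv: "H1_on L f \<Longrightarrow> weak_deriv 0 L f (edge_deriv L f)"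
  using someI_ex[of "weak_deriv_on L f"] by (simp add: H1_on_def edge_deriv_def weak_deriv_on_iff)

lemma H1_onI: "weak_deriv 0 L f g \<Longrightarrow> H1_on L f"
  unfolding H1_on_def weak_deriv_on_iff by (rule exI)

lemma H1_square_integrable: "H1_on L f \<Longrightarrow> square_integrable 0 L f"
  by (intro square_integrable_continuous weak_deriv_continuous[OF edge_deriv])

lemma edge_L2_add:
  assumes "square_integrable 0 L f" "square_integrable 0 L f'" "square_integrable 0 L h"
  shows "edge_L2 L (\<lambda>s. f s + f' s) h = edge_L2 L f h + edge_L2 L f' h"
  unfolding edge_L2_def distrib_right by (intro set_integral_add(2) set_integrable_mult assms)

lemma edge_L2_scale: "edge_L2 L (\<lambda>s. c * f s) h = c * edge_L2 L f h"
  unfolding edge_L2_def mult.assoc by (rule set_integral_mult_right)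

lemma edge_L2_cnj: "edge_L2 L h f = cnj (edge_L2 L f h)"
proof -
  have "cnj (edge_L2 L f h) = (LINT s|lborel. cnj (indicat_real {0..L} s *\<^sub>R (f s * cnj (h s))))"
    unfolding edge_L2_def set_lebesgue_integral_def by (rule Bochner_Integration.integral_cnj[symmetric])
  then show ?thesis unfolding edge_L2_def set_lebesgue_integral_def by (simp add: mult.commute)
qed

lemma edge_L2_self: "edge_L2 L f f = of_real (LINT s:{0..L}|lborel. (cmod (f s))\<^sup>2)"
  unfolding edge_L2_def by (rule LINT_norm_square)

text \<open>Weak derivatives agree almost everywhere, so the choice hidden in \<open>SOME\<close>
  does not affect the Dirichlet form, which may be computed with any derivative at hand.\<close>

lemma edge_dir_eq:
  assumes "weak_deriv 0 L f g" "weak_deriv 0 L f' g'" "0 \<le> L"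
  shows "edge_dir L f f' = edge_L2 L g g'"
proof -
  have e: "weak_deriv 0 L f (edge_deriv L f)" "weak_deriv 0 L f' (edge_deriv L f')"
    by (rule edge_deriv[OF H1_onI[OF assms(1)]], rule edge_deriv[OF H1_onI[OF assms(2)]])
  note m = weak_deriv_measurable[OF e(1)] weak_deriv_measurable[OF weak_deriv_cnj[OF e(2)]]
    weak_deriv_measurable[OF assms(1)] weak_deriv_measurable[OF weak_deriv_cnj[OF assms(2)]]
  show ?thesis
    unfolding edge_dir_def edge_L2_def set_lebesgue_integral_def
  proof (rule integral_cong_AE)
    show "(\<lambda>x. indicat_real {0..L} x *\<^sub>R (edge_deriv L f x * cnj (edge_deriv L f' x))) \<in> borel_measurable lborel"
      by (intro borel_measurable_scaleR borel_measurable_times m) auto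
    show "(\<lambda>x. indicat_real {0..L} x *\<^sub>R (g x * cnj (g' x))) \<in> borel_measurable lborel"
      by (intro borel_measurable_scaleR borel_measurable_times m) auto
    show "AE x in lborel. indicat_real {0..L} x *\<^sub>R (edge_deriv L f x * cnj (edge_deriv L f' x)) =
        indicat_real {0..L} x *\<^sub>R (g x * cnj (g' x))"
      using weak_deriv_unique[OF e(1) assms(1,3)] weak_deriv_unique[OF e(2) assms(2,3)]
      by eventually_elim (auto simp: indicator_def)
  qed
qed

lemma edge_dir_add:
  assumes "H1_on L f" "H1_on L f'" "H1_on L h" "0 \<le> L"
  shows "edge_dir L (\<lambda>s. f s + f' s) h = edge_dir L f h + edge_dir L f' h"
proof -
  note e = edge_deriv[OF assms(1)] edge_deriv[OF assms(2)] edge_deriv[OF assms(3)]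
  from edge_dir_eq[OF weak_deriv_add[OF e(1,2)] e(3) assms(4)] show ?thesis
    unfolding edge_dir_def[of L f] edge_dir_def[of L f']
    by (elim trans) (intro edge_L2_add weak_deriv_square_integrable[OF e(1)] weak_deriv_square_integrable[OF e(2)]
        weak_deriv_square_integrable[OF e(3)])
qed

lemma edge_dir_scale:
  assumes "H1_on L f" "H1_on L h" "0 \<le> L"
  shows "edge_dir L (\<lambda>s. c * f s) h = c * edge_dir L f h"
proof -
  note e = edge_deriv[OF assms(1)] edge_deriv[OF assms(2)]
  from edge_dir_eq[OF weak_deriv_scale[OF e(1), of c] e(2) assms(3)] show ?thesis
    unfolding edge_dir_def[of L f] by (elim trans) (rule edge_L2_scale)
qed

lemma edge_dir_cnj: "edge_dir L h f = cnj (edge_dir L f h)"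
  unfolding edge_dir_def by (rule edge_L2_cnj)

lemma dirichlet_on_eq: "complex_of_real (dirichlet_on L f) = edge_dir L f f"
  unfolding edge_dir_def edge_L2_self dirichlet_on_def edge_deriv_def ..

lemma Re_edge_L2_nonneg: "0 \<le> Re (edge_L2 L f f)"
  unfolding edge_L2_self set_lebesgue_integral_def
  by (simp add: Bochner_Integration.integral_nonneg)

definition fun_scale :: "complex \<Rightarrow> (nat \<Rightarrow> real \<Rightarrow> complex) \<Rightarrow> nat \<Rightarrow> real \<Rightarrow> complex"
  where "fun_scale c f = (\<lambda>j s. c * f j s)"

lemma vector_space_fun_scale: "vector_space fun_scale"
  by unfold_locales (auto simp: fun_scale_def plus_fun_def algebra_simps)

lemma nxt_mem: "1 \<le> n \<Longrightarrow> j \<in> {1..n} \<Longrightarrow> nxt n j \<in> {1..n}"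
  by (auto simp: nxt_def)

lemma prv_mem: "1 \<le> n \<Longrightarrow> j \<in> {1..n} \<Longrightarrow> prv n j \<in> {1..n}"
  by (auto simp: prv_def)

lemma prv_nxt: "j \<in> {1..n} \<Longrightarrow> prv n (nxt n j) = j"
  by (auto simp: prv_def nxt_def)

lemma nxt_prv: "j \<in> {1..n} \<Longrightarrow> nxt n (prv n j) = j"
  by (auto simp: prv_def nxt_def)

lemma bij_nxt: "1 \<le> n \<Longrightarrow> bij_betw (nxt n) {1..n} {1..n}"
  by (intro bij_betw_byWitness[where f' = "prv n"])
     (auto simp: prv_def nxt_def)

section \<open>The form domain of the graph and the two forms on it\<close>

locale quantum_graph =
  fixes n :: nat and alpha ell :: "nat \<Rightarrow> real"
  assumes n: "1 \<le> n" and ell: "\<And>j. j \<in> {1..n} \<Longrightarrow> 0 < ell j"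
begin

definition V :: "(nat \<Rightarrow> real \<Rightarrow> complex) set"
  where "V = {f. form_domain n alpha ell f}"

definition M :: "(nat \<Rightarrow> real \<Rightarrow> complex) \<Rightarrow> (nat \<Rightarrow> real \<Rightarrow> complex) \<Rightarrow> complex"
  where "M f g = (\<Sum>j\<in>{1..n}. edge_L2 (ell j) (f j) (g j))"

definition D :: "(nat \<Rightarrow> real \<Rightarrow> complex) \<Rightarrow> (nat \<Rightarrow> real \<Rightarrow> complex) \<Rightarrow> complex"
  where "D f g = (\<Sum>j\<in>{1..n}. edge_dir (ell j) (f j) (g j))"

definition sn :: "nat \<Rightarrow> real" where "sn j = sin (pi\<^sup>2 / (4 * alpha j))"
definition cs :: "nat \<Rightarrow> real" where "cs j = cos (pi\<^sup>2 / (4 * alpha j))"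

lemma sn_cs: "(sn j)\<^sup>2 + (cs j)\<^sup>2 = 1"
  by (simp add: sn_def cs_def)

lemma V_iff: "f \<in> V \<longleftrightarrow> (\<forall>j\<in>{1..n}. H1_on (ell j) (f j)) \<and>
    (\<forall>j\<in>{1..n}. of_real (sn j) * f (nxt n j) 0 = of_real (cs j) * f j (ell j))"
  by (simp add: V_def form_domain_def sn_def cs_def)

lemma V_H1: "f \<in> V \<Longrightarrow> j \<in> {1..n} \<Longrightarrow> H1_on (ell j) (f j)"
  by (simp add: V_iff)

lemma V_vertex: "f \<in> V \<Longrightarrow> j \<in> {1..n} \<Longrightarrow> of_real (sn j) * f (nxt n j) 0 = of_real (cs j) * f j (ell j)"
  by (simp add: V_iff)

lemma ell_nonneg: "j \<in> {1..n} \<Longrightarrow> 0 \<le> ell j"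
  using ell[of j] by simp

lemma subspace_V: "module.subspace fun_scale V"
proof -
  interpret vector_space fun_scale by (rule vector_space_fun_scale)
  have "(\<lambda>_ _. 0) \<in> V"
    unfolding V_iff by (auto intro!: H1_onI[of _ _ "\<lambda>_. 0"] weak_deriv_smooth)
  moreover have "f + g \<in> V" if f: "f \<in> V" and g: "g \<in> V" for f g
    unfolding V_iff
  proof (intro conjI ballI)
    fix j assume j: "j \<in> {1..n}"
    show "H1_on (ell j) ((f + g) j)"
      using H1_onI[OF weak_deriv_add[OF edge_deriv[OF V_H1[OF f j]] edge_deriv[OF V_H1[OF g j]]]]
      by (simp add: plus_fun_def)
    show "of_real (sn j) * (f + g) (nxt n j) 0 = of_real (cs j) * (f + g) j (ell j)"
      using V_vertex[OF f j] V_vertex[OF g j] by (simp add: plus_fun_def distrib_left)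
  qed
  moreover have "fun_scale c f \<in> V" if f: "f \<in> V" for f c
    unfolding V_iff
  proof (intro conjI ballI)
    fix j assume j: "j \<in> {1..n}"
    show "H1_on (ell j) (fun_scale c f j)"
      using H1_onI[OF weak_deriv_scale[OF edge_deriv[OF V_H1[OF f j]], of c]] by (simp add: fun_scale_def)
    show "of_real (sn j) * fun_scale c f (nxt n j) 0 = of_real (cs j) * fun_scale c f j (ell j)"
      using V_vertex[OF f j] by (simp add: fun_scale_def mult.left_commute)
  qed
  ultimately show ?thesis unfolding subspace_def by (simp add: zero_fun_def)
qed

sublocale form_pair fun_scale V M D
proof (intro form_pair.intro form_pair_axioms.intro)
  show "vector_space fun_scale" by (rule vector_space_fun_scale)
  show "hermitian_form fun_scale V M"
  proof (intro hermitian_form.intro hermitian_form_axioms.intro vector_space_fun_scale subspace_V)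
    show "M (x + y) z = M x z + M y z" if "x \<in> V" "y \<in> V" "z \<in> V" for x y z
      unfolding M_def plus_fun_def sum.distrib[symmetric]
      by (intro sum.cong refl edge_L2_add H1_square_integrable V_H1 that)
    show "M (fun_scale c x) z = c * M x z" for c x z
      unfolding M_def fun_scale_def by (simp add: edge_L2_scale sum_distrib_left)
    show "M y x = cnj (M x y)" for x y
      unfolding M_def cnj_sum by (intro sum.cong refl edge_L2_cnj)
  qed
  show "hermitian_form fun_scale V D"
  proof (intro hermitian_form.intro hermitian_form_axioms.intro vector_space_fun_scale subspace_V)
    show "D (x + y) z = D x z + D y z" if "x \<in> V" "y \<in> V" "z \<in> V" for x y z
      unfolding D_def plus_fun_def sum.distrib[symmetric]
      by (intro sum.cong refl edge_dir_add V_H1 that ell_nonneg)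
    show "D (fun_scale c x) z = c * D x z" if "x \<in> V" "z \<in> V" for c x z
      unfolding D_def fun_scale_def sum_distrib_left
      by (intro sum.cong refl edge_dir_scale V_H1 that ell_nonneg)
    show "D y x = cnj (D x y)" for x y
      unfolding D_def cnj_sum by (intro sum.cong refl edge_dir_cnj)
  qed
  show "0 \<le> Re (M x x)" for x
    unfolding M_def Re_sum by (intro sum_nonneg Re_edge_L2_nonneg)
  show "0 \<le> Re (D x x)" for x
    unfolding D_def Re_sum edge_dir_def by (intro sum_nonneg Re_edge_L2_nonneg)
qed

lemma graph_L2_eq: "graph_L2 n ell f = Re (M f f)"
  by (simp add: graph_L2_def M_def edge_L2_self Re_sum)

lemma graph_dirichlet_eq: "graph_dirichlet n ell f = Re (D f f)"
  by (simp add: graph_dirichlet_def D_def dirichlet_on_eq[symmetric] Re_sum)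

lemma sum_fun_scale: "(\<Sum>i\<in>I. fun_scale (c i) (f i)) = (\<lambda>j s. \<Sum>i\<in>I. c i * f i j s)"
proof (induction I rule: infinite_finite_induct)
  case (insert x F)
  then show ?case by (simp add: fun_scale_def plus_fun_def)
qed (auto simp: zero_fun_def)

lemma comb_eq: "comb m \<phi> c = lin_comb m \<phi> c"
  by (simp add: comb_def lin_comb_def sum_fun_scale)

lemma graph_eig_eq: "graph_eig n alpha ell m = Inf (rayleigh_values m)"
proof -
  have "form_domain n alpha ell f \<longleftrightarrow> f \<in> V" for f by (simp add: V_def)
  then show ?thesis
    unfolding graph_eig_def rayleigh_values_def comb_eq graph_L2_eq graph_dirichlet_eq by simp
qed

text \<open>On each edge Poincare's inequality on cells of length \<delta> gives (l + 1) M \<le> D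
  for functions vanishing at the nodes, so \<open>q l\<close> dominates \<open>M\<close> with
  constant 1; the same smallness of \<delta> makes the interpolation solvable.\<close>

lemma reducible_graph:
  assumes l: "0 \<le> l"
  shows "reducible l"
proof -
  have "\<exists>r::nat. 0 < r \<and> (ell j / real r)\<^sup>2 * (l + 1) \<le> 1" if j: "j \<in> {1..n}" for j
  proof -
    obtain r where r: "ell j * sqrt (l + 1) < real r" using reals_Archimedean2 by blast
    have pos: "0 < ell j * sqrt (l + 1)" using ell[OF j] l by simp
    then have "(ell j * sqrt (l + 1))\<^sup>2 \<le> (real r)\<^sup>2" using r by (intro power_mono) auto
    then have "(ell j)\<^sup>2 * (l + 1) \<le> (real r)\<^sup>2" using l by (simp add: power_mult_distrib)
    moreover have "0 < r" using r pos by (metis less_trans of_nat_0_less_iff)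
    ultimately show ?thesis by (intro exI[of _ r]) (simp add: power_divide divide_le_eq)
  qed
  then have "\<forall>j\<in>{1..n}. \<exists>r::nat. 0 < r \<and> (ell j / real r)\<^sup>2 * (l + 1) \<le> 1" by blast
  from bchoice[OF this] obtain r where r: "\<forall>j\<in>{1..n}. 0 < (r j :: nat) \<and> (ell j / real (r j))\<^sup>2 * (l + 1) \<le> 1" ..
  define \<delta> where "\<delta> = (\<lambda>j. ell j / real (r j))"
  have \<delta>: "0 < \<delta> j" "(\<delta> j)\<^sup>2 * (l + 1) \<le> 1" "real (r j) * \<delta> j = ell j" if "j \<in> {1..n}" for j
    using r that ell[OF that] by (auto simp: \<delta>_def)
  \<comment> \<open>The nodes include both ends of each edge, so an interpolant inherits the
    matching conditions.\<close>
  define ev where "ev = (\<lambda>(j, k) (f :: nat \<Rightarrow> real \<Rightarrow> complex). f j (real k * \<delta> j))"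
  define \<Phi> where "\<Phi> = ev ` Sigma {1..n} (\<lambda>j. {..r j})"
  have \<Phi>0: "(\<forall>g\<in>\<Phi>. g h = 0) \<longleftrightarrow> (\<forall>j\<in>{1..n}. \<forall>k\<le>r j. h j (real k * \<delta> j) = 0)" for h
    unfolding \<Phi>_def ball_simps ev_def by auto
  have fin: "finite \<Phi>" by (auto simp: \<Phi>_def)
  have lin: "\<forall>g\<in>\<Phi>. linear_functional g"
    unfolding \<Phi>_def linear_functional_def ev_def by (auto simp: plus_fun_def fun_scale_def)
  have coercive: "1 * Re (M h h) \<le> Re (q l h h)" if h: "h \<in> V" and z: "\<forall>g\<in>\<Phi>. g h = 0" for h
  proof -
    have "(l + 1) * Re (edge_L2 (ell j) (h j) (h j)) \<le> Re (edge_dir (ell j) (h j) (h j))" if j: "j \<in> {1..n}" for j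
    proof -
      let ?A = "LINT s:{0..ell j}|lborel. (cmod (h j s))\<^sup>2"
      let ?B = "LINT s:{0..ell j}|lborel. (cmod (edge_deriv (ell j) (h j) s))\<^sup>2"
      have zj: "h j (real k * \<delta> j) = 0" if "k < r j" for k
        using z[unfolded \<Phi>0] j that by auto
      have wd: "weak_deriv 0 (real (r j) * \<delta> j) (h j) (edge_deriv (ell j) (h j))"
        unfolding \<delta>(3)[OF j] by (rule edge_deriv[OF V_H1[OF h j]])
      have A: "?A \<le> (\<delta> j)\<^sup>2 * ?B"
        using mesh_poincare[OF wd zj \<delta>(1)[OF j]] unfolding \<delta>(3)[OF j] by simp
      have "0 \<le> ?B" unfolding set_lebesgue_integral_def by (intro Bochner_Integration.integral_nonneg) auto
      then have "((\<delta> j)\<^sup>2 * (l + 1)) * ?B \<le> ?B" using \<delta>(2)[OF j] by (intro mult_left_le_one_le) (use l in auto)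
      moreover have "(l + 1) * ?A \<le> (l + 1) * ((\<delta> j)\<^sup>2 * ?B)" using A l by (intro mult_left_mono) auto
      ultimately show ?thesis unfolding edge_dir_def edge_L2_self by (simp add: mult_ac)
    qed
    then have "(\<Sum>j\<in>{1..n}. (l + 1) * Re (edge_L2 (ell j) (h j) (h j))) \<le> (\<Sum>j\<in>{1..n}. Re (edge_dir (ell j) (h j) (h j)))"
      by (intro sum_mono)
    then have "(l + 1) * Re (M h h) \<le> Re (D h h)" by (simp add: M_def D_def Re_sum sum_distrib_left)
    then show ?thesis by (simp add: Re_q algebra_simps)
  qed
  have interp: "\<exists>u\<in>V. (\<forall>g\<in>\<Phi>. g (v - u) = 0) \<and> (\<forall>h\<in>V. (\<forall>g\<in>\<Phi>. g h = 0) \<longrightarrow> q l u h = 0)"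
    if v: "v \<in> V" for v
  proof -
    have "\<forall>j\<in>{1..n}. \<exists>ug. weak_deriv 0 (ell j) (fst ug) (snd ug) \<and> (\<forall>k\<le>r j. fst ug (real k * \<delta> j) = v j (real k * \<delta> j)) \<and>
      (\<forall>h \<gamma>. weak_deriv 0 (ell j) h \<gamma> \<longrightarrow> (\<forall>k\<le>r j. h (real k * \<delta> j) = 0) \<longrightarrow>
      edge_L2 (ell j) (snd ug) \<gamma> = of_real l * edge_L2 (ell j) (fst ug) h)"
    proof
      fix j assume j: "j \<in> {1..n}"
      show "\<exists>ug. weak_deriv 0 (ell j) (fst ug) (snd ug) \<and> (\<forall>k\<le>r j. fst ug (real k * \<delta> j) = v j (real k * \<delta> j)) \<and>
        (\<forall>h \<gamma>. weak_deriv 0 (ell j) h \<gamma> \<longrightarrow> (\<forall>k\<le>r j. h (real k * \<delta> j) = 0) \<longrightarrow>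
        edge_L2 (ell j) (snd ug) \<gamma> = of_real l * edge_L2 (ell j) (fst ug) h)"
        using mesh_interpolation[OF l \<delta>(1,2)[OF j], of "r j" "v j"]
        unfolding \<delta>(3)[OF j] edge_L2_def split_paired_Ex fst_conv snd_conv .
    qed
    from bchoice[OF this] obtain ug where
      ug: "\<forall>j\<in>{1..n}. weak_deriv 0 (ell j) (fst (ug j)) (snd (ug j)) \<and> (\<forall>k\<le>r j. fst (ug j) (real k * \<delta> j) = v j (real k * \<delta> j)) \<and>
      (\<forall>h \<gamma>. weak_deriv 0 (ell j) h \<gamma> \<longrightarrow> (\<forall>k\<le>r j. h (real k * \<delta> j) = 0) \<longrightarrow>
      edge_L2 (ell j) (snd (ug j)) \<gamma> = of_real l * edge_L2 (ell j) (fst (ug j)) h)" ..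
    define u where "u = (\<lambda>j. fst (ug j))"
    have u: "weak_deriv 0 (ell j) (u j) (snd (ug j))" "\<And>k. k \<le> r j \<Longrightarrow> u j (real k * \<delta> j) = v j (real k * \<delta> j)"
      "\<And>h \<gamma>. weak_deriv 0 (ell j) h \<gamma> \<Longrightarrow> \<forall>k\<le>r j. h (real k * \<delta> j) = 0 \<Longrightarrow>
        edge_L2 (ell j) (snd (ug j)) \<gamma> = of_real l * edge_L2 (ell j) (u j) h" if "j \<in> {1..n}" for j
      using bspec[OF ug that] unfolding u_def by blast+
    have ends: "u j 0 = v j 0" "u j (ell j) = v j (ell j)" if j: "j \<in> {1..n}" for j
      using u(2)[OF j, of 0] u(2)[OF j, of "r j"] \<delta>(3)[OF j] by auto
    have uV: "u \<in> V"
      unfolding V_iff using H1_onI[OF u(1)] V_vertex[OF v] ends nxt_mem[OF n] by simp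
    moreover have "\<forall>g\<in>\<Phi>. g (v - u) = 0"
      unfolding \<Phi>0 using u(2) by (simp add: fun_diff_def)
    moreover have "q l u h = 0" if h: "h \<in> V" and z: "\<forall>g\<in>\<Phi>. g h = 0" for h
    proof -
      have "edge_dir (ell j) (u j) (h j) = of_real l * edge_L2 (ell j) (u j) (h j)" if j: "j \<in> {1..n}" for j
        unfolding edge_dir_eq[OF u(1)[OF j] edge_deriv[OF V_H1[OF h j]] ell_nonneg[OF j]]
        by (rule u(3)[OF j edge_deriv[OF V_H1[OF h j]]]) (use z[unfolded \<Phi>0] j in auto)
      then show ?thesis by (simp add: q_def M_def D_def sum_distrib_left)
    qed
    ultimately show ?thesis by blast
  qed
  show ?thesis
    unfolding reducible_def
    by (rule exI[of _ \<Phi>], rule exI[of _ 1]) (use fin lin coercive interp in auto)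
qed

lemma negative_orthogonal:
  assumes V: "\<And>i. i < m \<Longrightarrow> \<phi> i \<in> V"
    and orth: "\<And>i j. \<lbrakk>i < m; j < m; i \<noteq> j\<rbrakk> \<Longrightarrow> M (\<phi> i) (\<phi> j) = 0 \<and> D (\<phi> i) (\<phi> j) = 0"
    and neg: "\<And>i. i < m \<Longrightarrow> Re (q l (\<phi> i) (\<phi> i)) < 0"
  shows "negative l m"
proof -
  have "Re (q l (comb m \<phi> c) (comb m \<phi> c)) < 0" if c: "\<exists>i<m. c i \<noteq> 0" for c
  proof -
    have "q l (comb m \<phi> c) (comb m \<phi> c) = (\<Sum>i<m. of_real ((cmod (c i))\<^sup>2) * q l (\<phi> i) (\<phi> i))"
      unfolding comb_def using V orth by (intro q.sum_orthogonal) (auto simp: q_def)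
    then have "Re (q l (comb m \<phi> c) (comb m \<phi> c)) = - (\<Sum>i<m. (cmod (c i))\<^sup>2 * - Re (q l (\<phi> i) (\<phi> i)))"
      by (simp add: sum_negf del: of_real_power)
    moreover obtain i where i: "i < m" "c i \<noteq> 0" using c by blast
    have "0 < (\<Sum>i<m. (cmod (c i))\<^sup>2 * - Re (q l (\<phi> i) (\<phi> i)))"
    proof (rule sum_pos2[of _ i])
      show "0 < (cmod (c i))\<^sup>2 * - Re (q l (\<phi> i) (\<phi> i))" using i neg[of i] by (intro mult_pos_pos) auto
      show "0 \<le> (cmod (c j))\<^sup>2 * - Re (q l (\<phi> j) (\<phi> j))" if "j \<in> {..<m}" for j
        using neg[of j] that by (intro mult_nonneg_nonneg) auto
    qed (use i in auto)
    ultimately show ?thesis by linarith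
  qed
  then show ?thesis using V unfolding negative_def by blast
qed

text \<open>The Dirichlet sine functions on edge 1, extended by zero, vanish at every vertex and so
  satisfy all matching conditions. They are orthogonal with energies \<mu> i, and the first m of
  them are negative at level \<mu> m.\<close>

lemma unbounded: "\<exists>l. negative l m"
proof -
  define L where "L = ell 1"
  have one: "1 \<in> {1..n}" using n by simp
  have L: "0 < L" using ell[OF one] by (simp add: L_def)
  define \<mu> where "\<mu> = (\<lambda>i::nat. (real (Suc i) * pi / L)\<^sup>2)"
  have \<mu>: "0 < \<mu> i" for i using L by (simp add: \<mu>_def)
  have sqrt: "sqrt (\<mu> i) = real (Suc i) * pi / L" for i
    using L by (simp add: \<mu>_def real_sqrt_abs)
  define \<phi> where "\<phi> = (\<lambda>i (j::nat) s. if j = 1 then sol (\<mu> i) 0 1 s else (0::complex))"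
  have end0: "\<phi> i j 0 = 0" "j = 1 \<Longrightarrow> \<phi> i j L = 0" for i j
  proof -
    show "\<phi> i j 0 = 0" by (simp add: \<phi>_def)
    have "sin (sqrt (\<mu> i) * L) = 0" unfolding sqrt using L sin_npi[of "Suc i"] by simp
    then show "\<phi> i j L = 0" if "j = 1" using that \<mu>[of i] by (simp add: \<phi>_def sol_def osc_sin_def)
  qed
  have wd: "weak_deriv 0 (ell j) (\<phi> i j) (\<lambda>s. if j = 1 then sol (\<mu> i) 1 0 s else 0)" for i j
  proof (cases "j = 1")
    case True
    then show ?thesis using sol_weak_deriv_0[OF less_imp_le[OF \<mu>[of i]], of 0 "ell j" 0 1] by (simp add: \<phi>_def)
  next
    case False
    have "weak_deriv 0 (ell j) (\<lambda>_. 0) (\<lambda>_. 0)" by (intro weak_deriv_smooth) auto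
    with False show ?thesis by (simp add: \<phi>_def)
  qed
  have \<phi>V: "\<phi> i \<in> V" for i
    unfolding V_iff using H1_onI[OF wd] end0 by (auto simp: \<phi>_def L_def)
  have D\<phi>: "D (\<phi> i) (\<phi> j) = of_real (\<mu> i) * M (\<phi> i) (\<phi> j)" for i j
  proof -
    have "edge_dir (ell k) (\<phi> i k) (\<phi> j k) = of_real (\<mu> i) * edge_L2 (ell k) (\<phi> i k) (\<phi> j k)" if k: "k \<in> {1..n}" for k
    proof (cases "k = 1")
      case True
      have \<phi>1: "\<phi> i' k = sol (\<mu> i') 0 1" for i' by (auto simp: \<phi>_def True)
      have w: "weak_deriv 0 L (sol (\<mu> i') 0 1) (sol (\<mu> i') 1 (- of_real (\<mu> i') * 0))" for i'
        by (rule sol_weak_deriv_0[OF less_imp_le[OF \<mu>]])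
      have "edge_dir L (\<phi> i k) (\<phi> j k) = edge_L2 L (sol (\<mu> i) 1 (- of_real (\<mu> i) * 0)) (sol (\<mu> j) 1 (- of_real (\<mu> j) * 0))"
        unfolding \<phi>1 by (rule edge_dir_eq[OF w w less_imp_le[OF L]])
      also have "\<dots> = of_real (\<mu> i) * edge_L2 L (\<phi> i k) (\<phi> j k)"
        using sol_by_parts[OF less_imp_le[OF \<mu>[of i]] less_imp_le[OF L] w[of j], where p = 0 and k = 1 and c = 0]
          end0(1)[of j k] end0(2)[of k j] True
        unfolding \<phi>1 edge_L2_def by simp
      finally show ?thesis by (simp add: L_def True)
    next
      case False
      then have "\<phi> i k = (\<lambda>_. 0)" by (auto simp: \<phi>_def)
      moreover have "edge_dir (ell k) (\<lambda>s. 0 * \<phi> i k s) (\<phi> j k) = 0 * edge_dir (ell k) (\<phi> i k) (\<phi> j k)"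
        by (rule edge_dir_scale[OF H1_onI[OF wd] H1_onI[OF wd] ell_nonneg[OF k]])
      moreover have "edge_L2 (ell k) (\<lambda>s. 0 * \<phi> i k s) (\<phi> j k) = 0 * edge_L2 (ell k) (\<phi> i k) (\<phi> j k)"
        by (rule edge_L2_scale)
      ultimately show ?thesis by simp
    qed
    then show ?thesis by (simp add: D_def M_def sum_distrib_left)
  qed
  have "M (\<phi> i) (\<phi> j) = 0 \<and> D (\<phi> i) (\<phi> j) = 0" if "i \<noteq> j" for i j
  proof -
    have "cnj (D (\<phi> j) (\<phi> i)) = D (\<phi> i) (\<phi> j)" "cnj (M (\<phi> j) (\<phi> i)) = M (\<phi> i) (\<phi> j)"
      using D.hermitian[OF \<phi>V \<phi>V, of i j] M.hermitian[OF \<phi>V \<phi>V, of i j] by auto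
    then have "of_real (\<mu> j) * M (\<phi> i) (\<phi> j) = of_real (\<mu> i) * M (\<phi> i) (\<phi> j)"
      using D\<phi>[of i j] D\<phi>[of j i] by (metis complex_cnj_complex_of_real complex_cnj_mult)
    moreover have "\<mu> i \<noteq> \<mu> j"
      using that sqrt[of i] sqrt[of j] L by (auto dest: arg_cong[of _ _ sqrt])
    ultimately have "M (\<phi> i) (\<phi> j) = 0" by auto
    then show ?thesis using D\<phi> by simp
  qed
  moreover have "Re (q (\<mu> m) (\<phi> i) (\<phi> i)) < 0" if "i < m" for i
  proof -
    have "Re (M (\<phi> i) (\<phi> i)) \<noteq> 0"
    proof
      assume "Re (M (\<phi> i) (\<phi> i)) = 0"
      then have "Re (edge_L2 (ell 1) (\<phi> i 1) (\<phi> i 1)) = 0"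
        unfolding M_def Re_sum using one by (subst (asm) sum_nonneg_eq_0_iff) (auto simp: Re_edge_L2_nonneg)
      then have z: "(LINT s:{0..L}|lborel. (cmod (\<phi> i 1 s))\<^sup>2) = 0" by (simp add: edge_L2_self L_def)
      have "continuous_on {0..L} (\<phi> i 1)"
        unfolding L_def by (rule weak_deriv_continuous[OF wd])
      \<comment> \<open>The first maximum of the sine, a point where the function is certainly
        non-zero.\<close>
      moreover define x where "x = L / (2 * real (Suc i))"
      then have "x \<in> {0..L}" using L by (simp add: divide_le_eq)
      ultimately have "\<phi> i 1 x = 0" by (rule zero_of_norm_square[OF _ z L])
      moreover have "sqrt (\<mu> i) * x = pi / 2"
        unfolding sqrt x_def using L by (simp add: field_simps del: of_nat_Suc)
      then have "sin (sqrt (\<mu> i) * x) = 1" by (simp only: sin_pi_half)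
      ultimately show False using \<mu>[of i] by (simp add: \<phi>_def sol_def osc_sin_def)
    qed
    then have "0 < Re (M (\<phi> i) (\<phi> i))" using M_nonneg[OF \<phi>V[of i]] by simp
    moreover have "\<mu> i < \<mu> m"
      unfolding \<mu>_def using that L by (intro power_strict_mono divide_strict_right_mono mult_strict_right_mono) auto
    ultimately show ?thesis by (simp add: Re_q D\<phi>)
  qed
  ultimately show ?thesis using negative_orthogonal[of m \<phi> "\<mu> m"] \<phi>V by blast
qed

end

section \<open>Eigenfunctions and their Cauchy data\<close>

context quantum_graph
begin

text \<open>Cauchy data \<open>p j\<close>, \<open>k j\<close> (value and derivative at the start of edge \<open>j\<close>) of a
  solution of \<open>- f'' = l f\<close> satisfying all matching conditions.\<close>

definition vertex_data :: "real \<Rightarrow> (nat \<Rightarrow> complex) \<Rightarrow> (nat \<Rightarrow> complex) \<Rightarrow> bool"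
  where "vertex_data l p k \<longleftrightarrow> (\<forall>j\<in>{1..n}.
    of_real (sn j) * p (nxt n j) = of_real (cs j) * sol l (p j) (k j) (ell j) \<and>
    of_real (cs j) * k (nxt n j) = of_real (sn j) * sol l (k j) (- of_real l * p j) (ell j))"

text \<open>For edgewise solutions the interior terms of the integration by parts cancel and only
  contributions of the edge ends remain.\<close>

lemma q_boundary:
  assumes l: "0 \<le> l" and u: "\<And>j s. \<lbrakk>j \<in> {1..n}; 0 \<le> s; s \<le> ell j\<rbrakk> \<Longrightarrow> u j s = sol l (p j) (k j) s"
    and g: "\<And>j. j \<in> {1..n} \<Longrightarrow> H1_on (ell j) (g j)"
  shows "q l u g = (\<Sum>j\<in>{1..n}. sol l (k j) (- of_real l * p j) (ell j) * cnj (g j (ell j))) - (\<Sum>j\<in>{1..n}. k j * cnj (g j 0))"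
proof -
  have "edge_dir (ell j) (u j) (g j) - of_real l * edge_L2 (ell j) (u j) (g j) =
      sol l (k j) (- of_real l * p j) (ell j) * cnj (g j (ell j)) - k j * cnj (g j 0)" if j: "j \<in> {1..n}" for j
  proof -
    have w: "weak_deriv 0 (ell j) (u j) (sol l (k j) (- of_real l * p j))"
      by (rule weak_deriv_cong[OF sol_weak_deriv_0[OF l]]) (use u[OF j] in auto)
    have "edge_L2 (ell j) (u j) (g j) = edge_L2 (ell j) (sol l (p j) (k j)) (g j)"
      unfolding edge_L2_def by (rule set_lebesgue_integral_cong) (use u[OF j] in auto)
    then show ?thesis
      unfolding edge_dir_eq[OF w edge_deriv[OF g[OF j]] ell_nonneg[OF j]]
      using sol_by_parts[OF l ell_nonneg[OF j] edge_deriv[OF g[OF j]], where c = 0 and p = "p j" and k = "k j"]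
      by (simp add: edge_L2_def)
  qed
  then show ?thesis
    by (simp add: q_def D_def M_def sum_distrib_left sum_subtractf[symmetric])
qed

lemma sum_nxt: "(\<Sum>j\<in>{1..n}. f (nxt n j)) = (\<Sum>j\<in>{1..n}. f j :: complex)"
  by (rule sum.reindex_bij_betw[OF bij_nxt[OF n]])

text \<open>Regrouping the boundary terms by vertices with \<open>nxt\<close> makes them cancel: at
  a vertex the values of g after and before it are proportional to (c, s), the derivatives of the
  solution to (s, c).\<close>

lemma vertex_data_imp_kernel:
  assumes l: "0 \<le> l" and vd: "vertex_data l p k"
  shows "(\<lambda>j. sol l (p j) (k j)) \<in> V" "g \<in> V \<Longrightarrow> q l (\<lambda>j. sol l (p j) (k j)) g = 0"
proof -
  show "(\<lambda>j. sol l (p j) (k j)) \<in> V"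
    unfolding V_iff using vd H1_onI[OF sol_weak_deriv_0[OF l]] by (simp add: vertex_data_def)
  assume g: "g \<in> V"
  define d where "d = (\<lambda>j. sol l (k j) (- of_real l * p j) (ell j))"
  have "q l (\<lambda>j. sol l (p j) (k j)) g = (\<Sum>j\<in>{1..n}. d j * cnj (g j (ell j))) - (\<Sum>j\<in>{1..n}. k j * cnj (g j 0))"
    unfolding d_def by (rule q_boundary[OF l _ V_H1[OF g]]) auto
  also have "(\<Sum>j\<in>{1..n}. k j * cnj (g j 0)) = (\<Sum>j\<in>{1..n}. k (nxt n j) * cnj (g (nxt n j) 0))"
    by (rule sum_nxt[symmetric])
  also have "\<dots> = (\<Sum>j\<in>{1..n}. d j * cnj (g j (ell j)))"
  proof (rule sum.cong[OF refl])
    fix j assume j: "j \<in> {1..n}"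
    define s c where "s = complex_of_real (sn j)" and "c = complex_of_real (cs j)"
    define x y where "x = cnj (g j (ell j))" and "y = cnj (g (nxt n j) 0)"
    have sc: "s * s + c * c = 1"
    proof -
      have "complex_of_real ((sn j)\<^sup>2 + (cs j)\<^sup>2) = 1" by (simp only: sn_cs of_real_1)
      then show ?thesis by (simp add: s_def c_def power2_eq_square)
    qed
    have xy: "s * y = c * x" using arg_cong[OF V_vertex[OF g j], of cnj] by (simp add: s_def c_def x_def y_def)
    have kd: "c * k (nxt n j) = s * d j" using vd j by (simp add: vertex_data_def s_def c_def d_def)
    \<comment> \<open>The factor s^2 + c^2 = 1 is inserted to avoid dividing by s or c, one of which
      vanishes at an exceptional vertex.\<close>
    have "k (nxt n j) * y = (s * s + c * c) * (k (nxt n j) * y)" by (simp add: sc)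
    also have "\<dots> = s * k (nxt n j) * (s * y) + (c * k (nxt n j)) * (c * y)" by (simp add: algebra_simps)
    also have "\<dots> = s * (c * k (nxt n j)) * x + (c * k (nxt n j)) * (c * y)" unfolding xy by (simp add: algebra_simps)
    also have "\<dots> = s * (s * d j) * x + (s * d j) * (c * y)" unfolding kd ..
    also have "\<dots> = s * s * d j * x + c * d j * (s * y)" by (simp add: algebra_simps)
    also have "\<dots> = (s * s + c * c) * (d j * x)" unfolding xy by (simp add: algebra_simps)
    finally show "k (nxt n j) * cnj (g (nxt n j) 0) = d j * cnj (g j (ell j))" by (simp add: sc x_def y_def)
  qed
  finally show "q l (\<lambda>j. sol l (p j) (k j)) g = 0" by simp
qed

text \<open>Testing with functions supported in a single edge gives the differential equation there;
  the condition on derivatives is the natural boundary condition, obtained by testing at one vertex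
  at a time.\<close>

lemma kernel_imp_vertex_data:
  assumes l: "0 \<le> l" and u: "u \<in> V" and ker: "\<And>g. g \<in> V \<Longrightarrow> q l u g = 0"
  shows "\<exists>p k. vertex_data l p k \<and> (\<forall>j\<in>{1..n}. \<forall>s\<in>{0..ell j}. u j s = sol l (p j) (k j) s)"
proof -
  have "\<exists>k. \<forall>s\<in>{0..ell j}. u j s = sol l (u j 0) k s" if j: "j \<in> {1..n}" for j
  proof (rule weak_eigenfunction[OF ell[OF j] l edge_deriv[OF V_H1[OF u j]]])
    fix h \<gamma> assume h: "weak_deriv 0 (ell j) h \<gamma>" "h 0 = 0" "h (ell j) = 0"
    define g where "g = (\<lambda>i s. if i = j then h s else 0)"
    have wd: "weak_deriv 0 (ell i) (g i) (\<lambda>s. if i = j then \<gamma> s else 0)" for i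
    proof (cases "i = j")
      case True
      then show ?thesis using h(1) by (simp add: g_def)
    next
      case False
      have "weak_deriv 0 (ell i) (\<lambda>_. 0) (\<lambda>_. 0)" by (intro weak_deriv_smooth) auto
      with False show ?thesis by (simp add: g_def)
    qed
    have "g \<in> V" unfolding V_iff using H1_onI[OF wd] h by (auto simp: g_def)
    then have "q l u g = 0" by (rule ker)
    moreover have "edge_dir (ell i) (u i) (g i) = (if i = j then edge_L2 (ell j) (edge_deriv (ell j) (u j)) \<gamma> else 0)"
      if i: "i \<in> {1..n}" for i
      unfolding edge_dir_eq[OF edge_deriv[OF V_H1[OF u i]] wd ell_nonneg[OF i]] by (simp add: edge_L2_def)
    moreover have "edge_L2 (ell i) (u i) (g i) = (if i = j then edge_L2 (ell j) (u j) h else 0)" for i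
      by (simp add: edge_L2_def g_def)
    ultimately show "(LINT s:{0..ell j}|lborel. edge_deriv (ell j) (u j) s * cnj (\<gamma> s)) =
        of_real l * (LINT s:{0..ell j}|lborel. u j s * cnj (h s))"
      using j by (simp add: q_def D_def M_def edge_L2_def)
  qed
  then have "\<forall>j\<in>{1..n}. \<exists>k. \<forall>s\<in>{0..ell j}. u j s = sol l (u j 0) k s" by blast
  from bchoice[OF this] obtain k where k: "\<forall>j\<in>{1..n}. \<forall>s\<in>{0..ell j}. u j s = sol l (u j 0) (k j) s" ..
  define p where "p = (\<lambda>j. u j 0)"
  define d where "d = (\<lambda>j. sol l (k j) (- of_real l * p j) (ell j))"
  have uk: "u j s = sol l (p j) (k j) s" if "j \<in> {1..n}" "0 \<le> s" "s \<le> ell j" for j s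
    unfolding p_def by (rule bspec[OF bspec[OF k that(1)]]) (use that in simp)
  have "of_real (cs j) * k (nxt n j) = of_real (sn j) * d j" if j: "j \<in> {1..n}" for j
  proof -
    \<comment> \<open>The test function is affine on each edge, with value \<open>cs j\<close> at
      the start of the edge after vertex j, \<open>sn j\<close> at the end of edge j and 0 at all
      other ends: it satisfies the matching conditions and isolates vertex j.\<close>
    define A where "A = (\<lambda>i. if i = nxt n j then complex_of_real (cs j) else 0)"
    define B where "B = (\<lambda>i. if i = j then complex_of_real (sn j) else 0)"
    define g where "g = (\<lambda>i. sol 0 (A i) ((B i - A i) / of_real (ell i)))"
    have g0: "g i 0 = A i" for i by (simp add: g_def)
    have gl: "g i (ell i) = B i" if "i \<in> {1..n}" for i
      using ell[OF that] by (simp add: g_def sol_def osc_cos_def osc_sin_def)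
    have "nxt n i = nxt n j \<longleftrightarrow> i = j" if "i \<in> {1..n}" for i
      using that j by (metis prv_nxt)
    then have "g \<in> V"
      unfolding V_iff g0 using H1_onI[OF sol_weak_deriv_0[OF order_refl]]
      by (auto simp: gl g_def[symmetric] A_def B_def) (simp add: g_def)
    then have "q l u g = 0" by (rule ker)
    moreover have "q l u g = (\<Sum>i\<in>{1..n}. d i * cnj (g i (ell i))) - (\<Sum>i\<in>{1..n}. k i * cnj (g i 0))"
      unfolding d_def by (rule q_boundary[OF l uk V_H1[OF \<open>g \<in> V\<close>]])
    moreover have "(\<Sum>i\<in>{1..n}. d i * cnj (g i (ell i))) = d j * of_real (sn j)"
    proof -
      have "(\<Sum>i\<in>{1..n}. d i * cnj (g i (ell i))) = (\<Sum>i\<in>{1..n}. if i = j then d j * of_real (sn j) else 0)"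
        by (intro sum.cong) (auto simp: gl B_def)
      then show ?thesis using j by simp
    qed
    moreover have "(\<Sum>i\<in>{1..n}. k i * cnj (g i 0)) = k (nxt n j) * of_real (cs j)"
    proof -
      have "(\<Sum>i\<in>{1..n}. k i * cnj (g i 0)) = (\<Sum>i\<in>{1..n}. if i = nxt n j then k (nxt n j) * of_real (cs j) else 0)"
        by (intro sum.cong) (auto simp: g0 A_def)
      then show ?thesis using nxt_mem[OF n j] by simp
    qed
    ultimately show ?thesis by (simp add: mult.commute)
  qed
  moreover have "of_real (sn j) * p (nxt n j) = of_real (cs j) * sol l (p j) (k j) (ell j)" if j: "j \<in> {1..n}" for j
    using V_vertex[OF u j] uk[OF j, of "ell j"] ell_nonneg[OF j] by (simp add: p_def)
  ultimately have "vertex_data l p k" by (simp add: vertex_data_def d_def)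
  then show ?thesis using uk by auto
qed

lemma sol_eq_0:
  assumes l: "0 \<le> l" and L: "0 < L" and z: "\<And>s. s \<in> {0..L} \<Longrightarrow> sol l p k s = 0"
  shows "p = 0" "k = 0"
proof -
  show p: "p = 0" using z[of 0] L by simp
  define d where "d = min L (1 / (l + 1))"
  have d: "0 < d" "d \<le> L" using L l by (auto simp: d_def)
  have "d \<le> 1 / (l + 1)" by (simp add: d_def)
  then have "d * (l + 1) \<le> 1" using l by (simp add: field_simps)
  moreover have "d \<le> 1" using \<open>d \<le> 1 / (l + 1)\<close> l by (smt (verit) divide_le_eq_1)
  ultimately have "d\<^sup>2 * (l + 1) \<le> 1"
    using d mult_mono[of d 1 "d * (l + 1)" 1] l by (simp add: power2_eq_square mult.assoc)
  then have "0 < osc_sin l d" by (rule osc_sin_pos[OF l d(1)])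
  then show "k = 0" using z[of d] d p by (simp add: sol_def)
qed

lemma M_eq_0:
  assumes u: "u \<in> V" and z: "Re (M u u) = 0" and j: "j \<in> {1..n}" and s: "s \<in> {0..ell j}"
  shows "u j s = 0"
proof -
  have "Re (edge_L2 (ell j) (u j) (u j)) = 0"
    using z j unfolding M_def Re_sum by (subst (asm) sum_nonneg_eq_0_iff) (auto simp: Re_edge_L2_nonneg)
  then have "(LINT s:{0..ell j}|lborel. (cmod (u j s))\<^sup>2) = 0" by (simp add: edge_L2_self)
  from zero_of_norm_square[OF weak_deriv_continuous[OF edge_deriv[OF V_H1[OF u j]]] this ell[OF j] s]
  show ?thesis .
qed

text \<open>At l = 0 the kernel equation tested with the solution itself says that its Dirichlet
  energy vanishes; the derivative is then zero on each edge.\<close>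

lemma vertex_data_0:
  assumes vd: "vertex_data 0 p k"
  shows "\<forall>j\<in>{1..n}. k j = 0"
proof
  fix j assume j: "j \<in> {1..n}"
  let ?u = "\<lambda>j. sol 0 (p j) (k j)"
  note u = vertex_data_imp_kernel[OF order_refl vd]
  have "D ?u ?u = 0" using u(2)[OF u(1)] by (simp add: q_def)
  then have "(\<Sum>j\<in>{1..n}. Re (edge_dir (ell j) (?u j) (?u j))) = 0"
    unfolding D_def Re_sum[symmetric] by simp
  then have "Re (edge_dir (ell j) (?u j) (?u j)) = 0"
    using j unfolding edge_dir_def by (subst (asm) sum_nonneg_eq_0_iff) (simp_all add: Re_edge_L2_nonneg)
  moreover have "edge_dir (ell j) (?u j) (?u j) = edge_L2 (ell j) (sol 0 (k j) 0) (sol 0 (k j) 0)"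
    using edge_dir_eq[OF sol_weak_deriv_0[OF order_refl] sol_weak_deriv_0[OF order_refl] ell_nonneg[OF j],
        of "p j" "k j" "p j" "k j"] by simp
  ultimately have z: "(LINT s:{0..ell j}|lborel. (cmod (sol 0 (k j) 0 s))\<^sup>2) = 0" by (simp add: edge_L2_self)
  have "sol 0 (k j) 0 0 = 0"
    using sol_continuous[of 0 "{0..ell j}" "k j" 0 0]
    by (intro zero_of_norm_square[OF _ z ell[OF j]]) (use ell_nonneg[OF j] in auto)
  then show "k j = 0" by simp
qed

text \<open>Turns kernel dimensions into linear algebra on Cauchy data: kernel elements are
  solutions on the edges, and a solution vanishing on an edge has zero data.\<close>

lemma kernel_familyI:
  assumes l: "0 \<le> l" and I: "finite I"
    and vd: "\<And>i. i \<in> I \<Longrightarrow> vertex_data l (P i) (K i)"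
    and indep: "\<And>c i. \<lbrakk>\<forall>j\<in>{1..n}. (\<Sum>i\<in>I. c i * P i j) = 0 \<and> (\<Sum>i\<in>I. c i * K i j) = 0; i \<in> I\<rbrakk> \<Longrightarrow> c i = 0"
    and gen: "\<And>p k. vertex_data l p k \<Longrightarrow>
      \<exists>c. \<forall>j\<in>{1..n}. p j = (\<Sum>i\<in>I. c i * P i j) \<and> k j = (\<Sum>i\<in>I. c i * K i j)"
  shows "\<exists>\<kappa>. kernel_family l (card I) \<kappa>"
proof -
  obtain e where e: "bij_betw e {..<card I} I"
    using ex_bij_betw_nat_finite[OF I] by (auto simp: atLeast0LessThan)
  have eI: "e i \<in> I" if "i < card I" for i using e that by (auto simp: bij_betw_def)
  define \<phi> where "\<phi> = (\<lambda>i j. sol l (P i j) (K i j))"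
  define \<kappa> where "\<kappa> = (\<lambda>i. \<phi> (e i))"
  have \<phi>: "\<phi> i \<in> V" "\<And>g. g \<in> V \<Longrightarrow> q l (\<phi> i) g = 0" if "i \<in> I" for i
    using vertex_data_imp_kernel[OF l vd[OF that]] by (auto simp: \<phi>_def)
  have sol_sum: "(\<Sum>i\<in>I. c i * \<phi> i j s) = sol l (\<Sum>i\<in>I. c i * P i j) (\<Sum>i\<in>I. c i * K i j) s" for c j s
    by (simp add: \<phi>_def sol_def sum_distrib_left sum_distrib_right sum.distrib distrib_left mult_ac)
  have reindex: "(\<Sum>i<card I. c (e i) * f (e i)) = (\<Sum>i\<in>I. c i * f i)" for c f :: "_ \<Rightarrow> complex"
    by (rule sum.reindex_bij_betw[OF e])
  have "c i = 0" if z: "Re (M (comb (card I) \<kappa> c) (comb (card I) \<kappa> c)) = 0" and i: "i < card I" for c i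
  proof -
    define c' where "c' = (\<lambda>x. c (the_inv_into {..<card I} e x))"
    have c': "c' (e i) = c i" if "i < card I" for i
      using e that by (auto simp: c'_def bij_betw_def the_inv_into_f_f)
    have V: "comb (card I) \<kappa> c \<in> V" using \<phi>(1) eI by (intro comb_in_V) (auto simp: \<kappa>_def)
    have comb: "comb (card I) \<kappa> c j s = sol l (\<Sum>i\<in>I. c' i * P i j) (\<Sum>i\<in>I. c' i * K i j) s" for j s
    proof -
      have "comb (card I) \<kappa> c j s = (\<Sum>i<card I. c' (e i) * \<phi> (e i) j s)"
        unfolding comb_eq lin_comb_def \<kappa>_def using c' by (intro sum.cong) auto
      then show ?thesis using reindex[of c' "\<lambda>i. \<phi> i j s"] by (simp add: sol_sum)
    qed
    have "\<forall>j\<in>{1..n}. (\<Sum>i\<in>I. c' i * P i j) = 0 \<and> (\<Sum>i\<in>I. c' i * K i j) = 0"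
    proof
      fix j assume j: "j \<in> {1..n}"
      have "sol l (\<Sum>i\<in>I. c' i * P i j) (\<Sum>i\<in>I. c' i * K i j) s = 0" if "s \<in> {0..ell j}" for s
        using M_eq_0[OF V z j that] comb by simp
      from sol_eq_0[OF l ell[OF j] this] show "(\<Sum>i\<in>I. c' i * P i j) = 0 \<and> (\<Sum>i\<in>I. c' i * K i j) = 0" by simp
    qed
    from indep[OF this eI[OF i]] show ?thesis using c'[OF i] by simp
  qed
  moreover have "M f u = 0" if u: "u \<in> V" "\<forall>g\<in>V. q l u g = 0" and f: "f \<in> V" "\<forall>i<card I. M f (\<kappa> i) = 0" for u f
  proof -
    obtain p k where pk: "vertex_data l p k" "\<forall>j\<in>{1..n}. \<forall>s\<in>{0..ell j}. u j s = sol l (p j) (k j) s"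
      using kernel_imp_vertex_data[OF l u(1)] u(2) by blast
    obtain c where c: "\<forall>j\<in>{1..n}. p j = (\<Sum>i\<in>I. c i * P i j) \<and> k j = (\<Sum>i\<in>I. c i * K i j)"
      using gen[OF pk(1)] by blast
    have "M f u = M f (\<Sum>i\<in>I. fun_scale (c i) (\<phi> i))"
      unfolding M_def edge_L2_def
      by (intro sum.cong refl set_lebesgue_integral_cong) (use pk(2) c in \<open>auto simp: sum_fun_scale sol_sum\<close>)
    also have "\<dots> = (\<Sum>i\<in>I. cnj (c i) * M f (\<phi> i))"
      by (rule M.sum_right[OF \<phi>(1) f(1)])
    also have "\<dots> = 0"
    proof (rule sum.neutral, rule ballI)
      fix i assume "i \<in> I"
      then obtain i' where "i' < card I" "i = e i'" using e by (auto simp: bij_betw_def)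
      then show "cnj (c i) * M f (\<phi> i) = 0" using f(2) by (simp add: \<kappa>_def)
    qed
    finally show ?thesis .
  qed
  ultimately have "kernel_family l (card I) \<kappa>"
    unfolding kernel_family_def using \<phi> eI by (auto simp: \<kappa>_def)
  then show ?thesis by blast
qed

end

section \<open>Transfer matrices, no exceptional angle\<close>

text \<open>The explicit basis computed by Gauss-Jordan elimination, restated by coordinates so that
  later arguments handle only finite sums.\<close>

lemma kernel_basis:
  fixes A :: "'a::field mat"
  assumes A: "A \<in> carrier_mat nr nc"
  shows "\<exists>S. finite S \<and> card S = kernel_dim A \<and> S \<subseteq> mat_kernel A \<and>
    (\<forall>c. (\<forall>i<nc. (\<Sum>x\<in>S. c x * x $ i) = 0) \<longrightarrow> (\<forall>x\<in>S. c x = 0)) \<and>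
    (\<forall>v\<in>mat_kernel A. \<exists>c. \<forall>i<nc. v $ i = (\<Sum>x\<in>S. c x * x $ i))"
proof -
  let ?B = "gauss_jordan_single A"
  from gauss_jordan_single[OF A refl]
  obtain P Q where AB: "?B = P * A" and QP: "Q * P = 1\<^sub>m nr" and
    P: "P \<in> carrier_mat nr nr" and Q: "Q \<in> carrier_mat nr nr" and B: "?B \<in> carrier_mat nr nc"
    and row: "row_echelon_form ?B" by auto
  interpret K: kernel nr nc ?B by (unfold_locales, rule B)
  have same: "mat_kernel ?B = mat_kernel A" using mat_kernel_mult_eq[OF A P Q QP, folded AB] .
  have dim: "kernel_dim A = K.dim" using same A unfolding kernel_dim_def by simp
  define S where "S = set (find_base_vectors ?B)"
  note fb = find_base_vectors[OF row B, folded S_def]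
  have fin: "finite S" by (simp add: S_def)
  have basis: "K.basis S" by (rule fb(3))
  have S: "S \<subseteq> mat_kernel ?B" by (rule fb(1))
  have "card S = kernel_dim A" using fb(4,6) dim by simp
  moreover have "\<forall>x\<in>S. c x = 0" if z: "\<forall>i<nc. (\<Sum>x\<in>S. c x * x $ i) = 0" for c
  proof (rule ccontr)
    assume "\<not> (\<forall>x\<in>S. c x = 0)"
    then obtain x where x: "x \<in> S" "c x \<noteq> 0" by blast
    have "K.lincomb c S \<in> carrier_vec nc"
      using K.lincomb_same[OF S] S mat_kernel_carrier[OF B] K.NC.lincomb_closed[of S c] by auto
    then have "K.lincomb c S = 0\<^sub>v nc"
      using z K.lincomb_index[OF _ S] by (intro eq_vecI) auto
    then have "K.lin_dep S"
      unfolding K.Ker.lin_dep_def using fin x by (intro exI[of _ S] exI[of _ c] exI[of _ x]) auto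
    then show False using basis unfolding K.Ker.basis_def by blast
  qed
  moreover have "\<exists>c. \<forall>i<nc. v $ i = (\<Sum>x\<in>S. c x * x $ i)" if v: "v \<in> mat_kernel A" for v
  proof -
    have "v \<in> K.span S" using basis v same unfolding K.Ker.basis_def by auto
    then obtain c where "v = K.lincomb c S"
      using K.Ker.finite_span[OF fin] S by auto
    then show ?thesis using K.lincomb_index[OF _ S] by auto
  qed
  ultimately show ?thesis
    using fin S unfolding same by (intro exI[of _ S] conjI allI impI ballI) simp_all
qed

section \<open>Plane vectors, wave coordinates and transport along an edge\<close>

definition vec2 :: "complex \<Rightarrow> complex \<Rightarrow> complex vec"
  where "vec2 x y = vec_of_list [x, y]"

lemma vec2_index [simp]: "vec2 x y $ 0 = x" "vec2 x y $ Suc 0 = y"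
  by (simp_all add: vec2_def)

lemma vec2_dim [simp]: "dim_vec (vec2 x y) = 2"
  by (simp add: vec2_def)

lemma vec2_carrier [simp]: "vec2 x y \<in> carrier_vec 2"
  by (intro carrier_vecI) simp

lemma vec2_eq: "v \<in> carrier_vec 2 \<Longrightarrow> v = vec2 (v $ 0) (v $ 1)"
  by (intro eq_vecI) (auto simp: less_2_cases_iff)

lemma smult_vec2: "a \<cdot>\<^sub>v vec2 x y = vec2 (a * x) (a * y)"
  by (intro eq_vecI) (auto simp: less_2_cases_iff)

lemma mat2_carrier [simp]: "mat_of_rows_list 2 [[a, b], [c, d]] \<in> carrier_mat 2 2"
  by (intro carrier_matI) (auto simp: mat_of_rows_list_def)

lemma mat2_mult_vec:
  "mat_of_rows_list 2 [[a, b], [c, d]] *\<^sub>v vec2 x y = vec2 (a * x + b * y) (c * x + d * y)" for a :: complex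
proof (rule eq_vecI)
  fix i assume "i < dim_vec (vec2 (a * x + b * y) (c * x + d * y))"
  then have "i = 0 \<or> i = 1" by (simp add: less_2_cases_iff)
  then show "(mat_of_rows_list 2 [[a, b], [c, d]] *\<^sub>v vec2 x y) $ i = vec2 (a * x + b * y) (c * x + d * y) $ i"
    by (auto simp: mat_of_rows_list_def scalar_prod_def numeral_2_eq_2)
qed (simp add: mat_of_rows_list_def)

lemma Amat_carrier [simp]: "Amat a \<in> carrier_mat 2 2"
  unfolding Amat_def Let_def by (rule mat2_carrier)

lemma Bmat_carrier [simp]: "Bmat L \<sigma> \<in> carrier_mat 2 2"
  unfolding Bmat_def by (rule mat2_carrier)

lemma Bmat_0: "Bmat L 0 = 1\<^sub>m 2"
  by (intro eq_matI) (auto simp: Bmat_def mat_of_rows_list_def less_2_cases_iff)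

lemma Tprod_carrier [simp]: "Tprod alpha ell \<sigma> j \<in> carrier_mat 2 2"
  by (induction j) (auto intro!: mult_carrier_mat[of _ 2 2])

text \<open>The Cauchy data \<open>(p, k)\<close> of \<open>a exp (i \<sigma> s) + b exp (- i \<sigma> s)\<close> correspond to the
  vector \<open>(a, i b)\<close> on which the transfer matrices of the paper act.\<close>

definition wave_vec :: "real \<Rightarrow> complex \<times> complex \<Rightarrow> complex vec"
  where "wave_vec \<sigma> y = vec2 ((fst y - \<i> * snd y / \<sigma>) / 2) ((\<i> * fst y - snd y / \<sigma>) / 2)"

definition wave_data :: "real \<Rightarrow> complex vec \<Rightarrow> complex \<times> complex"
  where "wave_data \<sigma> v = (v $ 0 - \<i> * v $ 1, \<i> * \<sigma> * (v $ 0 + \<i> * v $ 1))"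

lemma wave_vec_carrier [simp]: "wave_vec \<sigma> y \<in> carrier_vec 2"
  by (simp add: wave_vec_def)

lemma wave_vec_data:
  assumes "\<sigma> \<noteq> 0" "v \<in> carrier_vec 2"
  shows "wave_vec \<sigma> (wave_data \<sigma> v) = v"
proof -
  have "wave_vec \<sigma> (wave_data \<sigma> v) = vec2 (v $ 0) (v $ 1)"
    using assms(1) by (simp add: wave_vec_def wave_data_def field_simps)
  then show ?thesis using vec2_eq[OF assms(2)] by simp
qed

lemma wave_data_vec:
  assumes "\<sigma> \<noteq> 0"
  shows "wave_data \<sigma> (wave_vec \<sigma> y) = y"
  using assms by (cases y) (simp add: wave_vec_def wave_data_def field_simps)

definition transport :: "real \<Rightarrow> real \<Rightarrow> complex \<times> complex \<Rightarrow> complex \<times> complex"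
  where "transport l L y = (sol l (fst y) (snd y) L, sol l (snd y) (- of_real l * fst y) L)"

lemma Bmat_wave_vec:
  assumes \<sigma>: "0 < \<sigma>"
  shows "Bmat L \<sigma> *\<^sub>v wave_vec \<sigma> y = wave_vec \<sigma> (transport (\<sigma>\<^sup>2) L y)"
proof -
  define c s where "c = complex_of_real (cos (L * \<sigma>))" and "s = complex_of_real (sin (L * \<sigma>))"
  have e: "exp (\<i> * complex_of_real (L * \<sigma>)) = c + \<i> * s" "exp (- (\<i> * complex_of_real (L * \<sigma>))) = c - \<i> * s"
    unfolding c_def s_def
    by (simp_all add: exp_Euler exp_minus_Euler cos_of_real sin_of_real del: of_real_mult)
  have sol: "sol (\<sigma>\<^sup>2) p k L = p * c + k * (s / of_real \<sigma>)" for p k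
    using \<sigma> by (simp add: sol_def osc_cos_def osc_sin_def c_def s_def mult.commute)
  \<comment> \<open>Dividing the derivative by \<sigma> turns transport into the rotation by the
    angle L \<sigma>.\<close>
  define p \<kappa> where "p = fst y" and "\<kappa> = snd y / \<sigma>"
  have y: "snd y = \<kappa> * of_real \<sigma>" using \<sigma> by (simp add: \<kappa>_def)
  have t: "fst (transport (\<sigma>\<^sup>2) L y) = p * c + \<kappa> * s" "snd (transport (\<sigma>\<^sup>2) L y) / \<sigma> = \<kappa> * c - p * s"
    using \<sigma> unfolding transport_def fst_conv snd_conv sol y p_def[symmetric]
    by (simp_all add: field_simps power2_eq_square)
  have t': "wave_vec \<sigma> (transport (\<sigma>\<^sup>2) L y) =
      vec2 ((p * c + \<kappa> * s - \<i> * (\<kappa> * c - p * s)) / 2) ((\<i> * (p * c + \<kappa> * s) - (\<kappa> * c - p * s)) / 2)"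
    unfolding wave_vec_def t(1) t(2)[symmetric] by simp
  have w: "wave_vec \<sigma> y = vec2 ((p - \<i> * \<kappa>) / 2) ((\<i> * p - \<kappa>) / 2)"
    by (simp add: wave_vec_def p_def \<kappa>_def)
  have "(c + \<i> * s) * ((p - \<i> * \<kappa>) / 2) + 0 * ((\<i> * p - \<kappa>) / 2) = (p * c + \<kappa> * s - \<i> * (\<kappa> * c - p * s)) / 2"
    "0 * ((p - \<i> * \<kappa>) / 2) + (c - \<i> * s) * ((\<i> * p - \<kappa>) / 2) = (\<i> * (p * c + \<kappa> * s) - (\<kappa> * c - p * s)) / 2"
    by (simp_all add: field_simps)
  then show ?thesis
    unfolding t' w Bmat_def mat2_mult_vec mult_minus_left e by (simp only:)
qed

lemma osc_pythagoras: "0 \<le> l \<Longrightarrow> (osc_cos l x)\<^sup>2 + l * (osc_sin l x)\<^sup>2 = 1"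
  by (simp add: osc_cos_def osc_sin_def power_divide)

text \<open>The transport matrix has determinant 1 by \<open>osc_pythagoras\<close>; the linear
  combinations below are the rows of its inverse.\<close>

lemma transport_eq_0:
  assumes "0 \<le> l" "transport l L y = (0, 0)"
  shows "y = (0, 0)"
proof -
  define c s where "c = complex_of_real (osc_cos l L)" and "s = complex_of_real (osc_sin l L)"
  have "complex_of_real ((osc_cos l L)\<^sup>2 + l * (osc_sin l L)\<^sup>2) = 1"
    by (simp only: osc_pythagoras[OF assms(1)] of_real_1)
  then have cs: "c * c + of_real l * s * s = 1" by (simp add: c_def s_def power2_eq_square mult.assoc)
  have 1: "fst y * c + snd y * s = 0" and 2: "snd y * c - of_real l * fst y * s = 0"
    using assms(2) by (simp_all add: transport_def sol_def c_def s_def)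
  have "fst y = fst y * (c * c + of_real l * s * s)" by (simp add: cs)
  also have "\<dots> = c * (fst y * c + snd y * s) - s * (snd y * c - of_real l * fst y * s)" by (simp add: algebra_simps)
  finally have "fst y = 0" by (simp add: 1 2)
  have "snd y = snd y * (c * c + of_real l * s * s)" by (simp add: cs)
  also have "\<dots> = of_real l * s * (fst y * c + snd y * s) + c * (snd y * c - of_real l * fst y * s)" by (simp add: algebra_simps)
  finally have "snd y = 0" by (simp add: 1 2)
  with \<open>fst y = 0\<close> show ?thesis by (simp add: prod_eq_iff)
qed

section \<open>Matching at a vertex and the step to the next edge\<close>

locale polygon = quantum_graph +
  assumes alpha: "\<And>j. j \<in> {1..n} \<Longrightarrow> 0 < alpha j"
begin

definition exc :: "nat \<Rightarrow> bool" where "exc j \<longleftrightarrow> exc_angle (alpha j)"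

lemma exc_set_eq: "exc_set n alpha = {e \<in> {1..n}. exc e}"
  by (simp add: exc_set_def exc_def)

lemma double_angle: "pi\<^sup>2 / (2 * alpha j) = 2 * (pi\<^sup>2 / (4 * alpha j))"
  by simp

text \<open>If alpha = pi/(2k), the angle in the matching condition is k pi/2, and the parity of k
  decides which of sine and cosine vanishes.\<close>

lemma exc_parity:
  assumes j: "j \<in> {1..n}" and "exc j"
  shows "Opar (alpha j) = 1 \<and> sn j = 0 \<and> cs j \<noteq> 0 \<or> Opar (alpha j) = - 1 \<and> cs j = 0 \<and> sn j \<noteq> 0"
proof -
  obtain k :: nat where k: "1 \<le> k" "alpha j = pi / (2 * real k)"
    using assms(2) by (auto simp: exc_def exc_angle_def)
  have "(THE k::nat. k \<ge> 1 \<and> alpha j = pi / (2 * real k)) = k"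
  proof (rule the_equality)
    show "k' = k" if k': "1 \<le> k' \<and> alpha j = pi / (2 * real k')" for k'
    proof -
      have "pi / (2 * real k') = pi / (2 * real k)" using k k' by simp
      then have "real k = real k'" using k k' by (simp add: field_simps)
      then show ?thesis by simp
    qed
  qed (use k in auto)
  then have O: "Opar (alpha j) = (-1) ^ k" by (simp add: Opar_def)
  have \<theta>: "pi\<^sup>2 / (4 * alpha j) = real k * pi / 2"
    unfolding k(2) using k(1) by (simp add: power2_eq_square field_simps)
  show ?thesis
  proof (cases "even k")
    case True
    then obtain i where i: "k = 2 * i" by (elim evenE)
    have "sn j = 0" unfolding sn_def \<theta> i by (simp add: sin_npi)
    then show ?thesis using sn_cs[of j] O True by auto
  next
    case False
    then obtain i where i: "k = 2 * i + 1" by (elim oddE)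
    have "pi\<^sup>2 / (4 * alpha j) = real i * pi + pi / 2" unfolding \<theta> i by (simp add: field_simps)
    then have "cs j = 0" unfolding cs_def by (simp add: cos_add)
    then show ?thesis using sn_cs[of j] O False by auto
  qed
qed

text \<open>By the double angle formula a zero of sine or cosine gives pi^2/(2 alpha) = i pi; i is
  positive because alpha is, so alpha = pi/(2i) would be exceptional.\<close>

lemma not_exc:
  assumes j: "j \<in> {1..n}" and "\<not> exc j"
  shows "sn j \<noteq> 0" "cs j \<noteq> 0"
proof -
  have "sin (pi\<^sup>2 / (2 * alpha j)) \<noteq> 0"
  proof
    assume "sin (pi\<^sup>2 / (2 * alpha j)) = 0"
    then obtain i :: int where i: "pi\<^sup>2 / (2 * alpha j) = real_of_int i * pi"
      by (auto simp: sin_zero_iff_int2)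
    have "0 < pi\<^sup>2 / (2 * alpha j)" using alpha[OF j] by simp
    then have "0 < i" using i by (simp add: zero_less_mult_iff)
    have "pi = real_of_int i * (2 * alpha j)"
      using i alpha[OF j] by (simp add: power2_eq_square field_simps)
    then have "alpha j = pi / (2 * real (nat i))" using \<open>0 < i\<close> by (simp add: field_simps)
    then have "exc j" using \<open>0 < i\<close> unfolding exc_def exc_angle_def by (intro exI[of _ "nat i"]) auto
    then show False using assms(2) by simp
  qed
  then show "sn j \<noteq> 0" "cs j \<noteq> 0"
    unfolding double_angle sin_double sn_def cs_def by auto
qed

text \<open>Along edge \<open>j\<close> and across its end vertex: with \<theta> = pi^2/(4 alpha),
  the vertex multiplies the value by cot \<theta> and the derivative by tan \<theta>. It describes
  the matching only at non-exceptional vertices; elsewhere a quotient takes the default value of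
  division by 0.\<close>

definition step :: "real \<Rightarrow> nat \<Rightarrow> complex \<times> complex \<Rightarrow> complex \<times> complex"
  where "step l j y = (of_real (cs j / sn j) * fst (transport l (ell j) y), of_real (sn j / cs j) * snd (transport l (ell j) y))"

lemma vertex_data_iff: "vertex_data l p k \<longleftrightarrow> (\<forall>j\<in>{1..n}.
    of_real (sn j) * p (nxt n j) = of_real (cs j) * fst (transport l (ell j) (p j, k j)) \<and>
    of_real (cs j) * k (nxt n j) = of_real (sn j) * snd (transport l (ell j) (p j, k j)))"
  by (simp add: vertex_data_def transport_def)

lemma vertex_step_iff:
  assumes "j \<in> {1..n}" "\<not> exc j"
  shows "of_real (sn j) * p = of_real (cs j) * fst (transport l (ell j) y) \<and>
    of_real (cs j) * k = of_real (sn j) * snd (transport l (ell j) y) \<longleftrightarrow> (p, k) = step l j y"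
  using not_exc[OF assms] by (simp add: step_def field_simps)

lemma step_scale: "step l j (c * p, c * k) = (c * fst (step l j (p, k)), c * snd (step l j (p, k)))"
  by (simp add: step_def transport_def sol_def algebra_simps)

lemma step_eq_0:
  assumes "0 \<le> l" "j \<in> {1..n}" "\<not> exc j" "step l j y = (0, 0)"
  shows "y = (0, 0)"
proof -
  have "transport l (ell j) y = (0, 0)"
    using assms(4) not_exc[OF assms(2,3)] by (simp add: step_def prod_eq_iff)
  then show ?thesis by (rule transport_eq_0[OF assms(1)])
qed

text \<open>With \<open>ct\<close> = cot \<theta> these are the identities csc 2\<theta> = (cot
  \<theta> + tan \<theta>)/2 and cot 2\<theta> = (cot \<theta> - tan \<theta>)/2.\<close>

lemma Amat_eq:
  assumes j: "j \<in> {1..n}" "\<not> exc j" and ct: "ct = complex_of_real (cs j / sn j)"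
  shows "Amat (alpha j) = mat_of_rows_list 2
    [[(ct + 1 / ct) / 2, - \<i> * ((ct - 1 / ct) / 2)], [\<i> * ((ct - 1 / ct) / 2), (ct + 1 / ct) / 2]]"
proof -
  define c s where "c = complex_of_real (cs j)" and "s = complex_of_real (sn j)"
  have nz: "c \<noteq> 0" "s \<noteq> 0" using not_exc[OF j] by (auto simp: c_def s_def)
  have "complex_of_real ((sn j)\<^sup>2 + (cs j)\<^sup>2) = 1" by (simp only: sn_cs of_real_1)
  then have sc: "s * s + c * c = 1" by (simp add: s_def c_def power2_eq_square)
  have csc: "complex_of_real (1 / sin (pi\<^sup>2 / (2 * alpha j))) = (c / s + s / c) / 2"
  proof -
    have "complex_of_real (1 / sin (pi\<^sup>2 / (2 * alpha j))) = 1 / (2 * s * c)"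
      unfolding double_angle sin_double by (simp add: s_def c_def sn_def cs_def)
    also have "\<dots> = (s * s + c * c) / (2 * s * c)" by (simp add: sc)
    also have "\<dots> = (c / s + s / c) / 2" using nz by (simp add: field_simps)
    finally show ?thesis .
  qed
  have cot: "complex_of_real (cot (pi\<^sup>2 / (2 * alpha j))) = (c / s - s / c) / 2"
  proof -
    have "complex_of_real (cot (pi\<^sup>2 / (2 * alpha j))) = (c * c - s * s) / (2 * s * c)"
      unfolding double_angle cot_def sin_double cos_double
      by (simp add: s_def c_def sn_def cs_def power2_eq_square)
    also have "\<dots> = (c / s - s / c) / 2" using nz by (simp add: field_simps)
    finally show ?thesis .
  qed
  have "ct = c / s" "1 / ct = s / c" by (simp_all add: ct c_def s_def)
  then show ?thesis unfolding Amat_def Let_def csc cot by simp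
qed

lemma Amat_wave_vec:
  assumes j: "j \<in> {1..n}" "\<not> exc j" and \<sigma>: "0 < \<sigma>"
  shows "Amat (alpha j) *\<^sub>v wave_vec \<sigma> (transport (\<sigma>\<^sup>2) (ell j) y) = wave_vec \<sigma> (step (\<sigma>\<^sup>2) j y)"
proof -
  define a b where "a = complex_of_real (cs j / sn j)" and "b = 1 / a"
  define p \<kappa> where "p = fst (transport (\<sigma>\<^sup>2) (ell j) y)" and "\<kappa> = snd (transport (\<sigma>\<^sup>2) (ell j) y) / \<sigma>"
  have step: "wave_vec \<sigma> (step (\<sigma>\<^sup>2) j y) = vec2 ((a * p - \<i> * (b * \<kappa>)) / 2) ((\<i> * (a * p) - b * \<kappa>) / 2)"
    by (simp add: wave_vec_def step_def a_def b_def p_def \<kappa>_def)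
  have wave: "wave_vec \<sigma> (transport (\<sigma>\<^sup>2) (ell j) y) = vec2 ((p - \<i> * \<kappa>) / 2) ((\<i> * p - \<kappa>) / 2)"
    by (simp add: wave_vec_def p_def \<kappa>_def)
  have "(a + b) / 2 * ((p - \<i> * \<kappa>) / 2) + - \<i> * ((a - b) / 2) * ((\<i> * p - \<kappa>) / 2) = (a * p - \<i> * (b * \<kappa>)) / 2"
    "\<i> * ((a - b) / 2) * ((p - \<i> * \<kappa>) / 2) + (a + b) / 2 * ((\<i> * p - \<kappa>) / 2) = (\<i> * (a * p) - b * \<kappa>) / 2"
    by (simp_all add: field_simps)
  then show ?thesis
    unfolding step wave Amat_eq[OF j a_def] mat2_mult_vec b_def[symmetric] by (simp only:)
qed

lemma mat_step:
  assumes "j \<in> {1..n}" "\<not> exc j" "0 < \<sigma>"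
  shows "(Amat (alpha j) * Bmat (ell j) \<sigma>) *\<^sub>v wave_vec \<sigma> y = wave_vec \<sigma> (step (\<sigma>\<^sup>2) j y)"
  using Amat_wave_vec[OF assms] Bmat_wave_vec[OF assms(3)]
  by (simp add: assoc_mult_mat_vec[OF Amat_carrier Bmat_carrier])

lemma Tprod_wave_vec:
  assumes "\<And>i. i \<in> {1..n} \<Longrightarrow> \<not> exc i" "0 < \<sigma>" "j \<le> n" "Y 0 = y"
    and "\<And>i. i < n \<Longrightarrow> Y (Suc i) = step (\<sigma>\<^sup>2) (Suc i) (Y i)"
  shows "Tprod alpha ell \<sigma> j *\<^sub>v wave_vec \<sigma> y = wave_vec \<sigma> (Y j)"
  using assms(3)
proof (induction j)
  case 0
  then show ?case using assms(4) by simp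
next
  case (Suc j)
  have "Tprod alpha ell \<sigma> (Suc j) *\<^sub>v wave_vec \<sigma> y =
      (Amat (alpha (Suc j)) * Bmat (ell (Suc j)) \<sigma>) *\<^sub>v (Tprod alpha ell \<sigma> j *\<^sub>v wave_vec \<sigma> y)"
    unfolding Tprod.simps
    by (rule assoc_mult_mat_vec[OF mult_carrier_mat[OF Amat_carrier Bmat_carrier] Tprod_carrier]) simp
  also have "\<dots> = wave_vec \<sigma> (step (\<sigma>\<^sup>2) (Suc j) (Y j))"
    using Suc assms(1)[of "Suc j"] mat_step[of "Suc j" \<sigma>] assms(2) by simp
  finally show ?case using assms(5)[of j] Suc.prems by simp
qed

text \<open>Indexed so that \<open>orbit l y j\<close> is the data at the start of edge
  \<open>Suc j\<close>; after n steps one is back at edge 1.\<close>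

primrec orbit :: "real \<Rightarrow> complex \<times> complex \<Rightarrow> nat \<Rightarrow> complex \<times> complex" where
  "orbit l y 0 = y"
| "orbit l y (Suc j) = step l (Suc j) (orbit l y j)"

lemma orbit_sum:
  assumes "finite S"
  shows "orbit l (\<Sum>x\<in>S. c x * fst (y x), \<Sum>x\<in>S. c x * snd (y x)) j =
    (\<Sum>x\<in>S. c x * fst (orbit l (y x) j), \<Sum>x\<in>S. c x * snd (orbit l (y x) j))"
proof (induction j)
  case (Suc j)
  then show ?case
    by (simp add: step_def transport_def sol_def sum_distrib_left sum_distrib_right sum.distrib
        sum_negf sum_subtractf distrib_left right_diff_distrib mult_ac)
qed simp

text \<open>An eigenfunction is determined by its data at edge 1, and data extend to one iff a full
  turn fixes them. The spanning hypothesis also receives \<open>vertex_data\<close>, through which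
  the zero-energy case reaches \<open>vertex_data_0\<close>.\<close>

lemma regular_kernel_family:
  assumes ne: "\<And>i. i \<in> {1..n} \<Longrightarrow> \<not> exc i" and l: "0 \<le> l" and S: "finite S"
    and closed: "\<And>x. x \<in> S \<Longrightarrow> orbit l (y x) n = y x"
    and indep: "\<And>c x. \<lbrakk>(\<Sum>x\<in>S. c x * fst (y x)) = 0; (\<Sum>x\<in>S. c x * snd (y x)) = 0; x \<in> S\<rbrakk> \<Longrightarrow> c x = 0"
    and gen: "\<And>p k. \<lbrakk>vertex_data l p k; orbit l (p 1, k 1) n = (p 1, k 1)\<rbrakk> \<Longrightarrow>
      \<exists>c. p 1 = (\<Sum>x\<in>S. c x * fst (y x)) \<and> k 1 = (\<Sum>x\<in>S. c x * snd (y x))"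
  shows "\<exists>\<kappa>. kernel_family l (card S) \<kappa>"
proof (rule kernel_familyI[OF l S, where P = "\<lambda>x j. fst (orbit l (y x) (j - 1))" and K = "\<lambda>x j. snd (orbit l (y x) (j - 1))"])
  have orbit_pos: "orbit l z j = step l j (orbit l z (j - 1))" if "1 \<le> j" for z j
    using that by (cases j) auto
  show "vertex_data l (\<lambda>j. fst (orbit l (y x) (j - 1))) (\<lambda>j. snd (orbit l (y x) (j - 1)))" if x: "x \<in> S" for x
    unfolding vertex_data_iff
  proof
    fix j assume j: "j \<in> {1..n}"
    have "orbit l (y x) (nxt n j - 1) = orbit l (y x) j"
      using j closed[OF x] by (auto simp: nxt_def)
    then show "of_real (sn j) * fst (orbit l (y x) (nxt n j - 1)) = of_real (cs j) *
        fst (transport l (ell j) (fst (orbit l (y x) (j - 1)), snd (orbit l (y x) (j - 1)))) \<and>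
      of_real (cs j) * snd (orbit l (y x) (nxt n j - 1)) = of_real (sn j) *
        snd (transport l (ell j) (fst (orbit l (y x) (j - 1)), snd (orbit l (y x) (j - 1))))"
      unfolding vertex_step_iff[OF j ne[OF j]] using orbit_pos[of j "y x"] j by simp
  qed
  show "c x = 0" if "\<forall>j\<in>{1..n}. (\<Sum>x\<in>S. c x * fst (orbit l (y x) (j - 1))) = 0 \<and> (\<Sum>x\<in>S. c x * snd (orbit l (y x) (j - 1))) = 0"
    "x \<in> S" for c x
  proof -
    have "(\<Sum>x\<in>S. c x * fst (y x)) = 0" "(\<Sum>x\<in>S. c x * snd (y x)) = 0"
      using bspec[OF that(1), of 1] n by simp_all
    then show ?thesis by (rule indep[OF _ _ that(2)])
  qed
  show "\<exists>c. \<forall>j\<in>{1..n}. p j = (\<Sum>x\<in>S. c x * fst (orbit l (y x) (j - 1))) \<and> k j = (\<Sum>x\<in>S. c x * snd (orbit l (y x) (j - 1)))"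
    if vd: "vertex_data l p k" for p k
  proof -
    have succ: "(p (nxt n j), k (nxt n j)) = step l j (p j, k j)" if j: "j \<in> {1..n}" for j
      using vd j vertex_step_iff[OF j ne[OF j]] unfolding vertex_data_iff by blast
    have orb: "(p (Suc j), k (Suc j)) = orbit l (p 1, k 1) j" if "j < n" for j
      using that
    proof (induction j)
      case (Suc j)
      then show ?case using succ[of "Suc j"] by (simp add: nxt_def)
    qed simp
    have "orbit l (p 1, k 1) n = step l n (p n, k n)"
      using orbit_pos[of n] n orb[of "n - 1"] by simp
    also have "\<dots> = (p 1, k 1)" using succ[of n] n by (simp add: nxt_def)
    finally obtain c where c: "p 1 = (\<Sum>x\<in>S. c x * fst (y x))" "k 1 = (\<Sum>x\<in>S. c x * snd (y x))"
      using gen[OF vd] by blast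
    have "p j = (\<Sum>x\<in>S. c x * fst (orbit l (y x) (j - 1))) \<and> k j = (\<Sum>x\<in>S. c x * snd (orbit l (y x) (j - 1)))"
      if j: "j \<in> {1..n}" for j
    proof -
      have "j - 1 < n" "Suc (j - 1) = j" using j by auto
      then have "(p j, k j) = orbit l (p 1, k 1) (j - 1)" using orb[of "j - 1"] by simp
      then show ?thesis unfolding c orbit_sum[OF S] by simp
    qed
    then show ?thesis by blast
  qed
qed

text \<open>For \<sigma> > 0 the invertible map \<open>wave_vec\<close> intertwines the full turn
  with \<open>Tmat\<close>, so fixed data correspond to the kernel of T - 1.\<close>

lemma regular_positive:
  assumes ne: "\<And>i. i \<in> {1..n} \<Longrightarrow> \<not> exc i" and \<sigma>: "0 < \<sigma>"
  shows "\<exists>\<kappa>. kernel_family (\<sigma>\<^sup>2) (kernel_dim (char_matrix (Tmat n alpha ell \<sigma>) 1)) \<kappa>"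
proof -
  let ?T = "Tmat n alpha ell \<sigma>"
  have T: "?T \<in> carrier_mat 2 2" by (simp add: Tmat_def)
  have C: "char_matrix ?T 1 \<in> carrier_mat 2 2" using T by simp
  have T_orbit: "?T *\<^sub>v wave_vec \<sigma> y = wave_vec \<sigma> (orbit (\<sigma>\<^sup>2) y n)" for y
    unfolding Tmat_def using Tprod_wave_vec[OF ne \<sigma> order_refl, of "orbit (\<sigma>\<^sup>2) y" y] by simp
  have ker: "v \<in> mat_kernel (char_matrix ?T 1) \<longleftrightarrow> v \<in> carrier_vec 2 \<and> ?T *\<^sub>v v = v" for v
  proof (cases "v = 0\<^sub>v 2")
    case True
    have "A *\<^sub>v 0\<^sub>v 2 = 0\<^sub>v 2" if "A \<in> carrier_mat 2 2" for A :: "complex mat"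
      using that by (intro eq_vecI) auto
    then show ?thesis using True T C unfolding mat_kernel[OF C] by blast
  next
    case False
    then show ?thesis
      using eigenvector_char_matrix[OF T, of v 1] T unfolding mat_kernel[OF C] eigenvector_def by auto
  qed
  obtain S :: "complex vec set" where S: "finite S" "card S = kernel_dim (char_matrix ?T 1)" "S \<subseteq> mat_kernel (char_matrix ?T 1)"
    "\<forall>c. (\<forall>i<2. (\<Sum>x\<in>S. c x * x $ i) = 0) \<longrightarrow> (\<forall>x\<in>S. c x = 0)"
    "\<forall>v\<in>mat_kernel (char_matrix ?T 1). \<exists>c. \<forall>i<2. v $ i = (\<Sum>x\<in>S. c x * x $ i)"
    using kernel_basis[OF C] by (elim exE conjE) (rule that; assumption)
  have sums: "(\<Sum>x\<in>S. c x * fst (wave_data \<sigma> x)) = (\<Sum>x\<in>S. c x * x $ 0) - \<i> * (\<Sum>x\<in>S. c x * x $ 1)"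
    "(\<Sum>x\<in>S. c x * snd (wave_data \<sigma> x)) = \<i> * \<sigma> * ((\<Sum>x\<in>S. c x * x $ 0) + \<i> * (\<Sum>x\<in>S. c x * x $ 1))" for c
  proof -
    have "(\<Sum>x\<in>S. c x * fst (wave_data \<sigma> x)) = (\<Sum>x\<in>S. c x * x $ 0 - \<i> * (c x * x $ 1))"
      by (intro sum.cong refl) (simp add: wave_data_def right_diff_distrib)
    then show "(\<Sum>x\<in>S. c x * fst (wave_data \<sigma> x)) = (\<Sum>x\<in>S. c x * x $ 0) - \<i> * (\<Sum>x\<in>S. c x * x $ 1)"
      by (simp only: sum_subtractf sum_distrib_left)
    have "(\<Sum>x\<in>S. c x * snd (wave_data \<sigma> x)) = (\<Sum>x\<in>S. \<i> * \<sigma> * (c x * x $ 0 + \<i> * (c x * x $ 1)))"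
      by (intro sum.cong refl) (simp add: wave_data_def algebra_simps)
    then show "(\<Sum>x\<in>S. c x * snd (wave_data \<sigma> x)) = \<i> * \<sigma> * ((\<Sum>x\<in>S. c x * x $ 0) + \<i> * (\<Sum>x\<in>S. c x * x $ 1))"
      by (simp only: sum.distrib sum_distrib_left[symmetric])
  qed
  have "\<exists>\<kappa>. kernel_family (\<sigma>\<^sup>2) (card S) \<kappa>"
  proof (rule regular_kernel_family[OF ne zero_le_power2 S(1), where y = "wave_data \<sigma>"])
    show "orbit (\<sigma>\<^sup>2) (wave_data \<sigma> x) n = wave_data \<sigma> x" if "x \<in> S" for x
    proof -
      have x: "x \<in> carrier_vec 2" "?T *\<^sub>v x = x" using S(3) ker that by auto
      have "wave_vec \<sigma> (orbit (\<sigma>\<^sup>2) (wave_data \<sigma> x) n) = x"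
        using T_orbit[of "wave_data \<sigma> x"] wave_vec_data[OF _ x(1)] x(2) \<sigma> by simp
      then show ?thesis using wave_data_vec[of \<sigma>] \<sigma> by (metis less_irrefl)
    qed
    show "c x = 0" if z: "(\<Sum>x\<in>S. c x * fst (wave_data \<sigma> x)) = 0" "(\<Sum>x\<in>S. c x * snd (wave_data \<sigma> x)) = 0" and x: "x \<in> S" for c x
    proof -
      define a b where "a = (\<Sum>x\<in>S. c x * x $ 0)" and "b = (\<Sum>x\<in>S. c x * x $ 1)"
      have "a - \<i> * b = 0" "a + \<i> * b = 0" using z \<sigma> unfolding sums by (auto simp: a_def b_def)
      then have "a = 0" "b = 0" by (auto simp: add_eq_0_iff)
      then have "\<forall>i<2. (\<Sum>x\<in>S. c x * x $ i) = 0" by (auto simp: a_def b_def less_2_cases_iff)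
      with S(4) x show ?thesis by blast
    qed
    show "\<exists>c. p 1 = (\<Sum>x\<in>S. c x * fst (wave_data \<sigma> x)) \<and> k 1 = (\<Sum>x\<in>S. c x * snd (wave_data \<sigma> x))"
      if orb: "orbit (\<sigma>\<^sup>2) (p 1, k 1) n = (p 1, k 1)" for p k
    proof -
      have "wave_vec \<sigma> (p 1, k 1) \<in> mat_kernel (char_matrix ?T 1)"
        unfolding ker T_orbit orb by simp
      from bspec[OF S(5) this] obtain c where c: "\<forall>i<2. wave_vec \<sigma> (p 1, k 1) $ i = (\<Sum>x\<in>S. c x * x $ i)" ..
      have "wave_data \<sigma> (wave_vec \<sigma> (p 1, k 1)) = (p 1, k 1)" using \<sigma> by (intro wave_data_vec) simp
      then have "p 1 = (\<Sum>x\<in>S. c x * x $ 0) - \<i> * (\<Sum>x\<in>S. c x * x $ 1)"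
        "k 1 = \<i> * \<sigma> * ((\<Sum>x\<in>S. c x * x $ 0) + \<i> * (\<Sum>x\<in>S. c x * x $ 1))"
        using c[rule_format, of 0] c[rule_format, of 1] by (auto simp: wave_data_def)
      then show ?thesis unfolding sums[symmetric] by blast
    qed
  qed
  then show ?thesis unfolding S(2) .
qed

text \<open>At \<sigma> = 0 every B is the identity and the A's are simultaneously diagonal in the
  basis (1, i), (1, -i), so T has the eigenvalues C and 1/C with C the product of the cotangents. If
  C = 1 then T fixes every vector, but derivatives vanish at zero energy, so the graph has only the
  edgewise constant solution that is multiplied by \<open>ct\<close> at each vertex.\<close>

lemma regular_zero:
  assumes ne: "\<And>i. i \<in> {1..n} \<Longrightarrow> \<not> exc i"
  shows "\<exists>\<kappa>. kernel_family 0 (if eigenvalue (Tmat n alpha ell 0) 1 then 1 else 0) \<kappa>"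
proof -
  define ct where "ct = (\<lambda>i. complex_of_real (cs i / sn i))"
  define C where "C = (\<lambda>j. \<Prod>i\<in>{1..j}. ct i)"
  have ct0: "ct i \<noteq> 0" if "i \<in> {1..n}" for i using not_exc[OF that ne[OF that]] by (simp add: ct_def)
  have C0: "C n \<noteq> 0" using ct0 by (auto simp: C_def)
  have CS: "C (Suc j) = ct (Suc j) * C j" for j by (simp add: C_def mult.commute)
  \<comment> \<open>The vector is a (1, i) + b (1, -i), written out in coordinates.\<close>
  have A: "Amat (alpha j) *\<^sub>v vec2 (a + b) (\<i> * (a - b)) = vec2 (ct j * a + b / ct j) (\<i> * (ct j * a - b / ct j))"
    if j: "j \<in> {1..n}" for j a b
  proof -
    have "(c + d) / 2 * (a + b) + - \<i> * ((c - d) / 2) * (\<i> * (a - b)) = c * a + b * d"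
      "\<i> * ((c - d) / 2) * (a + b) + (c + d) / 2 * (\<i> * (a - b)) = \<i> * (c * a - b * d)" for c d
      by (simp_all add: field_simps)
    from this[of "ct j" "1 / ct j"] show ?thesis
      unfolding Amat_eq[OF j ne[OF j] fun_cong[OF ct_def]] mat2_mult_vec by simp
  qed
  have T: "Tprod alpha ell 0 j *\<^sub>v vec2 (a + b) (\<i> * (a - b)) = vec2 (C j * a + b / C j) (\<i> * (C j * a - b / C j))"
    if "j \<le> n" for j a b
    using that
  proof (induction j)
    case 0
    then show ?case by (simp add: C_def)
  next
    case (Suc j)
    have "Tprod alpha ell 0 (Suc j) *\<^sub>v vec2 (a + b) (\<i> * (a - b)) =
        Amat (alpha (Suc j)) *\<^sub>v (Tprod alpha ell 0 j *\<^sub>v vec2 (a + b) (\<i> * (a - b)))"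
      unfolding Tprod.simps Bmat_0 right_mult_one_mat[OF Amat_carrier]
      by (rule assoc_mult_mat_vec[OF Amat_carrier Tprod_carrier]) simp
    also have "\<dots> = vec2 (ct (Suc j) * (C j * a) + (b / C j) / ct (Suc j)) (\<i> * (ct (Suc j) * (C j * a) - (b / C j) / ct (Suc j)))"
      using Suc A[of "Suc j" "C j * a" "b / C j"] by simp
    finally show ?case by (simp add: CS mult_ac)
  qed
  let ?T = "Tmat n alpha ell 0"
  have Tc: "?T \<in> carrier_mat 2 2" by (simp add: Tmat_def)
  have Tn: "?T *\<^sub>v vec2 (a + b) (\<i> * (a - b)) = vec2 (C n * a + b / C n) (\<i> * (C n * a - b / C n))" for a b
    unfolding Tmat_def by (rule T) simp
  have ev: "eigenvalue ?T 1 \<longleftrightarrow> C n = 1"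
  proof
    assume "C n = 1"
    then have "?T *\<^sub>v vec2 1 \<i> = vec2 1 \<i>" using Tn[of 1 0] by simp
    moreover have "vec2 1 \<i> \<noteq> 0\<^sub>v 2" by (auto dest: arg_cong[of _ _ "\<lambda>v :: complex vec. v $ 0"])
    ultimately show "eigenvalue ?T 1"
      unfolding eigenvalue_def eigenvector_def using Tc by (intro exI[of _ "vec2 1 \<i>"]) auto
  next
    assume "eigenvalue ?T 1"
    then obtain v where v: "v \<in> carrier_vec 2" "v \<noteq> 0\<^sub>v 2" "?T *\<^sub>v v = v"
      unfolding eigenvalue_def eigenvector_def using Tc by auto
    define a b where "a = (v $ 0 - \<i> * v $ 1) / 2" and "b = (v $ 0 + \<i> * v $ 1) / 2"
    have vab: "v = vec2 (a + b) (\<i> * (a - b))"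
      using vec2_eq[OF v(1)] by (simp add: a_def b_def field_simps)
    have E: "vec2 (C n * a + b / C n) (\<i> * (C n * a - b / C n)) = vec2 (a + b) (\<i> * (a - b))"
      using v(3) Tn unfolding vab by simp
    define X B where "X = C n * a" and "B = b / C n"
    have XB: "X + B = a + b" "X - B = a - b"
      using arg_cong[OF E, of "\<lambda>v :: complex vec. v $ 0"] arg_cong[OF E, of "\<lambda>v :: complex vec. v $ Suc 0"]
      by (auto simp: X_def B_def)
    have "2 * X = (X + B) + (X - B)" "2 * B = (X + B) - (X - B)" by simp_all
    then have "2 * X = 2 * a" "2 * B = 2 * b" unfolding XB by simp_all
    then have ab: "C n * a = a" "b / C n = b" by (simp_all add: X_def[symmetric] B_def[symmetric])
    have "a \<noteq> 0 \<or> b \<noteq> 0"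
    proof (rule ccontr)
      assume "\<not> (a \<noteq> 0 \<or> b \<noteq> 0)"
      then have "v = vec2 0 0" using vab by simp
      also have "\<dots> = 0\<^sub>v 2" by (intro eq_vecI) (auto simp: less_2_cases_iff)
      finally show False using v(2) by simp
    qed
    then show "C n = 1" using ab C0 by (auto simp: divide_eq_eq)
  qed
  \<comment> \<open>An index set with one element or none; \<open>card S\<close> is the
    multiplicity.\<close>
  define S where "S = (if C n = 1 then {()} else {})"
  have finS: "finite S" by (simp add: S_def)
  have sol0: "sol 0 p k x = p + k * of_real x" for p k x
    by (simp add: sol_def osc_cos_def osc_sin_def)
  have orb: "orbit 0 (a, 0) j = (C j * a, 0)" for a j
    by (induction j) (simp_all add: C_def CS step_def transport_def sol0 ct_def mult.commute mult.left_commute)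
  have "\<exists>\<kappa>. kernel_family 0 (card S) \<kappa>"
  proof (rule regular_kernel_family[OF ne order_refl finS, where y = "\<lambda>_. (1, 0)"])
    show "orbit 0 (1, 0) n = (1, 0)" if "x \<in> S" for x
      using that by (auto simp: orb S_def split: if_splits)
    show "c x = 0" if "(\<Sum>x\<in>S. c x * fst (1, 0 :: complex)) = 0" "x \<in> S" for c :: "unit \<Rightarrow> complex" and x
      using that by (auto simp: S_def split: if_splits)
    show "\<exists>c. p 1 = (\<Sum>x\<in>S. c x * fst (1, 0)) \<and> k 1 = (\<Sum>x\<in>S. c x * snd (1, 0))"
      if vd: "vertex_data 0 p k" and orbp: "orbit 0 (p 1, k 1) n = (p 1, k 1)" for p k
    proof -
      have k1: "k 1 = 0" using vertex_data_0[OF vd] n by simp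
      then have "C n * p 1 = p 1" using orbp by (simp add: orb)
      then have "C n = 1 \<or> p 1 = 0" by auto
      then show ?thesis using k1 by (auto simp: S_def intro!: exI[of _ "\<lambda>_. p 1"])
    qed
  qed
  then show ?thesis by (simp add: S_def ev if_distrib[of card] cong: if_cong)
qed

end

section \<open>Exceptional angles\<close>

lemma nxt_funpow: "i + d \<le> n \<Longrightarrow> (nxt n ^^ d) i = i + d"
  by (induction d) (auto simp: nxt_def)

lemma nxt_reaches:
  assumes "i \<in> {1..n}" "j \<in> {1..n}"
  shows "\<exists>d. (nxt n ^^ d) i = j"
proof -
  have "(nxt n ^^ (n - i)) i = n" using nxt_funpow[of i "n - i" n] assms by simp
  then have "(nxt n ^^ Suc (n - i)) i = 1" by (simp add: nxt_def)
  moreover have "(nxt n ^^ (j - 1)) 1 = j" using nxt_funpow[of 1 "j - 1" n] assms by simp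
  ultimately have "(nxt n ^^ (j - 1 + Suc (n - i))) i = j" unfolding funpow_add by simp
  then show ?thesis by blast
qed

lemma nxt_funpow_mem: "j \<in> {1..n} \<Longrightarrow> (nxt n ^^ d) j \<in> {1..n}"
  by (induction d) (auto simp: nxt_def)

lemma prv_funpow_mem: "j \<in> {1..n} \<Longrightarrow> (prv n ^^ d) j \<in> {1..n}"
  by (induction d) (auto simp: prv_def)

lemma prv_nxt_funpow: "j \<in> {1..n} \<Longrightarrow> (prv n ^^ d) ((nxt n ^^ d) j) = j"
proof (induction d)
  case (Suc d)
  have "(prv n ^^ Suc d) ((nxt n ^^ Suc d) j) = (prv n ^^ d) (prv n (nxt n ((nxt n ^^ d) j)))"
    by (simp add: funpow_swap1)
  then show ?case using Suc prv_nxt[OF nxt_funpow_mem[OF Suc.prems]] by simp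
qed simp

text \<open>Behind an even vertex the outgoing edge has the Neumann condition, behind an odd one the
  Dirichlet condition; these are normalised data satisfying it.\<close>

definition start :: "real \<Rightarrow> complex \<times> complex"
  where "start a = (if Opar a = 1 then (1, 0) else (0, 1))"

lemma exp_quarter:
  "exp (\<i> * complex_of_real pi / 4) = \<i> * exp (- \<i> * complex_of_real pi / 4)"
  "cnj (exp (- \<i> * complex_of_real pi / 4)) = exp (\<i> * complex_of_real pi / 4)"
  "cnj (exp (\<i> * complex_of_real pi / 4)) = exp (- \<i> * complex_of_real pi / 4)"
proof -
  have "\<i> = exp (\<i> * complex_of_real pi / 2)"
    by (simp add: exp_eq_polar cis_conv_exp[symmetric] complex_eq_iff)
  then have "\<i> * exp (- \<i> * complex_of_real pi / 4) = exp (\<i> * complex_of_real pi / 2) * exp (- \<i> * complex_of_real pi / 4)"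
    by simp
  also have "\<dots> = exp (\<i> * complex_of_real pi / 2 + - \<i> * complex_of_real pi / 4)"
    by (rule exp_add[symmetric])
  also have "\<i> * complex_of_real pi / 2 + - \<i> * complex_of_real pi / 4 = \<i> * complex_of_real pi / 4"
    by (simp add: field_simps)
  finally show "exp (\<i> * complex_of_real pi / 4) = \<i> * exp (- \<i> * complex_of_real pi / 4)" ..
qed (simp_all add: exp_cnj)

lemma X_vec2:
  defines "w \<equiv> exp (- \<i> * complex_of_real pi / 4) / complex_of_real (sqrt 2)"
  shows "X_even = w \<cdot>\<^sub>v vec2 1 \<i>" "X_odd = (\<i> * w) \<cdot>\<^sub>v vec2 1 (- \<i>)"
  unfolding smult_vec2 X_even_def X_odd_def vec2_def[symmetric] w_def exp_quarter(1) by (simp_all add: mult_ac)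

text \<open>Only the directions of the X vectors matter for orthogonality: (1, i) for even and (1,
  -i) for odd parity.\<close>

definition xvec_sign :: "real \<Rightarrow> complex"
  where "xvec_sign a = (if Opar a = 1 then \<i> else - \<i>)"

lemma Xvec_vec2: "\<exists>c. c \<noteq> 0 \<and> Xvec a = c \<cdot>\<^sub>v vec2 1 (xvec_sign a)"
proof (cases "Opar a = 1")
  case True
  then show ?thesis
    by (intro exI[of _ "exp (- \<i> * complex_of_real pi / 4) / complex_of_real (sqrt 2)"])
       (simp add: Xvec_def xvec_sign_def X_vec2)
next
  case False
  then show ?thesis
    by (intro exI[of _ "\<i> * (exp (- \<i> * complex_of_real pi / 4) / complex_of_real (sqrt 2))"])
       (simp add: Xvec_def xvec_sign_def X_vec2)
qed

lemma cdot_Xvec_eq_0_iff: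
  "cdot (c \<cdot>\<^sub>v vec2 x y) (Xvec a) = 0 \<longleftrightarrow> c = 0 \<or> x + cnj (xvec_sign a) * y = 0"
proof -
  obtain d where d: "d \<noteq> 0" "Xvec a = d \<cdot>\<^sub>v vec2 1 (xvec_sign a)" using Xvec_vec2 by blast
  have "cdot (c \<cdot>\<^sub>v vec2 x y) (Xvec a) = c * cnj d * (x + cnj (xvec_sign a) * y)"
    unfolding d(2) smult_vec2 cdot_def by (simp add: algebra_simps)
  then show ?thesis using d(1) by simp
qed

lemma Xvec_wave_vec:
  assumes "0 < \<sigma>"
  shows "\<exists>c. c \<noteq> 0 \<and> Xvec a = c \<cdot>\<^sub>v wave_vec \<sigma> (start a)"
proof -
  obtain d where d: "d \<noteq> 0" "Xvec a = d \<cdot>\<^sub>v vec2 1 (xvec_sign a)" using Xvec_vec2 by blast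
  \<comment> \<open>\<open>wave_vec\<close> sends (1, 0) to (1, i)/2 and (0, 1) to (1, -i)/(2
    \<sigma> i); c undoes these factors.\<close>
  define c where "c = (if Opar a = 1 then 2 * d else 2 * \<sigma> * \<i> * d)"
  have "Xvec a = c \<cdot>\<^sub>v wave_vec \<sigma> (start a)"
    using assms unfolding d(2) wave_vec_def smult_vec2 c_def xvec_sign_def start_def by (simp add: mult_ac)
  then show ?thesis using d(1) assms by (intro exI[of _ c]) (auto simp: c_def)
qed

text \<open>Translates orthogonality to X into the condition at the end of a string: Dirichlet
  before an even vertex, Neumann before an odd one.\<close>

lemma cdot_wave_vec_iff:
  assumes "0 < \<sigma>" "c \<noteq> 0"
  shows "cdot (c \<cdot>\<^sub>v wave_vec \<sigma> y) (Xvec a) = 0 \<longleftrightarrow> (if Opar a = 1 then fst y = 0 else snd y = 0)"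
  using assms unfolding wave_vec_def cdot_Xvec_eq_0_iff xvec_sign_def
  by (auto simp: field_simps)

context polygon
begin

text \<open>With one of sine and cosine equal to zero, each matching condition constrains one side
  of the vertex alone: Dirichlet before and Neumann after an even vertex, the reverse at an odd
  one.\<close>

lemma exc_vertex_iff:
  fixes p k :: complex and t :: "complex \<times> complex"
  assumes "j \<in> {1..n}" "exc j"
  shows "of_real (sn j) * p = of_real (cs j) * fst t \<and> of_real (cs j) * k = of_real (sn j) * snd t \<longleftrightarrow>
    (if Opar (alpha j) = 1 then fst t = 0 \<and> k = 0 else p = 0 \<and> snd t = 0)"
  using exc_parity[OF assms] by auto

lemma vertex_data_cond:
  assumes "vertex_data l p k" "j \<in> {1..n}"
  shows "of_real (sn j) * p (nxt n j) = of_real (cs j) * fst (transport l (ell j) (p j, k j)) \<and>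
    of_real (cs j) * k (nxt n j) = of_real (sn j) * snd (transport l (ell j) (p j, k j))"
  using assms unfolding vertex_data_iff by blast

end

locale exceptional_polygon = polygon +
  assumes exc_ne: "exc_set n alpha \<noteq> {}"
begin

lemma exc_reachable: "j \<in> {1..n} \<Longrightarrow> \<exists>d>0. exc ((prv n ^^ d) j)"
proof -
  assume j: "j \<in> {1..n}"
  obtain e where e: "e \<in> {1..n}" "exc e" using exc_ne by (auto simp: exc_set_eq)
  obtain d where "(nxt n ^^ d) (nxt n e) = j" using nxt_reaches[OF nxt_mem[OF n e(1)] j] by blast
  then have "(nxt n ^^ Suc d) e = j" by (simp add: funpow_swap1)
  then have "(prv n ^^ Suc d) j = e" using prv_nxt_funpow[OF e(1), of "Suc d"] by simp
  then show ?thesis using e(2) by blast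
qed

section \<open>Strings between consecutive exceptional vertices\<close>

abbreviation gp :: "nat \<Rightarrow> nat" where "gp \<equiv> gap n alpha"

lemma gap_eq: "gp j = (LEAST d. 0 < d \<and> exc ((prv n ^^ d) j))"
  by (simp add: gap_def exc_def)

lemma gap_pos: "j \<in> {1..n} \<Longrightarrow> 0 < gp j"
  and exc_gap: "j \<in> {1..n} \<Longrightarrow> exc ((prv n ^^ gp j) j)"
  using LeastI_ex[OF exc_reachable] unfolding gap_eq by blast+

lemma not_exc_before_gap: "0 < d \<Longrightarrow> d < gp j \<Longrightarrow> \<not> exc ((prv n ^^ d) j)"
  unfolding gap_eq using not_less_Least by blast

lemma gap_exc: "exc (prv n j) \<Longrightarrow> gp j = 1"
  unfolding gap_eq by (rule Least_equality) auto

lemma gap_not_exc: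
  assumes j: "j \<in> {1..n}" and "\<not> exc (prv n j)"
  shows "gp j = Suc (gp (prv n j))"
proof -
  have p: "prv n j \<in> {1..n}" by (rule prv_mem[OF n j])
  show ?thesis
    unfolding gap_eq[of j]
  proof (rule Least_equality)
    show "0 < Suc (gp (prv n j)) \<and> exc ((prv n ^^ Suc (gp (prv n j))) j)"
      using exc_gap[OF p] by (simp add: funpow_swap1)
    fix d assume d: "0 < d \<and> exc ((prv n ^^ d) j)"
    then obtain d' where d': "d = Suc d'" by (cases d) auto
    have "d' \<noteq> 0" using d d' assms(2) by (cases d') auto
    then have "0 < d' \<and> exc ((prv n ^^ d') (prv n j))" using d d' by (simp add: funpow_swap1)
    then have "gp (prv n j) \<le> d'" unfolding gap_eq by (rule Least_le)
    then show "Suc (gp (prv n j)) \<le> d" using d' by simp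
  qed
qed

lemma prev_exc_exc: "exc (prv n j) \<Longrightarrow> prev_exc n alpha j = prv n j"
  by (simp add: prev_exc_def gap_exc)

lemma prev_exc_not_exc: "j \<in> {1..n} \<Longrightarrow> \<not> exc (prv n j) \<Longrightarrow> prev_exc n alpha j = prev_exc n alpha (prv n j)"
  by (simp add: prev_exc_def gap_not_exc funpow_swap1)

text \<open>Induction along a string from its first edge: edge \<open>j\<close> starts at vertex
  \<open>prv n j\<close>, and \<open>gp j\<close> is its position within the string.\<close>

lemma edge_induct [consumes 1, case_names start step]:
  assumes "j \<in> {1..n}"
    and "\<And>j. \<lbrakk>j \<in> {1..n}; exc (prv n j)\<rbrakk> \<Longrightarrow> Q j"
    and "\<And>j. \<lbrakk>j \<in> {1..n}; \<not> exc (prv n j); Q (prv n j)\<rbrakk> \<Longrightarrow> Q j"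
  shows "Q j"
  using assms(1)
proof (induction "gp j" arbitrary: j rule: less_induct)
  case less
  show ?case
  proof (cases "exc (prv n j)")
    case False
    then show ?thesis
      using assms(3)[OF less.prems False] less.hyps[of "prv n j"] gap_not_exc[OF less.prems False] prv_mem[OF n less.prems]
      by simp
  qed (use assms(2) less.prems in blast)
qed

primrec block_data :: "real \<Rightarrow> nat \<Rightarrow> nat \<Rightarrow> complex \<times> complex" where
  "block_data l 0 j = start (alpha (prv n j))"
| "block_data l (Suc d) j = step l (prv n j) (block_data l d (prv n j))"

text \<open>Data at the start of edge \<open>j\<close> of the normalised solution on its string that
  satisfies the condition at the beginning of the string. Off by one: edge \<open>j\<close> is
  reached after \<open>gp j - 1\<close> steps.\<close>

definition z :: "real \<Rightarrow> nat \<Rightarrow> complex \<times> complex"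
  where "z l j = block_data l (gp j - 1) j"

lemma z_start: "exc (prv n j) \<Longrightarrow> z l j = start (alpha (prv n j))"
  by (simp add: z_def gap_exc)

lemma z_step: "j \<in> {1..n} \<Longrightarrow> \<not> exc (prv n j) \<Longrightarrow> z l j = step l (prv n j) (z l (prv n j))"
  using gap_pos[OF prv_mem[OF n, of j]] by (cases "gp (prv n j)") (auto simp: z_def gap_not_exc)

lemma z_nxt:
  assumes j: "j \<in> {1..n}"
  shows "z l (nxt n j) = (if exc j then start (alpha j) else step l j (z l j))"
  using z_start[of "nxt n j" l] z_step[OF nxt_mem[OF n j], of l] prv_nxt[OF j] by simp

lemma z_nonzero:
  assumes "0 \<le> l" "j \<in> {1..n}"
  shows "z l j \<noteq> (0, 0)"
  using assms(2)
proof (induction rule: edge_induct)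
  case (start j)
  then show ?case by (simp add: z_start start_def)
next
  case (step j)
  show ?case
    unfolding z_step[OF step(1,2)] using step_eq_0[OF assms(1) prv_mem[OF n step(1)] step(2)] step(3) by blast
qed

text \<open>Names a string by the exceptional vertex at which it ends, so strings are indexed by
  \<open>exc_set\<close>.\<close>

definition own :: "nat \<Rightarrow> nat"
  where "own j = (nxt n ^^ (LEAST d. exc ((nxt n ^^ d) j))) j"

lemma exc_ahead: "j \<in> {1..n} \<Longrightarrow> \<exists>d. exc ((nxt n ^^ d) j)"
proof -
  assume j: "j \<in> {1..n}"
  obtain e where e: "e \<in> {1..n}" "exc e" using exc_ne by (auto simp: exc_set_eq)
  show ?thesis using nxt_reaches[OF j e(1)] e(2) by blast
qed

lemma own_exc [simp]: "exc j \<Longrightarrow> own j = j"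
proof -
  assume "exc j"
  then have "(LEAST d. exc ((nxt n ^^ d) j)) = 0" by (intro Least_equality) auto
  then show ?thesis by (simp add: own_def)
qed

lemma dist_nxt:
  assumes j: "j \<in> {1..n}" "\<not> exc j"
  shows "(LEAST d. exc ((nxt n ^^ d) j)) = Suc (LEAST d. exc ((nxt n ^^ d) (nxt n j)))"
proof -
  obtain d where "exc ((nxt n ^^ d) j)" using exc_ahead[OF j(1)] by blast
  from Least_Suc[where P = "\<lambda>d. exc ((nxt n ^^ d) j)", OF this] j(2) show ?thesis by (simp add: funpow_swap1)
qed

lemma own_nxt: "j \<in> {1..n} \<Longrightarrow> \<not> exc j \<Longrightarrow> own (nxt n j) = own j"
  by (simp add: own_def dist_nxt funpow_swap1)

lemma own_mem: "j \<in> {1..n} \<Longrightarrow> own j \<in> exc_set n alpha"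
  using LeastI_ex[OF exc_ahead] nxt_funpow_mem by (simp add: own_def exc_set_eq)

lemma forward_induct [consumes 1, case_names exc nxt]:
  assumes "j \<in> {1..n}"
    and "\<And>j. \<lbrakk>j \<in> {1..n}; exc j\<rbrakk> \<Longrightarrow> Q j"
    and "\<And>j. \<lbrakk>j \<in> {1..n}; \<not> exc j; Q (nxt n j)\<rbrakk> \<Longrightarrow> Q j"
  shows "Q j"
  using assms(1)
proof (induction "LEAST d. exc ((nxt n ^^ d) j)" arbitrary: j rule: less_induct)
  case less
  show ?case
  proof (cases "exc j")
    case False
    then show ?thesis
      using assms(3)[OF less.prems False] less.hyps[of "nxt n j"] dist_nxt[OF less.prems False] nxt_mem[OF n less.prems]
      by simp
  qed (use assms(2) less.prems in blast)
qed

definition end_cond :: "real \<Rightarrow> nat \<Rightarrow> bool"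
  where "end_cond l e \<longleftrightarrow> (if Opar (alpha e) = 1 then fst (transport l (ell e) (z l e)) = 0
    else snd (transport l (ell e) (z l e)) = 0)"

lemma transport_scale: "transport l L (c * p, c * k) = (c * fst (transport l L (p, k)), c * snd (transport l L (p, k)))"
  by (simp add: transport_def sol_def algebra_simps)

lemma transport_0 [simp]: "transport l L (0, 0) = (0, 0)"
  by (simp add: transport_def sol_def)

text \<open>A string solution extends by zero to the rest of the graph, because the conditions on
  the two sides of an exceptional vertex are independent.\<close>

lemma block_vertex_data:
  assumes e: "e \<in> {1..n}" "exc e" "end_cond l e"
  shows "vertex_data l (\<lambda>j. if own j = e then fst (z l j) else 0) (\<lambda>j. if own j = e then snd (z l j) else 0)"
  unfolding vertex_data_iff
proof
  fix j assume j: "j \<in> {1..n}"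
  let ?p = "\<lambda>j. if own j = e then fst (z l j) else 0"
  let ?k = "\<lambda>j. if own j = e then snd (z l j) else 0"
  show "of_real (sn j) * ?p (nxt n j) = of_real (cs j) * fst (transport l (ell j) (?p j, ?k j)) \<and>
    of_real (cs j) * ?k (nxt n j) = of_real (sn j) * snd (transport l (ell j) (?p j, ?k j))"
  proof (cases "exc j")
    case True
    show ?thesis
      unfolding exc_vertex_iff[OF j True]
      using True e(3) z_nxt[OF j, of l] by (auto simp: end_cond_def start_def)
  next
    case False
    show ?thesis
    proof (cases "own j = e")
      case True
      then show ?thesis
        unfolding vertex_step_iff[OF j False] using False z_nxt[OF j, of l] own_nxt[OF j False] by simp
    next
      case 2: False
      then show ?thesis using own_nxt[OF j False] by simp
    qed
  qed
qed

text \<open>Every solution is on each edge a multiple of \<open>z\<close>. The multiplier is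
  constant along a string, as \<open>z\<close> never vanishes, and it is zero when \<open>z\<close>
  fails the condition at the end. So each string satisfying \<open>end_cond\<close> contributes
  exactly one dimension.\<close>

lemma singular_kernel_family:
  assumes l: "0 \<le> l"
  shows "\<exists>\<kappa>. kernel_family l (card {e \<in> exc_set n alpha. end_cond l e}) \<kappa>"
proof (rule kernel_familyI[OF l, where P = "\<lambda>e j. if own j = e then fst (z l j) else 0"
      and K = "\<lambda>e j. if own j = e then snd (z l j) else 0"])
  let ?I = "{e \<in> exc_set n alpha. end_cond l e}"
  show fin: "finite ?I" by (auto simp: exc_set_eq)
  show "vertex_data l (\<lambda>j. if own j = e then fst (z l j) else 0) (\<lambda>j. if own j = e then snd (z l j) else 0)"
    if "e \<in> ?I" for e using that by (intro block_vertex_data) (auto simp: exc_set_eq)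
  have sum: "(\<Sum>e\<in>?I. c e * (if own j = e then x else 0)) = (if own j \<in> ?I then c (own j) * x else 0)"
    for c :: "nat \<Rightarrow> complex" and j x
  proof -
    have "(\<Sum>e\<in>?I. c e * (if own j = e then x else 0)) = (\<Sum>e\<in>?I. if own j = e then c (own j) * x else 0)"
      by (intro sum.cong) auto
    also have "\<dots> = (if own j \<in> ?I then c (own j) * x else 0)"
      by (rule sum.delta'[OF fin, of "own j" "\<lambda>_. c (own j) * x", simplified eq_commute[of _ "own j"]])
    finally show ?thesis .
  qed
  show "c e = 0" if eq: "\<forall>j\<in>{1..n}. (\<Sum>e\<in>?I. c e * (if own j = e then fst (z l j) else 0)) = 0 \<and>
      (\<Sum>e\<in>?I. c e * (if own j = e then snd (z l j) else 0)) = 0" and e: "e \<in> ?I" for c e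
  proof -
    have "e \<in> {1..n}" "own e = e" using e by (auto simp: exc_set_eq)
    then have "c e * fst (z l e) = 0" "c e * snd (z l e) = 0"
      using bspec[OF eq \<open>e \<in> {1..n}\<close>] e \<open>own e = e\<close> unfolding sum by simp_all
    then show ?thesis using z_nonzero[OF l \<open>e \<in> {1..n}\<close>] by (auto simp: prod_eq_iff)
  qed
  show "\<exists>c. \<forall>j\<in>{1..n}. p j = (\<Sum>e\<in>?I. c e * (if own j = e then fst (z l j) else 0)) \<and>
      k j = (\<Sum>e\<in>?I. c e * (if own j = e then snd (z l j) else 0))" if vd: "vertex_data l p k" for p k
  proof -
    have "\<exists>t. (p j, k j) = (t * fst (z l j), t * snd (z l j))" if "j \<in> {1..n}" for j
      using that
    proof (induction rule: edge_induct)
      case (start j)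
      define i where "i = prv n j"
      have i: "i \<in> {1..n}" "exc i" "nxt n i = j" using start prv_mem[OF n] nxt_prv by (auto simp: i_def)
      have "if Opar (alpha i) = 1 then k j = 0 else p j = 0"
        using vertex_data_cond[OF vd i(1)] unfolding exc_vertex_iff[OF i(1,2)] i(3) by (auto split: if_splits)
      moreover have "z l j = start (alpha i)" using start by (simp add: z_start i_def)
      ultimately show ?case
        by (intro exI[of _ "if Opar (alpha i) = 1 then p j else k j"]) (auto simp: start_def)
    next
      case (step j)
      define i where "i = prv n j"
      have i: "i \<in> {1..n}" "\<not> exc i" "nxt n i = j" using step prv_mem[OF n] nxt_prv by (auto simp: i_def)
      obtain t where t: "(p i, k i) = (t * fst (z l i), t * snd (z l i))" using step(3) unfolding i_def by blast
      have "(p j, k j) = step l i (p i, k i)"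
        using vertex_data_cond[OF vd i(1)] unfolding vertex_step_iff[OF i(1,2)] i(3) .
      also have "\<dots> = (t * fst (step l i (z l i)), t * snd (step l i (z l i)))"
        unfolding t by (simp add: step_scale)
      finally show ?case using z_step[OF step(1,2), of l] unfolding i_def by auto
    qed
    then have "\<forall>j\<in>{1..n}. \<exists>t. (p j, k j) = (t * fst (z l j), t * snd (z l j))" by blast
    from bchoice[OF this] obtain \<tau> where \<tau>: "\<forall>j\<in>{1..n}. (p j, k j) = (\<tau> j * fst (z l j), \<tau> j * snd (z l j))" ..
    have own: "\<tau> j = \<tau> (own j)" if "j \<in> {1..n}" for j
      using that
    proof (induction rule: forward_induct)
      case (nxt j)
      have nj: "nxt n j \<in> {1..n}" by (rule nxt_mem[OF n nxt(1)])
      have "(\<tau> (nxt n j) * fst (z l (nxt n j)), \<tau> (nxt n j) * snd (z l (nxt n j))) = (p (nxt n j), k (nxt n j))"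
        using bspec[OF \<tau> nj] by simp
      also have "\<dots> = step l j (p j, k j)"
        using vertex_data_cond[OF vd nxt(1)] unfolding vertex_step_iff[OF nxt(1,2)] .
      also have "\<dots> = (\<tau> j * fst (z l (nxt n j)), \<tau> j * snd (z l (nxt n j)))"
        unfolding bspec[OF \<tau> nxt(1)] using nxt(2) z_nxt[OF nxt(1), of l] by (simp add: step_scale)
      finally have "\<tau> (nxt n j) = \<tau> j" using z_nonzero[OF l nj] by (auto simp: prod_eq_iff)
      then show ?case using nxt(3) own_nxt[OF nxt(1,2)] by simp
    qed simp
    have zero: "\<tau> e = 0" if e: "e \<in> exc_set n alpha" "\<not> end_cond l e" for e
    proof -
      have e': "e \<in> {1..n}" "exc e" using e by (auto simp: exc_set_eq)
      have "if Opar (alpha e) = 1 then fst (transport l (ell e) (p e, k e)) = 0 else snd (transport l (ell e) (p e, k e)) = 0"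
        using vertex_data_cond[OF vd e'(1)] unfolding exc_vertex_iff[OF e'] by (auto split: if_splits)
      then show ?thesis
        unfolding bspec[OF \<tau> e'(1)] transport_scale using e(2) by (auto simp: end_cond_def split: if_splits)
    qed
    have "p j = (\<Sum>e\<in>?I. \<tau> e * (if own j = e then fst (z l j) else 0)) \<and>
      k j = (\<Sum>e\<in>?I. \<tau> e * (if own j = e then snd (z l j) else 0))" if j: "j \<in> {1..n}" for j
      using bspec[OF \<tau> j] own[OF j] zero[of "own j"] own_mem[OF j] unfolding sum by auto
    then show ?thesis by blast
  qed
qed

section \<open>Parity changes around the cycle and zero energy\<close>

lemma Opar_exc: "e \<in> exc_set n alpha \<Longrightarrow> Opar (alpha e) = 1 \<or> Opar (alpha e) = - 1"
  using exc_parity[of e] by (auto simp: exc_set_eq)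

lemma prev_exc_mem: "j \<in> {1..n} \<Longrightarrow> prev_exc n alpha j \<in> exc_set n alpha"
  using exc_gap prv_funpow_mem unfolding prev_exc_def exc_set_eq by blast

lemma own_before_gap:
  assumes e: "e \<in> exc_set n alpha"
  shows "d < gp e \<Longrightarrow> own ((prv n ^^ d) e) = e"
proof (induction d)
  case 0
  then show ?case using e by (simp add: exc_set_eq)
next
  case (Suc d)
  let ?i = "(prv n ^^ Suc d) e"
  have e': "e \<in> {1..n}" using e by (simp add: exc_set_eq)
  have i: "?i \<in> {1..n}" "\<not> exc ?i"
    using prv_funpow_mem[OF e'] not_exc_before_gap[of "Suc d" e] Suc.prems by blast+
  have "nxt n ?i = (prv n ^^ d) e" using nxt_prv[OF prv_funpow_mem[OF e', of d]] by simp
  then show ?case using own_nxt[OF i] Suc by simp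
qed

lemma own_nxt_prev_exc:
  assumes e: "e \<in> exc_set n alpha"
  shows "own (nxt n (prev_exc n alpha e)) = e"
proof -
  have e': "e \<in> {1..n}" using e by (simp add: exc_set_eq)
  obtain d where d: "gp e = Suc d" using gap_pos[OF e'] by (cases "gp e") auto
  have "nxt n (prev_exc n alpha e) = (prv n ^^ d) e"
    unfolding prev_exc_def d using nxt_prv[OF prv_funpow_mem[OF e', of d]] by simp
  then show ?thesis using own_before_gap[OF e, of d] d by simp
qed

text \<open>Stepping forward and passing to the end of the string inverts \<open>prev_exc\<close>
  from the left; an injective map of a finite set into itself is onto.\<close>

lemma bij_prev_exc: "bij_betw (prev_exc n alpha) (exc_set n alpha) (exc_set n alpha)"
proof -
  have fin: "finite (exc_set n alpha)" by (simp add: exc_set_eq)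
  have "inj_on (prev_exc n alpha) (exc_set n alpha)"
    by (rule inj_on_inverseI[of _ "\<lambda>i. own (nxt n i)"]) (rule own_nxt_prev_exc)
  moreover have "prev_exc n alpha ` exc_set n alpha \<subseteq> exc_set n alpha"
    using prev_exc_mem by (auto simp: exc_set_eq)
  ultimately show ?thesis
    unfolding bij_betw_def using endo_inj_surj[OF fin] by blast
qed

text \<open>Going once around the cycle, the parity switches from even to odd as often as back.\<close>

lemma card_parity_changes:
  "card {e \<in> exc_set n alpha. Opar (alpha (prev_exc n alpha e)) \<noteq> Opar (alpha e)} =
    2 * card {e \<in> exc_set n alpha. Opar (alpha (prev_exc n alpha e)) = 1 \<and> Opar (alpha e) \<noteq> 1}"
proof -
  let ?E = "exc_set n alpha" and ?f = "prev_exc n alpha"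
  define O' where "O' = (\<lambda>e. Opar (alpha e) = 1)"
  define A where "A = {e \<in> ?E. O' (?f e) \<and> \<not> O' e}"
  define A' where "A' = {e \<in> ?E. \<not> O' (?f e) \<and> O' e}"
  define W where "W = {e \<in> ?E. O' (?f e) \<and> O' e}"
  have fin: "finite ?E" by (simp add: exc_set_eq)
  then have fins: "finite A" "finite A'" "finite W" by (auto simp: A_def A'_def W_def)
  \<comment> \<open>As the predecessor map permutes the exceptional vertices, as many have an even
    predecessor as are even; removing the common part \<open>W\<close> leaves equally many switches
    in both directions.\<close>
  have "bij_betw ?f {e \<in> ?E. O' (?f e)} {e \<in> ?E. O' e}"
  proof (rule bij_betw_imageI)
    show "inj_on ?f {e \<in> ?E. O' (?f e)}"
      using bij_prev_exc by (auto simp: bij_betw_def intro: inj_on_subset)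
    show "?f ` {e \<in> ?E. O' (?f e)} = {e \<in> ?E. O' e}"
    proof (intro equalityI subsetI)
      fix y assume "y \<in> ?f ` {e \<in> ?E. O' (?f e)}"
      then obtain e where e: "e \<in> ?E" "O' (?f e)" "y = ?f e" by auto
      then have "y \<in> ?f ` ?E" by simp
      then show "y \<in> {e \<in> ?E. O' e}" using e unfolding bij_betw_imp_surj_on[OF bij_prev_exc] by simp
    next
      fix y assume "y \<in> {e \<in> ?E. O' e}"
      then have y: "y \<in> ?f ` ?E" "O' y" unfolding bij_betw_imp_surj_on[OF bij_prev_exc] by simp_all
      then show "y \<in> ?f ` {e \<in> ?E. O' (?f e)}" by auto
    qed
  qed
  then have "card {e \<in> ?E. O' (?f e)} = card {e \<in> ?E. O' e}" by (rule bij_betw_same_card)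
  moreover have "{e \<in> ?E. O' (?f e)} = A \<union> W" "{e \<in> ?E. O' e} = A' \<union> W"
    by (auto simp: A_def A'_def W_def)
  moreover have "A \<inter> W = {}" "A' \<inter> W = {}" "A \<inter> A' = {}" by (auto simp: A_def A'_def W_def)
  ultimately have "card A = card A'" using fins by (simp add: card_Un_disjoint)
  moreover have "{e \<in> ?E. Opar (alpha (?f e)) \<noteq> Opar (alpha e)} = A \<union> A'"
  proof -
    have "Opar (alpha (?f e)) \<noteq> Opar (alpha e) \<longleftrightarrow> O' (?f e) \<noteq> O' e" if e: "e \<in> ?E" for e
      using Opar_exc[OF e] Opar_exc[OF prev_exc_mem, of e] e by (auto simp: O'_def exc_set_eq)
    then show ?thesis by (auto simp: A_def A'_def)
  qed
  ultimately show ?thesis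
    using fins \<open>A \<inter> A' = {}\<close> by (simp add: card_Un_disjoint A_def O'_def)
qed

lemma transport_zero_energy: "transport 0 L y = (fst y + snd y * of_real L, snd y)"
  by (simp add: transport_def sol_def osc_cos_def osc_sin_def)

text \<open>At l = 0 each step multiplies the derivative by a non-zero factor, so it stays zero or
  stays non-zero along the string; in the first case the value is only rescaled and never
  vanishes.\<close>

lemma z_zero_energy:
  assumes "j \<in> {1..n}"
  shows "if Opar (alpha (prev_exc n alpha j)) = 1 then fst (z 0 j) \<noteq> 0 \<and> snd (z 0 j) = 0 else snd (z 0 j) \<noteq> 0"
  using assms
proof (induction rule: edge_induct)
  case (start j)
  then show ?case by (simp add: z_start prev_exc_exc start_def)
next
  case (step j)
  then show ?case
    using not_exc[OF prv_mem[OF n step(1)] step(2)]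
    by (auto simp: z_step prev_exc_not_exc step_def transport_zero_energy split: if_splits)
qed

text \<open>After an even vertex the solution is edgewise a non-zero constant, which is compatible
  with a Neumann end but not with a Dirichlet end. After an odd vertex its derivative is non-zero,
  which \<open>vertex_data_0\<close> excludes for a kernel element.\<close>

lemma end_cond_zero:
  assumes e: "e \<in> exc_set n alpha"
  shows "end_cond 0 e \<longleftrightarrow> Opar (alpha (prev_exc n alpha e)) = 1 \<and> Opar (alpha e) \<noteq> 1"
proof -
  have e': "e \<in> {1..n}" "exc e" using e by (auto simp: exc_set_eq)
  have snd0: "snd (z 0 e) = 0" if "end_cond 0 e"
    using bspec[OF vertex_data_0[OF block_vertex_data[OF e' that]] e'(1)] own_exc[OF e'(2)] by simp
  show ?thesis
  proof (cases "Opar (alpha (prev_exc n alpha e)) = 1")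
    case True
    then have "fst (z 0 e) \<noteq> 0" "snd (z 0 e) = 0" using z_zero_energy[OF e'(1)] by simp_all
    then show ?thesis using True by (simp add: end_cond_def transport_zero_energy)
  next
    case False
    then have "snd (z 0 e) \<noteq> 0" using z_zero_energy[OF e'(1)] by simp
    then show ?thesis using False snd0 by blast
  qed
qed

section \<open>Transfer matrices of the strings\<close>

lemma Wprod_carrier [simp]: "Wprod n alpha ell e \<sigma> d \<in> carrier_mat 2 2"
  by (induction d) (auto intro!: mult_carrier_mat[of _ 2 2])

lemma mat_smult_vec:
  "A \<in> carrier_mat 2 2 \<Longrightarrow> v \<in> carrier_vec 2 \<Longrightarrow> A *\<^sub>v (c \<cdot>\<^sub>v v) = c \<cdot>\<^sub>v (A *\<^sub>v v)" for A :: "complex mat"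
  by (rule mult_mat_vec)

text \<open>\<open>Wprod\<close> grows on the right while the vertex moves backwards, so the newest
  factor acts first and shortens the claim by one edge. The first factor is B alone: the result is
  the data at the end of edge \<open>e\<close>, before its vertex.\<close>

lemma Wprod_wave_vec:
  assumes e: "e \<in> {1..n}" and \<sigma>: "0 < \<sigma>"
  shows "d < gp e \<Longrightarrow> Wprod n alpha ell e \<sigma> (Suc d) *\<^sub>v wave_vec \<sigma> (z (\<sigma>\<^sup>2) ((prv n ^^ d) e)) =
    wave_vec \<sigma> (transport (\<sigma>\<^sup>2) (ell e) (z (\<sigma>\<^sup>2) e))"
proof (induction d)
  case 0
  show ?case using left_mult_one_mat[OF Bmat_carrier] by (simp add: Bmat_wave_vec[OF \<sigma>])
next
  case (Suc d)
  let ?i = "(prv n ^^ Suc d) e"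
  have i: "?i \<in> {1..n}" "\<not> exc ?i"
    using prv_funpow_mem[OF e] not_exc_before_gap[of "Suc d" e] Suc.prems by blast+
  have z: "z (\<sigma>\<^sup>2) ((prv n ^^ d) e) = step (\<sigma>\<^sup>2) ?i (z (\<sigma>\<^sup>2) ?i)"
    using z_step[OF prv_funpow_mem[OF e, of d]] i(2) by simp
  have W: "Wprod n alpha ell e \<sigma> (Suc (Suc d)) = Wprod n alpha ell e \<sigma> (Suc d) * (Amat (alpha ?i) * Bmat (ell ?i) \<sigma>)"
    unfolding Wprod.simps(2)[of n alpha ell e \<sigma> "Suc d"] by simp
  have "Wprod n alpha ell e \<sigma> (Suc (Suc d)) *\<^sub>v wave_vec \<sigma> (z (\<sigma>\<^sup>2) ?i) =
      Wprod n alpha ell e \<sigma> (Suc d) *\<^sub>v ((Amat (alpha ?i) * Bmat (ell ?i) \<sigma>) *\<^sub>v wave_vec \<sigma> (z (\<sigma>\<^sup>2) ?i))"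
    unfolding W by (rule assoc_mult_mat_vec[OF Wprod_carrier mult_carrier_mat[OF Amat_carrier Bmat_carrier]]) simp
  also have "\<dots> = Wprod n alpha ell e \<sigma> (Suc d) *\<^sub>v wave_vec \<sigma> (z (\<sigma>\<^sup>2) ((prv n ^^ d) e))"
    unfolding mat_step[OF i \<sigma>] z ..
  also have "\<dots> = wave_vec \<sigma> (transport (\<sigma>\<^sup>2) (ell e) (z (\<sigma>\<^sup>2) e))" using Suc by simp
  finally show ?case .
qed

lemma U_cond_iff:
  assumes e: "e \<in> exc_set n alpha" and \<sigma>: "0 < \<sigma>"
  shows "U_cond n alpha ell e \<sigma> \<longleftrightarrow> end_cond (\<sigma>\<^sup>2) e"
proof -
  have e': "e \<in> {1..n}" using e by (simp add: exc_set_eq)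
  obtain d where d: "gp e = Suc d" using gap_pos[OF e'] by (cases "gp e") auto
  have p: "prv n ((prv n ^^ d) e) = prev_exc n alpha e" by (simp add: prev_exc_def d)
  have "exc (prev_exc n alpha e)" using prev_exc_mem[OF e'] by (simp add: exc_set_eq)
  then have z: "z (\<sigma>\<^sup>2) ((prv n ^^ d) e) = start (alpha (prev_exc n alpha e))"
    using z_start[of "(prv n ^^ d) e"] unfolding p by simp
  obtain c where c: "c \<noteq> 0" "Xvec (alpha (prev_exc n alpha e)) = c \<cdot>\<^sub>v wave_vec \<sigma> (start (alpha (prev_exc n alpha e)))"
    using Xvec_wave_vec[OF \<sigma>] by blast
  have "Umat n alpha ell e \<sigma> *\<^sub>v Xvec (alpha (prev_exc n alpha e)) =
      c \<cdot>\<^sub>v wave_vec \<sigma> (transport (\<sigma>\<^sup>2) (ell e) (z (\<sigma>\<^sup>2) e))"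
    unfolding Umat_def d c(2) mat_smult_vec[OF Wprod_carrier wave_vec_carrier]
    using Wprod_wave_vec[OF e' \<sigma>, of d] unfolding d z by simp
  then show ?thesis
    unfolding U_cond_def end_cond_def using cdot_wave_vec_iff[OF \<sigma> c(1)] by simp
qed

text \<open>The directions (1, i) and (1, -i) are eigenvectors common to all A; at \<sigma> = 0,
  where B is the identity, U therefore only rescales X.\<close>

lemma Amat_Xvec:
  assumes "j \<in> {1..n}" "\<not> exc j"
  shows "\<exists>c. Amat (alpha j) *\<^sub>v vec2 1 (xvec_sign a) = c \<cdot>\<^sub>v vec2 1 (xvec_sign a)"
proof -
  define ct where "ct = complex_of_real (cs j / sn j)"
  define c where "c = (if Opar a = 1 then ct else 1 / ct)"
  show ?thesis
    unfolding Amat_eq[OF assms ct_def] mat2_mult_vec smult_vec2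
    by (intro exI[of _ c]) (simp add: xvec_sign_def c_def field_simps)
qed

lemma Wprod_Xvec_zero:
  assumes e: "e \<in> {1..n}"
  shows "d < gp e \<Longrightarrow> \<exists>c. Wprod n alpha ell e 0 (Suc d) *\<^sub>v vec2 1 (xvec_sign a) = c \<cdot>\<^sub>v vec2 1 (xvec_sign a)"
proof (induction d)
  case 0
  show ?case by (intro exI[of _ 1]) (simp add: Bmat_0)
next
  case (Suc d)
  let ?i = "(prv n ^^ Suc d) e" and ?v = "vec2 1 (xvec_sign a)"
  have i: "?i \<in> {1..n}" "\<not> exc ?i"
    using prv_funpow_mem[OF e] not_exc_before_gap[of "Suc d" e] Suc.prems by blast+
  obtain c where c: "Wprod n alpha ell e 0 (Suc d) *\<^sub>v ?v = c \<cdot>\<^sub>v ?v" using Suc by auto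
  obtain c' where c': "Amat (alpha ?i) *\<^sub>v ?v = c' \<cdot>\<^sub>v ?v" using Amat_Xvec[OF i] by blast
  have W: "Wprod n alpha ell e 0 (Suc (Suc d)) = Wprod n alpha ell e 0 (Suc d) * Amat (alpha ?i)"
    unfolding Wprod.simps(2)[of n alpha ell e 0 "Suc d"] Bmat_0 by (simp add: right_mult_one_mat[OF Amat_carrier])
  have "Wprod n alpha ell e 0 (Suc (Suc d)) *\<^sub>v ?v = Wprod n alpha ell e 0 (Suc d) *\<^sub>v (Amat (alpha ?i) *\<^sub>v ?v)"
    unfolding W by (rule assoc_mult_mat_vec[OF Wprod_carrier Amat_carrier]) simp
  also have "\<dots> = c' \<cdot>\<^sub>v (c \<cdot>\<^sub>v ?v)"
    unfolding c' mat_smult_vec[OF Wprod_carrier vec2_carrier] c ..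
  also have "\<dots> = (c' * c) \<cdot>\<^sub>v ?v" by (simp add: smult_vec2 mult.assoc)
  finally show ?case by blast
qed

text \<open>The directions of opposite parity are orthogonal. Hence when \<open>qmult\<close> finds
  no zero of the condition at \<sigma> = 0 there are no parity changes, and its value 0 agrees with
  half their number.\<close>

lemma U_cond_zero:
  assumes e: "e \<in> exc_set n alpha" and ne: "Opar (alpha (prev_exc n alpha e)) \<noteq> Opar (alpha e)"
  shows "U_cond n alpha ell e 0"
proof -
  have e': "e \<in> {1..n}" using e by (simp add: exc_set_eq)
  let ?a = "alpha (prev_exc n alpha e)"
  obtain d where d: "gp e = Suc d" using gap_pos[OF e'] by (cases "gp e") auto
  obtain c where c: "Wprod n alpha ell e 0 (Suc d) *\<^sub>v vec2 1 (xvec_sign ?a) = c \<cdot>\<^sub>v vec2 1 (xvec_sign ?a)"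
    using Wprod_Xvec_zero[OF e', of d] d by auto
  obtain c' where c': "Xvec ?a = c' \<cdot>\<^sub>v vec2 1 (xvec_sign ?a)" using Xvec_vec2 by blast
  have U: "Umat n alpha ell e 0 *\<^sub>v Xvec ?a = (c' * c) \<cdot>\<^sub>v vec2 1 (xvec_sign ?a)"
    unfolding Umat_def d c' mat_smult_vec[OF Wprod_carrier vec2_carrier] c by (simp add: smult_vec2 mult.assoc)
  have "1 + cnj (xvec_sign (alpha e)) * xvec_sign ?a = 0"
    using ne Opar_exc[OF e] Opar_exc[OF prev_exc_mem[OF e']] by (auto simp: xvec_sign_def)
  then show ?thesis unfolding U_cond_def U cdot_Xvec_eq_0_iff by simp
qed

end

section \<open>Quasi-eigenvalue multiplicities as kernel dimensions\<close>

context polygon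
begin

lemma kernel_family_qmult:
  assumes \<sigma>: "0 \<le> \<sigma>"
  shows "\<exists>\<kappa>. kernel_family (\<sigma>\<^sup>2) (qmult n alpha ell \<sigma>) \<kappa>"
proof (cases "exc_set n alpha = {}")
  case True
  then have ne: "\<not> exc i" if "i \<in> {1..n}" for i using that by (auto simp: exc_set_eq)
  show ?thesis
  proof (cases "\<sigma> = 0")
    case 0: True
    show ?thesis using regular_zero[OF ne] by (simp add: qmult_def True 0)
  next
    case False
    then show ?thesis using regular_positive[OF ne, of \<sigma>] \<sigma> by (simp add: qmult_def True)
  qed
next
  case False
  interpret exceptional_polygon n alpha ell
    by unfold_locales (rule False)
  show ?thesis
  proof (cases "\<sigma> = 0")
    case True
    let ?D = "{e \<in> exc_set n alpha. Opar (alpha (prev_exc n alpha e)) \<noteq> Opar (alpha e)}"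
    have "{e \<in> exc_set n alpha. end_cond 0 e} =
        {e \<in> exc_set n alpha. Opar (alpha (prev_exc n alpha e)) = 1 \<and> Opar (alpha e) \<noteq> 1}"
      using end_cond_zero by blast
    then have "card {e \<in> exc_set n alpha. end_cond 0 e} = card ?D div 2"
      by (simp add: card_parity_changes)
    moreover have "card ?D = 0" if "\<not> (\<exists>e\<in>exc_set n alpha. U_cond n alpha ell e 0)"
    proof -
      have "?D = {}" using that U_cond_zero by blast
      then show ?thesis by (simp only: card.empty)
    qed
    ultimately have "qmult n alpha ell 0 = card {e \<in> exc_set n alpha. end_cond 0 e}"
      using False by (auto simp: qmult_def)
    then show ?thesis using singular_kernel_family[OF order_refl] True by simp
  next
    case pos: False
    have "{e \<in> exc_set n alpha. U_cond n alpha ell e \<sigma>} = {e \<in> exc_set n alpha. end_cond (\<sigma>\<^sup>2) e}"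
      using U_cond_iff pos \<sigma> by auto
    then have "qmult n alpha ell \<sigma> = card {e \<in> exc_set n alpha. end_cond (\<sigma>\<^sup>2) e}"
      using pos \<sigma> False by (simp add: qmult_def)
    then show ?thesis using singular_kernel_family[OF zero_le_power2] by simp
  qed
qed

sublocale spectral_count fun_scale V M D "qmult n alpha ell"
proof (intro spectral_count.intro spectral_count_axioms.intro)
  show "form_pair fun_scale V M D" by unfold_locales
  show "reducible l" if "0 \<le> l" for l using that by (rule reducible_graph)
  show "\<exists>\<kappa>. kernel_family (\<sigma>\<^sup>2) (qmult n alpha ell \<sigma>) \<kappa>" if "0 \<le> \<sigma>" for \<sigma>
    using that by (rule kernel_family_qmult)
  show "\<exists>l. negative l m" for m by (rule unbounded)
qed

end

theorem theorem2p18: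
  fixes n :: nat and alpha ell :: "nat \<Rightarrow> real"
  assumes "n \<ge> 1"
    and "\<forall>j\<in>{1..n}. 0 < alpha j \<and> alpha j < pi"
    and "\<forall>j\<in>{1..n}. 0 < ell j"
  shows "\<forall>m\<ge>1. (quasi_eig n alpha ell m)^2 = graph_eig n alpha ell m"
proof -
  interpret polygon n alpha ell
    by unfold_locales (use assms in auto)
  show ?thesis
    unfolding quasi_eig_def qcount_def graph_eig_eq by (intro allI impI counting_eq_minmax)
qed

end
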